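(* Let $X,Y,A,\Sigma,\alpha,\gamma,\nu,s,u_0,u^\dagger$ and the averaged 3DVAR iterates $\bar u_n$ be as described in the context, and assume: (1) $\Sigma$ is a self-adjoint positive definite trace class operator on $X$ with $\Sigma^{-1}$ densely defined, $\operatorname{Ran}(\Sigma^{1/2})\subset\operatorname{Dom}(A)$, and $\alpha>0$; (2) there are constants $C>1$, $\nu>0$ with $C^{-1}\|x\|_\nu\le\|Ax\|\le C\|x\|_\nu$ for all $x$; (3) $u_0-u^\dagger\in\operatorname{Dom}(\Sigma^{-s/2})$ with $0\le s\le\nu+2$. Fix $t\in[0,\nu]$ and $\tau_{\rm v}\in[0,1]$, and assume that $\Sigma^{t+1-\tau_{\rm v}(1+\nu)}$ is trace class. Then for all $n\ge 1$, $$\mathbb{E}\left[\|\bar u_n-u^\dagger\|_t^2\right]\lesssim\left(\frac{n}{\alpha}\right)^{-\frac{s+t}{1+\nu}}\|z_0\|^2+\frac{\gamma^2}{\alpha}\operatorname{Tr}\left(\Sigma^{t+1-\tau_{\rm v}(1+\nu)}\right)\left(\frac{n}{\alpha}\right)^{-\tau_{\rm v}},$$ where $z_0\in X$ is the solution of $$\Sigma^{-1/2}(u_0-u^\dagger)=(B^*B)^{\frac{s-1}{2(1+\nu)}}z_0,\qquad B=A\Sigma^{1/2}.$$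
   Context: $X,Y$ are separable Hilbert spaces, $A:X\to Y$ is a compact linear operator, $u^\dagger\in X$, $\gamma>0$. The noises $\eta_1,\eta_2,\dots$ are i.i.d. white noise $N(0,\gamma^2I)$ on $Y$ (cylindrical Gaussians when $\dim Y=\infty$, so $\mathbb{E}\|T\eta_k\|^2=\gamma^2\operatorname{Tr}(TT^* )$ for Hilbert–Schmidt $T$), and $y_k=Au^\dagger+\eta_k$. The operator $\Sigma$ induces a Hilbert scale, with norms $\|x\|_r=\|\Sigma^{r/2}x\|$. 3DVAR: $u_0\in X$ is deterministic and $u_n=\mathcal{K}y_n+(I-\mathcal{K}A)u_{n-1}$ with $\mathcal{K}=(A^*A+\alpha\Sigma^{-1})^{-1}A^*$, i.e. $\mathcal{K}=\Sigma^{1/2}(\alpha I+B^*B)^{-1}B^*$ where $B=A\Sigma^{1/2}$. Iterate average: $\bar u_n=\frac1n\sum_{k=1}^nu_k$. When $s<1$, the equation for $z_0$ is understood in the Hilbert scale: $\Sigma^{-1/2}(u_0-u^\dagger)$ belongs to the completion of $X$ under $\|\cdot\|_{1-s}$, and $z_0=(B^*B)^{\frac{1-s}{2(1+\nu)}}\Sigma^{-1/2}(u_0-u^\dagger)$ with $(B^*B)^{\frac{1-s}{2(1+\nu)}}$ extended by continuity to that completion. $a\lesssim b$ means $a\le C'b$ with a constant $C'$ that may depend on $A,\Sigma,\nu,s,t,\tau_{\rm v}$ but not on $n,\alpha,\gamma,u_0,u^\dagger$. *)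

theory Defs
  imports "HOL-Probability.Probability"
begin

section \<open>Operators on real Hilbert spaces\<close>

definition compact_operator ::
  "('a::real_normed_vector \<Rightarrow> 'b::real_normed_vector) \<Rightarrow> bool" where
  "compact_operator T \<longleftrightarrow> linear T \<and> compact (closure (T ` cball 0 1))"

definition selfadjoint :: "('a::real_inner \<Rightarrow> 'a) \<Rightarrow> bool" where
  "selfadjoint T \<longleftrightarrow> bounded_linear T \<and> (\<forall>x y. T x \<bullet> y = x \<bullet> T y)"

definition positive_definite :: "('a::real_inner \<Rightarrow> 'a) \<Rightarrow> bool" where
  "positive_definite T \<longleftrightarrow> (\<forall>x. x \<noteq> 0 \<longrightarrow> T x \<bullet> x > 0)"

text \<open>Orthonormal bases are sets of vectors, so that finite-dimensional and
  infinite-dimensional spaces are treated alike.\<close>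

definition hilbert_basis :: "'a::real_inner set \<Rightarrow> bool" where
  "hilbert_basis E \<longleftrightarrow>
     (\<forall>e\<in>E. norm e = 1) \<and> pairwise orthogonal E \<and> closure (span E) = UNIV"

text \<open>The trace class condition is used for positive self-adjoint operators only; for these
  \<open>|T| = T\<close>, and neither summability nor the value of the trace depends on the basis.\<close>

definition positive_trace_class :: "('a::real_inner \<Rightarrow> 'a) \<Rightarrow> bool" where
  "positive_trace_class T \<longleftrightarrow> selfadjoint T \<and> (\<forall>x. T x \<bullet> x \<ge> 0) \<and>
     (\<forall>E. hilbert_basis E \<longrightarrow> (\<lambda>e. T e \<bullet> e) summable_on E)"

definition op_trace :: "('a::real_inner \<Rightarrow> 'a) \<Rightarrow> real" where
  "op_trace T = (\<Sum>\<^sub>\<infinity>e\<in>(SOME E. hilbert_basis E). T e \<bullet> e)"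

text \<open>Real powers of a compact, injective, positive self-adjoint operator, by its spectral
  decomposition \<open>T x = \<Sum>e. \<lambda>\<^sub>e \<langle>x,e\<rangle> e\<close> with \<open>\<lambda>\<^sub>e = \<langle>T e,e\<rangle> > 0\<close>. The result does not depend on the
  chosen eigenbasis. For negative exponents the operator is unbounded in infinite dimensions:
  the value of \<open>op_powr T r\<close> is meaningful on \<open>op_powr_dom T r\<close> only. For exponents
  \<open>r \<ge> 0\<close> this domain is the whole space.\<close>

definition eigenbasis :: "('a::real_inner \<Rightarrow> 'a) \<Rightarrow> 'a set" where
  "eigenbasis T = (SOME E. hilbert_basis E \<and> (\<forall>e\<in>E. \<exists>c. T e = c *\<^sub>R e))"

definition op_powr_dom :: "('a::real_inner \<Rightarrow> 'a) \<Rightarrow> real \<Rightarrow> 'a set" where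
  "op_powr_dom T r =
     {x. (\<lambda>e. ((T e \<bullet> e) powr r * (x \<bullet> e))\<^sup>2) summable_on eigenbasis T}"

definition op_powr :: "('a::real_inner \<Rightarrow> 'a) \<Rightarrow> real \<Rightarrow> 'a \<Rightarrow> 'a" where
  "op_powr T r x = (\<Sum>\<^sub>\<infinity>e\<in>eigenbasis T. ((T e \<bullet> e) powr r * (x \<bullet> e)) *\<^sub>R e)"

section \<open>The Hilbert scale induced by an operator\<close>

definition scale_norm :: "('a::real_inner \<Rightarrow> 'a) \<Rightarrow> real \<Rightarrow> 'a \<Rightarrow> real" where
  "scale_norm S r x = norm (op_powr S (r / 2) x)"

text \<open>For \<open>r \<ge> 0\<close>: the completion of the space under \<open>scale_norm S r\<close>, as the set of classes
  of Cauchy sequences.\<close>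

definition scale_Cauchy :: "('a::real_inner \<Rightarrow> 'a) \<Rightarrow> real \<Rightarrow> (nat \<Rightarrow> 'a) \<Rightarrow> bool" where
  "scale_Cauchy S r \<xi> \<longleftrightarrow>
     (\<forall>e>0. \<exists>N. \<forall>m\<ge>N. \<forall>n\<ge>N. scale_norm S r (\<xi> m - \<xi> n) < e)"

definition scale_equiv ::
  "('a::real_inner \<Rightarrow> 'a) \<Rightarrow> real \<Rightarrow> ((nat \<Rightarrow> 'a) \<times> (nat \<Rightarrow> 'a)) set" where
  "scale_equiv S r = {(\<xi>, \<zeta>). scale_Cauchy S r \<xi> \<and> scale_Cauchy S r \<zeta> \<and>
     (\<lambda>m. scale_norm S r (\<xi> m - \<zeta> m)) \<longlonglongrightarrow> 0}"

definition scale_completion :: "('a::real_inner \<Rightarrow> 'a) \<Rightarrow> real \<Rightarrow> (nat \<Rightarrow> 'a) set set" where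
  "scale_completion S r = {\<xi>. scale_Cauchy S r \<xi>} // scale_equiv S r"

text \<open>For \<open>s < 1\<close> and \<open>w \<in> Dom(S\<^sup>-\<^sup>s\<^sup>/\<^sup>2)\<close>: the element \<open>S\<^sup>-\<^sup>1\<^sup>/\<^sup>2 w\<close> of the completion under
  \<open>scale_norm S (1 - s)\<close>. Since the norm of \<open>x\<close> with index \<open>1 - s\<close> equals the norm of
  \<open>S\<^sup>1\<^sup>/\<^sup>2 x\<close> with index \<open>- s\<close>, it is the class of the sequences \<open>\<xi>\<close> for which \<open>S\<^sup>1\<^sup>/\<^sup>2 \<xi>\<^sub>m\<close> tends to
  \<open>w\<close> in the latter norm.\<close>

definition scale_inv_sqrt :: "('a::real_inner \<Rightarrow> 'a) \<Rightarrow> real \<Rightarrow> 'a \<Rightarrow> (nat \<Rightarrow> 'a) set" where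
  "scale_inv_sqrt S s w =
     {\<xi>. (\<lambda>m. scale_norm S (- s) (op_powr S (1 / 2) (\<xi> m) - w)) \<longlonglongrightarrow> 0}"

text \<open>\<open>z\<close> solves \<open>S\<^sup>-\<^sup>1\<^sup>/\<^sup>2 w = (B\<^sup>*B)\<^sup>p z\<close> with \<open>p = (s - 1) / (2 (1 + \<nu>))\<close> and \<open>B = A S\<^sup>1\<^sup>/\<^sup>2\<close>.
  For \<open>s < 1\<close> this means \<open>z = (B\<^sup>*B)\<^sup>-\<^sup>p S\<^sup>-\<^sup>1\<^sup>/\<^sup>2 w\<close>, where \<open>(B\<^sup>*B)\<^sup>-\<^sup>p\<close> is extended by continuity
  to the completion: its value at a class is the common limit along all sequences of the class.\<close>

definition source_solution ::
  "('a::real_inner \<Rightarrow> 'b::real_inner) \<Rightarrow> ('a \<Rightarrow> 'a) \<Rightarrow> real \<Rightarrow> real \<Rightarrow> 'a \<Rightarrow> 'a \<Rightarrow> bool" where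
  "source_solution A S \<nu> s w z \<longleftrightarrow>
     (let B = A \<circ> op_powr S (1 / 2); G = adjoint B \<circ> B in
      if s \<ge> 1 then
        w \<in> op_powr_dom S (- 1 / 2) \<and>
        op_powr S (- 1 / 2) w = op_powr G ((s - 1) / (2 * (1 + \<nu>))) z
      else
        scale_inv_sqrt S s w \<in> scale_completion S (1 - s) \<and>
        (\<forall>\<xi>\<in>scale_inv_sqrt S s w.
           (\<lambda>m. op_powr G ((1 - s) / (2 * (1 + \<nu>))) (\<xi> m)) \<longlonglongrightarrow> z))"

section \<open>White noise and 3DVAR\<close>

text \<open>Cylindrical random elements \<open>W\<close> of a Hilbert space are given by the random variables
  \<open>W h = \<langle>W,h\<rangle>\<close>. White noise \<open>N(0,\<gamma>\<^sup>2 I)\<close> is linear in \<open>h\<close> almost surely, with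
  \<open>\<langle>W,h\<rangle>\<close> distributed as \<open>N(0,\<gamma>\<^sup>2 \<parallel>h\<parallel>\<^sup>2)\<close>. For \<open>h = 0\<close>, linearity gives \<open>W 0 = 0\<close> almost surely.\<close>

definition white_noise :: "'w measure \<Rightarrow> real \<Rightarrow> ('b::real_inner \<Rightarrow> 'w \<Rightarrow> real) \<Rightarrow> bool" where
  "white_noise M \<gamma> W \<longleftrightarrow>
     (\<forall>h. W h \<in> borel_measurable M) \<and>
     (\<forall>a b g h. AE \<omega> in M. W (a *\<^sub>R g + b *\<^sub>R h) \<omega> = a * W g \<omega> + b * W h \<omega>) \<and>
     (\<forall>h. h \<noteq> 0 \<longrightarrow>
        distributed M lborel (W h) (\<lambda>x. ennreal (normal_density 0 (\<gamma> * norm h) x)))"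

text \<open>The sequence is indexed from 1. Independence is that of the whole families
  \<open>(\<langle>\<eta>\<^sub>k,h\<rangle>)\<^sub>h\<close>, \<open>k \<ge> 1\<close>.\<close>

definition iid_white_noise ::
  "'w measure \<Rightarrow> real \<Rightarrow> (nat \<Rightarrow> 'b::real_inner \<Rightarrow> 'w \<Rightarrow> real) \<Rightarrow> bool" where
  "iid_white_noise M \<gamma> \<eta> \<longleftrightarrow>
     (\<forall>k\<ge>1. white_noise M \<gamma> (\<eta> k)) \<and>
     prob_space.indep_vars M (\<lambda>_. \<Pi>\<^sub>M h\<in>UNIV. borel) (\<lambda>k \<omega> h. \<eta> k h \<omega>) {1..}"

definition observation ::
  "('a::real_inner \<Rightarrow> 'b::real_inner) \<Rightarrow> 'a \<Rightarrow> ('b \<Rightarrow> 'w \<Rightarrow> real) \<Rightarrow> 'b \<Rightarrow> 'w \<Rightarrow> real" where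
  "observation A u\<^sub>d W h \<omega> = A u\<^sub>d \<bullet> h + W h \<omega>"

text \<open>\<open>Z\<close> is (a version of) the \<open>'a\<close>-valued random variable \<open>T W\<close>, i.e.
  \<open>\<langle>T W,x\<rangle> = \<langle>W,T\<^sup>* x\<rangle>\<close> almost surely for every \<open>x\<close>.\<close>

definition cylindrical_image ::
  "'w measure \<Rightarrow> ('b::real_inner \<Rightarrow> 'a::real_inner) \<Rightarrow> ('b \<Rightarrow> 'w \<Rightarrow> real) \<Rightarrow> ('w \<Rightarrow> 'a) \<Rightarrow> bool"
  where
  "cylindrical_image M T W Z \<longleftrightarrow>
     Z \<in> borel_measurable M \<and> (\<forall>x. AE \<omega> in M. Z \<omega> \<bullet> x = W (adjoint T x) \<omega>)"

definition kalman_gain ::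
  "('a::real_inner \<Rightarrow> 'b::real_inner) \<Rightarrow> ('a \<Rightarrow> 'a) \<Rightarrow> real \<Rightarrow> 'b \<Rightarrow> 'a" where
  "kalman_gain A S \<alpha> =
     (let B = A \<circ> op_powr S (1 / 2) in
      op_powr S (1 / 2) \<circ> inv (\<lambda>x. \<alpha> *\<^sub>R x + adjoint B (B x)) \<circ> adjoint B)"

definition threedvar ::
  "'w measure \<Rightarrow> ('a::real_inner \<Rightarrow> 'b::real_inner) \<Rightarrow> ('a \<Rightarrow> 'a) \<Rightarrow> real \<Rightarrow> 'a \<Rightarrow>
     (nat \<Rightarrow> 'b \<Rightarrow> 'w \<Rightarrow> real) \<Rightarrow> (nat \<Rightarrow> 'w \<Rightarrow> 'a) \<Rightarrow> bool" where
  "threedvar M A S \<alpha> u\<^sub>0 y u \<longleftrightarrow>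
     (let K = kalman_gain A S \<alpha> in
      (\<forall>\<omega>. u 0 \<omega> = u\<^sub>0) \<and>
      (\<exists>Ky. \<forall>n\<ge>1. cylindrical_image M K (y n) (Ky n) \<and>
         (\<forall>\<omega>. u n \<omega> = Ky n \<omega> + (u (n - 1) \<omega> - K (A (u (n - 1) \<omega>))))))"

definition iterate_average :: "(nat \<Rightarrow> 'w \<Rightarrow> 'a::real_vector) \<Rightarrow> nat \<Rightarrow> 'w \<Rightarrow> 'a" where
  "iterate_average u n \<omega> = (1 / real n) *\<^sub>R (\<Sum>k=1..n. u k \<omega>)"

end

theory Submission
  imports Defs
begin

text \<open>
  Write \<open>S\<close> for \<open>\<Sigma>\<close>, \<open>B = A S\<^sup>1\<^sup>/\<^sup>2\<close> and \<open>G = B\<^sup>* B\<close>. The propagator \<open>L = I - K A\<close> of the error satisfies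
  \<open>L S\<^sup>1\<^sup>/\<^sup>2 = S\<^sup>1\<^sup>/\<^sup>2 \<alpha> (\<alpha> + G)\<^sup>-\<^sup>1\<close>, so on the range of \<open>S\<^sup>1\<^sup>/\<^sup>2\<close> everything that happens in the iteration is a
  function of \<open>G\<close>. The averaged error is the average of \<open>L\<^sup>k (u\<^sub>0 - u\<^sub>d)\<close>, \<open>1 \<le> k \<le> n\<close>, plus a linear
  combination of the noises.

  The error is measured with powers of \<open>S\<close>, while the filters are functions of \<open>G\<close>, and the two operators
  do not commute. The link condition says that \<open>\<parallel>B x\<parallel>\<close> is comparable to the norm of \<open>S\<^sup>(\<^sup>1\<^sup>+\<^sup>\<nu>\<^sup>)\<^sup>/\<^sup>2 x\<close>, and the
  Heinz inequality (\<open>heinz_inequality\<close>) carries this over to the powers of order \<open>\<theta> \<in> [0,1]\<close>: the norm of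
  \<open>G\<^sup>\<theta>\<^sup>/\<^sup>2 x\<close> is comparable to that of \<open>S\<^sup>\<theta>\<^sup>(\<^sup>1\<^sup>+\<^sup>\<nu>\<^sup>)\<^sup>/\<^sup>2 x\<close> (\<open>S_le_G\<close>, \<open>G_le_S\<close>). By duality the range of the latter
  power of \<open>S\<close> lies in the domain of \<open>G\<^sup>-\<^sup>\<theta>\<^sup>/\<^sup>2\<close> (\<open>S_range_in_G_range\<close>). The restrictions \<open>s \<le> \<nu> + 2\<close>, \<open>t \<le> \<nu>\<close> and
  \<open>\<tau> \<le> 1\<close> keep all the orders \<open>\<theta>\<close> that occur in the unit interval.

  These comparisons give existence and uniqueness of the source element \<open>z\<^sub>0\<close>, and they reduce the two
  parts of the error to scalar inequalities. For the deterministic part (\<open>bias_bound\<close>), the average of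
  \<open>(\<alpha> / (\<alpha> + \<rho>))\<^sup>k\<close> over \<open>1 \<le> k \<le> n\<close> is at most \<open>min 1 (\<alpha> / (n \<rho>))\<close>, hence at most \<open>(\<alpha> / (n \<rho>))\<^sup>q\<close> for \<open>0 \<le> q \<le> 1\<close>.
  For the random part (\<open>noise_second_moment\<close>), the variance of the component along an eigenvector of \<open>S\<close>
  with eigenvalue \<open>\<sigma>\<close> is computed from independence and is bounded by a multiple of
  \<open>\<gamma>\<^sup>2 / \<alpha> (n / \<alpha>)\<^sup>-\<^sup>\<tau>\<close> times the power of \<open>\<sigma>\<close> of order \<open>t + 1 - \<tau> (1 + \<nu>)\<close>; the sum over the eigenbasis is the trace.

  Powers of operators are defined through eigenbases, so the theory rests on orthonormal expansions
  and on the spectral theorem for positive compact operators. The Heinz inequality is obtained from the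
  resolvent functions \<open>\<lambda> \<mu> / (\<lambda> + \<mu>)\<close>, for which it is a variational statement, by integration over \<open>\<mu>\<close>.
\<close>

section \<open>Orthonormal expansions\<close>

definition orthonormal :: "'a::real_inner set \<Rightarrow> bool" where
  "orthonormal E \<longleftrightarrow> (\<forall>e\<in>E. norm e = 1) \<and> pairwise orthogonal E"

lemma hilbert_basis_orthonormal: "hilbert_basis E \<Longrightarrow> orthonormal E"
  by (simp add: hilbert_basis_def orthonormal_def)

lemma orthonormal_inner:
  assumes "orthonormal E" "e \<in> E" "f \<in> E"
  shows "e \<bullet> f = (if e = f then 1 else 0)"
  using assms by (auto simp: orthonormal_def pairwise_def orthogonal_def dot_square_norm)

lemma inner_orthonormal_sum:
  assumes "orthonormal E" "finite F" "F \<subseteq> E" "f \<in> E"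
  shows "(\<Sum>e\<in>F. c e *\<^sub>R e) \<bullet> f = (if f \<in> F then c f else 0)"
proof -
  have "(\<Sum>e\<in>F. c e *\<^sub>R e) \<bullet> f = (\<Sum>e\<in>F. if e = f then c e else 0)"
    unfolding inner_sum_left using assms
    by (intro sum.cong) (auto simp: orthonormal_inner[OF assms(1)] subset_iff)
  then show ?thesis using assms(2) by simp
qed

lemma norm_orthonormal_sum:
  assumes "orthonormal E" "finite F" "F \<subseteq> E"
  shows "(norm (\<Sum>e\<in>F. c e *\<^sub>R e))\<^sup>2 = (\<Sum>e\<in>F. (c e)\<^sup>2)"
proof -
  have "(norm (\<Sum>e\<in>F. c e *\<^sub>R e))\<^sup>2 = (\<Sum>f\<in>F. c f * ((\<Sum>e\<in>F. c e *\<^sub>R e) \<bullet> f))"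
    by (simp add: power2_norm_eq_inner inner_sum_right)
  also have "\<dots> = (\<Sum>f\<in>F. c f * c f)"
    using assms by (intro sum.cong refl) (simp add: inner_orthonormal_sum subset_iff)
  finally show ?thesis by (simp add: power2_eq_square)
qed

lemma norm_minus_projection:
  assumes "orthonormal E" "finite F" "F \<subseteq> E"
  shows "(norm (x - (\<Sum>e\<in>F. (x \<bullet> e) *\<^sub>R e)))\<^sup>2 = (norm x)\<^sup>2 - (\<Sum>e\<in>F. (x \<bullet> e)\<^sup>2)"
proof -
  let ?p = "\<Sum>e\<in>F. (x \<bullet> e) *\<^sub>R e"
  have "x \<bullet> ?p = (\<Sum>e\<in>F. (x \<bullet> e)\<^sup>2)" by (simp add: inner_sum_right power2_eq_square)
  moreover have "?p \<bullet> ?p = (\<Sum>e\<in>F. (x \<bullet> e)\<^sup>2)"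
    using norm_orthonormal_sum[OF assms, of "\<lambda>e. x \<bullet> e"] by (simp add: power2_norm_eq_inner)
  ultimately show ?thesis
    by (simp add: power2_norm_eq_inner inner_diff_left inner_diff_right inner_commute)
qed

lemma bessel_finite:
  assumes "orthonormal E" "finite F" "F \<subseteq> E"
  shows "(\<Sum>e\<in>F. (x \<bullet> e)\<^sup>2) \<le> (norm x)\<^sup>2"
  using norm_minus_projection[OF assms, of x] zero_le_power2[of "norm (x - (\<Sum>e\<in>F. (x \<bullet> e) *\<^sub>R e))"]
  by linarith

lemma bessel_summable:
  assumes "orthonormal E"
  shows "(\<lambda>e. (x \<bullet> e)\<^sup>2) summable_on E"
  by (rule nonneg_bounded_partial_sums_imp_summable_on[where C = "(norm x)\<^sup>2"])
     (auto simp: eventually_finite_subsets_at_top intro!: exI[of _ "{}"] bessel_finite[OF assms])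

text \<open>Square summable coefficients give an unconditionally convergent sum: by Pythagoras the
  tails over finite sets are controlled by the tails of the sum of squares, so the partial sums
  along suitable finite sets form a Cauchy sequence, and its limit is the sum.\<close>

lemma orthonormal_summable:
  fixes E :: "'a::{real_inner, complete_space} set"
  assumes E: "orthonormal E" and c: "(\<lambda>e. (c e)\<^sup>2) summable_on E"
  shows "(\<lambda>e. c e *\<^sub>R e) summable_on E"
proof -
  let ?L = "infsum (\<lambda>e. (c e)\<^sup>2) E"
  have ex: "\<exists>F. finite F \<and> F \<subseteq> E \<and> ?L - (\<Sum>e\<in>F. (c e)\<^sup>2) < d" if d: "d > 0" for d
  proof -
    obtain F where "finite F" "F \<subseteq> E" "dist (\<Sum>e\<in>F. (c e)\<^sup>2) ?L \<le> d / 2"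
      using infsum_finite_approximation[OF c half_gt_zero[OF d]] by blast
    then have "?L - (\<Sum>e\<in>F. (c e)\<^sup>2) < d" using d unfolding dist_real_def by linarith
    then show ?thesis using \<open>finite F\<close> \<open>F \<subseteq> E\<close> by blast
  qed
  have tail: "norm ((\<Sum>e\<in>H. c e *\<^sub>R e) - (\<Sum>e\<in>F. c e *\<^sub>R e)) < d"
    if F: "finite F" "F \<subseteq> E" "?L - (\<Sum>e\<in>F. (c e)\<^sup>2) < d\<^sup>2" and H: "finite H" "F \<subseteq> H" "H \<subseteq> E" and d: "d > 0"
    for F H d
  proof -
    have "(\<Sum>e\<in>H. c e *\<^sub>R e) - (\<Sum>e\<in>F. c e *\<^sub>R e) = (\<Sum>e\<in>H - F. c e *\<^sub>R e)"
      using H F by (simp add: sum_diff)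
    then have "(norm ((\<Sum>e\<in>H. c e *\<^sub>R e) - (\<Sum>e\<in>F. c e *\<^sub>R e)))\<^sup>2 = (\<Sum>e\<in>H - F. (c e)\<^sup>2)"
      using norm_orthonormal_sum[OF E, of "H - F" c] H by auto
    also have "\<dots> = (\<Sum>e\<in>H. (c e)\<^sup>2) - (\<Sum>e\<in>F. (c e)\<^sup>2)"
      using H F by (simp add: sum_diff)
    also have "\<dots> \<le> ?L - (\<Sum>e\<in>F. (c e)\<^sup>2)"
      using finite_sum_le_infsum[OF c, of H] H by simp
    also have "\<dots> < d\<^sup>2" by (rule F)
    finally show ?thesis using d by (simp add: power_less_imp_less_base)
  qed
  define G where "G d = (SOME F. finite F \<and> F \<subseteq> E \<and> ?L - (\<Sum>e\<in>F. (c e)\<^sup>2) < d\<^sup>2)" for d :: real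
  have G: "finite (G d) \<and> G d \<subseteq> E \<and> ?L - (\<Sum>e\<in>G d. (c e)\<^sup>2) < d\<^sup>2" if "d > 0" for d
    unfolding G_def by (rule someI_ex[OF ex]) (use that in simp)
  define X where "X n = (\<Sum>e\<in>G (1 / Suc n). c e *\<^sub>R e)" for n
  have near: "norm ((\<Sum>e\<in>H. c e *\<^sub>R e) - X n) < 1 / Suc n"
    if "finite H" "G (1 / Suc n) \<subseteq> H" "H \<subseteq> E" for H n
    unfolding X_def using G[of "1 / Suc n"] that by (intro tail[OF _ _ _ that]) simp_all
  have "Cauchy X"
  proof (rule metric_CauchyI)
    fix d :: real assume "d > 0"
    then obtain N where N: "1 / Suc N < d / 2" using nat_approx_posE[of "d/2"] by auto
    show "\<exists>N. \<forall>m\<ge>N. \<forall>n\<ge>N. dist (X m) (X n) < d"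
    proof (intro exI allI impI)
      fix m n assume mn: "m \<ge> N" "n \<ge> N"
      let ?H = "G (1 / Suc m) \<union> G (1 / Suc n)"
      have H: "finite ?H" "?H \<subseteq> E" using G[of "1 / Suc m"] G[of "1 / Suc n"] by auto
      have le: "1 / Suc k \<le> 1 / Suc N" if "k \<ge> N" for k
        using that by (simp add: frac_le)
      have "dist (X m) (X n) \<le> norm ((\<Sum>e\<in>?H. c e *\<^sub>R e) - X m) + norm ((\<Sum>e\<in>?H. c e *\<^sub>R e) - X n)"
        using dist_triangle[of "X m" "X n" "\<Sum>e\<in>?H. c e *\<^sub>R e"] by (simp add: dist_norm norm_minus_commute)
      also have "\<dots> < 1 / Suc m + 1 / Suc n"
        using near[OF H(1) _ H(2), of m] near[OF H(1) _ H(2), of n] by auto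
      also have "\<dots> < d" using le[OF mn(1)] le[OF mn(2)] N by linarith
      finally show "dist (X m) (X n) < d" .
    qed
  qed
  then obtain y where y: "X \<longlonglongrightarrow> y" using Cauchy_convergent_iff convergent_def by blast
  have "((\<lambda>e. c e *\<^sub>R e) has_sum y) E"
    unfolding has_sum_def tendsto_iff
  proof (intro allI impI)
    fix d :: real assume "d > 0"
    then obtain N where N: "1 / Suc N < d / 2" using nat_approx_posE[of "d/2"] by auto
    obtain K where K: "\<And>n. n \<ge> K \<Longrightarrow> dist (X n) y < d / 2"
      using metric_LIMSEQ_D[OF y, of "d / 2"] \<open>d > 0\<close> by auto
    define n where "n = max N K"
    have n: "1 / Suc n < d / 2" "dist (X n) y < d / 2"
      using N K[of n] frac_le[of 1 1 "real (Suc N)" "Suc n"] unfolding n_def by auto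
    show "\<forall>\<^sub>F H in finite_subsets_at_top E. dist (\<Sum>e\<in>H. c e *\<^sub>R e) y < d"
      unfolding eventually_finite_subsets_at_top
    proof (intro exI[of _ "G (1 / Suc n)"] conjI allI impI)
      show "finite (G (1 / Suc n))" "G (1 / Suc n) \<subseteq> E" using G[of "1 / Suc n"] by auto
      fix H assume "finite H \<and> G (1 / Suc n) \<subseteq> H \<and> H \<subseteq> E"
      then have "dist (\<Sum>e\<in>H. c e *\<^sub>R e) (X n) < 1 / Suc n" using near by (auto simp: dist_norm)
      then show "dist (\<Sum>e\<in>H. c e *\<^sub>R e) y < d"
        using n dist_triangle[of "\<Sum>e\<in>H. c e *\<^sub>R e" y "X n"] by linarith
    qed
  qed
  then show ?thesis by (rule has_sum_imp_summable)
qed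

lemma has_sum_inner:
  assumes "((\<lambda>e. c e *\<^sub>R e) has_sum y) E"
  shows "((\<lambda>e. c e * (e \<bullet> x)) has_sum (y \<bullet> x)) E"
  using has_sum_bounded_linear[OF bounded_linear_inner_left[of x] assms] by (simp add: comp_def)

lemma inner_orthonormal_has_sum:
  assumes E: "orthonormal E" and y: "((\<lambda>e. c e *\<^sub>R e) has_sum y) E" and f: "f \<in> E"
  shows "y \<bullet> f = c f"
proof -
  have "((\<lambda>e. c e * (e \<bullet> f)) has_sum (\<Sum>e\<in>{f}. c e * (e \<bullet> f))) E"
    by (rule has_sum_finite_neutralI[where B = "{f}"])
       (use f in \<open>auto simp: orthonormal_inner[OF E] split: if_splits\<close>)
  then show ?thesis
    using has_sum_unique[OF has_sum_inner[OF y, of f]] f orthonormal_inner[OF E f f] by auto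
qed

lemma norm_orthonormal_has_sum:
  assumes E: "orthonormal E" and y: "((\<lambda>e. c e *\<^sub>R e) has_sum y) E"
  shows "((\<lambda>e. (c e)\<^sup>2) has_sum (norm y)\<^sup>2) E"
proof -
  have "((\<lambda>e. c e * (e \<bullet> y)) has_sum (y \<bullet> y)) E" by (rule has_sum_inner[OF y])
  moreover have "e \<bullet> y = c e" if "e \<in> E" for e
    using inner_orthonormal_has_sum[OF E y that] by (simp add: inner_commute)
  ultimately show ?thesis
    unfolding power2_norm_eq_inner by (simp add: power2_eq_square cong: has_sum_cong)
qed

lemma dense_orthogonal_eq_0:
  assumes E: "closure (span E) = UNIV" and x: "\<And>e. e \<in> E \<Longrightarrow> x \<bullet> e = 0"
  shows "x = 0"
proof -
  have "span E \<subseteq> {y. x \<bullet> y = 0}"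
    by (rule span_minimal) (auto simp: x subspace_def inner_add_right)
  then have "closure (span E) \<subseteq> {y. x \<bullet> y = 0}"
    by (rule closure_minimal) (intro closed_Collect_eq continuous_intros)
  then have "x \<bullet> x = 0" using E by blast
  then show ?thesis by simp
qed

lemma basis_eqI:
  assumes "hilbert_basis E" "\<And>e. e \<in> E \<Longrightarrow> x \<bullet> e = y \<bullet> e"
  shows "x = y"
  using dense_orthogonal_eq_0[of E "x - y"] assms by (auto simp: hilbert_basis_def inner_diff_left)

lemma projection_has_sum:
  fixes E :: "'a::{real_inner, complete_space} set"
  assumes E: "orthonormal E"
  obtains p where "((\<lambda>e. (x \<bullet> e) *\<^sub>R e) has_sum p) E" "\<And>e. e \<in> E \<Longrightarrow> (x - p) \<bullet> e = 0"
proof -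
  obtain p where p: "((\<lambda>e. (x \<bullet> e) *\<^sub>R e) has_sum p) E"
    using orthonormal_summable[OF E bessel_summable[OF E, of x]] summable_iff_has_sum_infsum by blast
  show ?thesis
    by (rule that[OF p]) (simp add: inner_diff_left inner_orthonormal_has_sum[OF E p])
qed

lemma basis_expansion:
  fixes E :: "'a::{real_inner, complete_space} set"
  assumes E: "hilbert_basis E"
  shows "((\<lambda>e. (x \<bullet> e) *\<^sub>R e) has_sum x) E"
proof -
  obtain p where p: "((\<lambda>e. (x \<bullet> e) *\<^sub>R e) has_sum p) E" "\<And>e. e \<in> E \<Longrightarrow> (x - p) \<bullet> e = 0"
    by (rule projection_has_sum[OF hilbert_basis_orthonormal[OF E], of x]) blast
  have "x = p" by (rule basis_eqI[OF E]) (use p(2) in \<open>simp add: inner_diff_left\<close>)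
  then show ?thesis using p(1) by simp
qed

lemma parseval:
  fixes E :: "'a::{real_inner, complete_space} set"
  assumes "hilbert_basis E"
  shows "((\<lambda>e. (x \<bullet> e)\<^sup>2) has_sum (norm x)\<^sup>2) E"
  by (rule norm_orthonormal_has_sum[OF hilbert_basis_orthonormal[OF assms] basis_expansion[OF assms]])

text \<open>A maximal orthonormal set of vectors with a given property; with the trivial property it
  is a Hilbert basis, with the property of being an eigenvector it is the candidate for an
  eigenbasis.\<close>

lemma maximal_orthonormal:
  fixes P :: "'a::real_inner \<Rightarrow> bool"
  obtains E where "orthonormal E" "\<forall>e\<in>E. P e"
    "\<And>x. norm x = 1 \<Longrightarrow> P x \<Longrightarrow> (\<And>e. e \<in> E \<Longrightarrow> x \<bullet> e = 0) \<Longrightarrow> False"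
proof -
  let ?\<A> = "{E. orthonormal E \<and> (\<forall>e\<in>E. P e)}"
  have "\<exists>M\<in>?\<A>. \<forall>X\<in>?\<A>. M \<subseteq> X \<longrightarrow> X = M"
  proof (rule subset_Zorn')
    fix \<C> assume C: "subset.chain ?\<A> \<C>"
    then have sub: "\<C> \<subseteq> ?\<A>" by (auto simp: subset.chain_def)
    have "pairwise orthogonal (\<Union>\<C>)"
    proof (rule pairwiseI)
      fix x y assume xy: "x \<in> \<Union>\<C>" "y \<in> \<Union>\<C>" and ne: "x \<noteq> y"
      from xy obtain X Y where XY: "X \<in> \<C>" "Y \<in> \<C>" "x \<in> X" "y \<in> Y" by blast
      then have "X \<subseteq> Y \<or> Y \<subseteq> X" using C unfolding subset.chain_def by blast
      then obtain Z where Z: "Z \<in> \<C>" "x \<in> Z" "y \<in> Z" using XY by blast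
      then have "orthonormal Z" using sub by blast
      then show "orthogonal x y" using Z ne by (auto simp: orthonormal_def pairwise_def)
    qed
    then show "\<Union>\<C> \<in> ?\<A>" using sub by (auto simp: orthonormal_def)
  qed
  then obtain E where E: "E \<in> ?\<A>" and max: "\<forall>X\<in>?\<A>. E \<subseteq> X \<longrightarrow> X = E" by (rule bexE)
  show ?thesis
  proof (rule that[of E])
    fix x assume x: "norm x = 1" "P x" and orth: "\<And>e. e \<in> E \<Longrightarrow> x \<bullet> e = 0"
    have orth': "orthogonal x e" "orthogonal e x" if "e \<in> E" for e
      using orth[OF that] by (simp_all add: orthogonal_def inner_commute)
    have "pairwise orthogonal (insert x E)"
      unfolding pairwise_insert using E orth' by (simp add: orthonormal_def)
    then have "insert x E \<in> ?\<A>" using E x(1,2) by (simp add: orthonormal_def)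
    then have "insert x E = E" by (rule max[rule_format]) (rule subset_insertI)
    then have "x \<in> E" by (metis insertI1)
    then have "x \<bullet> x = 0" by (rule orth)
    then show False using x by simp
  qed (use E in auto)
qed

text \<open>The difference of \<open>x\<close> and its projection is orthogonal to \<open>E\<close>; if this forces it to vanish, then
  \<open>x\<close> is a limit of finite combinations of elements of \<open>E\<close>.\<close>

lemma complete_orthonormal:
  fixes E :: "'a::{real_inner, complete_space} set"
  assumes E: "orthonormal E" and complete: "\<And>x. (\<And>e. e \<in> E \<Longrightarrow> x \<bullet> e = 0) \<Longrightarrow> x = 0"
  shows "hilbert_basis E"
proof -
  have "x \<in> closure (span E)" for x
  proof -
    obtain p where p: "((\<lambda>e. (x \<bullet> e) *\<^sub>R e) has_sum p) E" "\<And>e. e \<in> E \<Longrightarrow> (x - p) \<bullet> e = 0"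
      by (rule projection_has_sum[OF E, of x]) blast
    have "x - p = 0" by (rule complete) (rule p(2))
    then have "((\<lambda>e. (x \<bullet> e) *\<^sub>R e) has_sum x) E" using p(1) by simp
    then have "x \<in> closure ((\<lambda>F. \<Sum>e\<in>F. (x \<bullet> e) *\<^sub>R e) ` {F. finite F \<and> F \<subseteq> E})"
      using has_sum_finite_approximation unfolding closure_approachable
      by (smt (verit, best) field_sum_of_halves half_gt_zero image_eqI mem_Collect_eq)
    also have "\<dots> \<subseteq> closure (span E)"
      by (intro closure_mono) (auto intro!: span_sum intro: span_scale span_base)
    finally show ?thesis .
  qed
  then show ?thesis using E by (auto simp: hilbert_basis_def orthonormal_def)
qed

lemma hilbert_basis_exists:
  obtains E :: "'a::{real_inner, complete_space} set" where "hilbert_basis E"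
proof -
  obtain E :: "'a set" where E: "orthonormal E"
    and max: "\<And>x. norm x = 1 \<Longrightarrow> (\<And>e. e \<in> E \<Longrightarrow> x \<bullet> e = 0) \<Longrightarrow> False"
    by (rule maximal_orthonormal[of "\<lambda>_::'a. True"]) blast
  have "x = 0" if x: "\<And>e. e \<in> E \<Longrightarrow> x \<bullet> e = 0" for x
  proof (rule ccontr)
    assume "x \<noteq> 0"
    then show False using x max[of "x /\<^sub>R norm x"] by simp
  qed
  then show ?thesis using that complete_orthonormal[OF E] by blast
qed

text \<open>Riesz representation, read off from the coefficients in a Hilbert basis; it provides the
  adjoint of a bounded operator.\<close>

lemma riesz:
  fixes \<phi> :: "'a::{real_inner, complete_space} \<Rightarrow> real"
  assumes \<phi>: "bounded_linear \<phi>"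
  obtains y where "\<And>x. \<phi> x = x \<bullet> y"
proof -
  obtain E :: "'a set" where E: "hilbert_basis E" by (rule hilbert_basis_exists)
  note on = hilbert_basis_orthonormal[OF E]
  interpret bounded_linear \<phi> by (rule \<phi>)
  obtain K where K: "K \<ge> 0" "\<And>x. norm (\<phi> x) \<le> norm x * K" using nonneg_bounded by blast
  have fin: "(\<Sum>e\<in>F. (\<phi> e)\<^sup>2) \<le> K\<^sup>2" if F: "finite F" "F \<subseteq> E" for F
  proof -
    let ?x = "\<Sum>e\<in>F. \<phi> e *\<^sub>R e" and ?Q = "\<Sum>e\<in>F. (\<phi> e)\<^sup>2"
    have n: "(norm ?x)\<^sup>2 = ?Q" by (rule norm_orthonormal_sum[OF on F])
    have "\<phi> ?x = ?Q" by (simp add: sum scaleR power2_eq_square)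
    then have "(norm ?x)\<^sup>2 \<le> norm ?x * K" using K(2)[of ?x] n by simp
    then have "norm ?x \<le> K" using K(1) by (cases "norm ?x = 0") (auto simp: power2_eq_square)
    then show ?thesis using n power_mono[of "norm ?x" K 2] by simp
  qed
  have "(\<lambda>e. (\<phi> e)\<^sup>2) summable_on E"
    by (rule nonneg_bounded_partial_sums_imp_summable_on[where C = "K\<^sup>2"])
       (auto simp: eventually_finite_subsets_at_top intro!: exI[of _ "{}"] fin)
  then obtain y where y: "((\<lambda>e. \<phi> e *\<^sub>R e) has_sum y) E"
    using orthonormal_summable[OF on] summable_iff_has_sum_infsum by blast
  show ?thesis
  proof (rule that[of y])
    fix x
    have "((\<lambda>e. \<phi> ((x \<bullet> e) *\<^sub>R e)) has_sum \<phi> x) E"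
      using has_sum_bounded_linear[OF \<phi> basis_expansion[OF E, of x]] by (simp add: comp_def)
    moreover have "((\<lambda>e. \<phi> ((x \<bullet> e) *\<^sub>R e)) has_sum (y \<bullet> x)) E"
      using has_sum_inner[OF y, of x] by (simp add: scaleR inner_commute mult.commute)
    ultimately show "\<phi> x = x \<bullet> y" using has_sum_unique inner_commute by metis
  qed
qed

lemma adjoint_inner:
  fixes T :: "'a::{real_inner, complete_space} \<Rightarrow> 'b::real_inner"
  assumes T: "bounded_linear T"
  shows "T x \<bullet> y = x \<bullet> adjoint T y"
proof -
  have "\<exists>z. \<forall>x. T x \<bullet> y = x \<bullet> z" for y
    using riesz[OF bounded_linear_compose[OF bounded_linear_inner_left[of y] T]] by metis
  then have "\<exists>f'. \<forall>x y. T x \<bullet> y = x \<bullet> f' y" by metis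
  then show ?thesis unfolding adjoint_def by (rule someI2_ex) blast
qed

lemma bounded_linear_adjoint:
  fixes T :: "'a::{real_inner, complete_space} \<Rightarrow> 'b::real_inner"
  assumes T: "bounded_linear T"
  shows "bounded_linear (adjoint T)"
proof -
  note adj = adjoint_inner[OF T, symmetric]
  obtain K where K: "K \<ge> 0" "\<And>x. norm (T x) \<le> norm x * K" using bounded_linear.nonneg_bounded[OF T] by blast
  have b: "norm (adjoint T y) \<le> norm y * K" for y
  proof -
    let ?z = "adjoint T y"
    have "(norm ?z)\<^sup>2 = T ?z \<bullet> y" by (simp add: adj power2_norm_eq_inner inner_commute)
    also have "\<dots> \<le> norm (T ?z) * norm y" by (rule norm_cauchy_schwarz)
    also have "\<dots> \<le> norm ?z * (norm y * K)" using K(2)[of ?z] by (metis mult.assoc mult.commute mult_right_mono norm_ge_zero)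
    finally show ?thesis using K(1) by (cases "norm ?z = 0") (auto simp: power2_eq_square)
  qed
  have eq: "a = b" if "\<And>x::'a. x \<bullet> a = x \<bullet> b" for a b
    using that[of "a - b"] by (metis inner_diff_right inner_eq_zero_iff right_minus_eq)
  show ?thesis
  proof (rule bounded_linear_intro[OF _ _ b])
    show "adjoint T (x + y) = adjoint T x + adjoint T y" for x y
      by (rule eq) (simp add: adj inner_add_right)
    show "adjoint T (r *\<^sub>R x) = r *\<^sub>R adjoint T x" for r x
      by (rule eq) (simp add: adj)
  qed
qed

section \<open>The spectral theorem\<close>

lemma selfadjoint_swap: "selfadjoint T \<Longrightarrow> T x \<bullet> y = x \<bullet> T y"
  by (simp add: selfadjoint_def)

text \<open>Nonnegativity of the form at \<open>r x - t y\<close> is nonnegativity of a quadratic polynomial in \<open>r\<close> and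
  \<open>t\<close>, which is then evaluated at suitable points instead of discussing its discriminant.\<close>

lemma form_cauchy_schwarz:
  assumes T: "selfadjoint T" and pos: "\<And>x. T x \<bullet> x \<ge> 0"
  shows "(T x \<bullet> y)\<^sup>2 \<le> (T x \<bullet> x) * (T y \<bullet> y)"
proof -
  interpret bounded_linear T using T by (simp add: selfadjoint_def)
  let ?a = "T x \<bullet> x" and ?b = "T x \<bullet> y" and ?c = "T y \<bullet> y"
  have sw: "T y \<bullet> x = ?b" using selfadjoint_swap[OF T, of y x] by (simp add: inner_commute)
  have q: "r\<^sup>2 * ?a - 2 * r * t * ?b + t\<^sup>2 * ?c \<ge> 0" for r t
    using pos[of "r *\<^sub>R x - t *\<^sub>R y"]
    by (simp add: diff scaleR inner_diff_left inner_diff_right sw power2_eq_square algebra_simps)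
  show ?thesis
  proof (cases "?c = 0")
    case True
    have "?b = 0"
    proof (rule ccontr)
      assume b: "?b \<noteq> 0"
      then have "1 * ?a - 2 * ((?a + 1) / (2 * ?b)) * ?b \<ge> 0"
        using q[of 1 "(?a + 1) / (2 * ?b)"] True by simp
      then show False using b by (simp add: field_simps)
    qed
    then show ?thesis using True by simp
  next
    case False
    then have c: "?c > 0" using pos[of y] by simp
    have "?c * (?a * ?c - ?b\<^sup>2) \<ge> 0"
      using q[of ?c ?b] by (simp add: power2_eq_square algebra_simps)
    then show ?thesis using c by (simp add: zero_le_mult_iff)
  qed
qed

text \<open>Unless \<open>T v = 0\<close>, the supremum \<open>m\<close> of the quadratic form over the unit vectors orthogonal to \<open>E\<close> is attained:
  along a maximizing sequence \<open>T x\<^sub>n - m x\<^sub>n\<close> tends to \<open>0\<close>, and compactness makes a subsequence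
  of \<open>T x\<^sub>n\<close>, hence of \<open>x\<^sub>n\<close>, converge. The maximizer is an eigenvector.\<close>

lemma eigenvector_in_complement:
  fixes T :: "'a::{real_inner, complete_space} \<Rightarrow> 'a"
  assumes T: "selfadjoint T" and pos: "\<And>x. T x \<bullet> x \<ge> 0"
    and cpt: "compact (closure (T ` cball 0 1))"
    and E: "\<And>e. e \<in> E \<Longrightarrow> \<exists>c. T e = c *\<^sub>R e"
    and v: "v \<noteq> 0" "\<And>e. e \<in> E \<Longrightarrow> v \<bullet> e = 0"
  obtains x c where "norm x = 1" "\<And>e. e \<in> E \<Longrightarrow> x \<bullet> e = 0" "T x = c *\<^sub>R x"
proof (cases "T v = 0")
  case True
  then show ?thesis
    using v T by (intro that[of "v /\<^sub>R norm v" 0]) (simp_all add: selfadjoint_def linear_simps)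
next
  case False
  have bl: "bounded_linear T" using T by (simp add: selfadjoint_def)
  interpret bounded_linear T by (rule bl)
  define V where "V = {x. \<forall>e\<in>E. x \<bullet> e = 0}"
  have V_inv: "T x \<in> V" if "x \<in> V" for x
    unfolding V_def
  proof (intro CollectI ballI)
    fix e assume e: "e \<in> E"
    obtain c where "T e = c *\<^sub>R e" using E[OF e] by auto
    then show "T x \<bullet> e = 0" using that e by (simp add: selfadjoint_swap[OF T] V_def)
  qed
  have V_scale: "r *\<^sub>R x \<in> V" if "x \<in> V" for r x using that by (simp add: V_def)
  have vV: "v \<in> V" using v by (simp add: V_def)
  obtain K where K: "\<And>x. norm (T x) \<le> norm x * K" using nonneg_bounded by blast
  define A where "A = (\<lambda>x. T x \<bullet> x) ` {x \<in> V. norm x = 1}"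
  define m where "m = Sup A"
  have "T x \<bullet> x \<le> K" if "norm x = 1" for x
    using norm_cauchy_schwarz[of "T x" x] K[of x] that by simp
  then have bdd: "bdd_above A" unfolding A_def by (intro bdd_aboveI[of _ K]) auto
  have ne: "A \<noteq> {}" unfolding A_def using v vV V_scale[OF vV, of "1 / norm v"] by auto
  have le1: "T x \<bullet> x \<le> m" if "x \<in> V" "norm x = 1" for x
    unfolding m_def using that by (intro cSup_upper[OF _ bdd]) (auto simp: A_def)
  have le: "T x \<bullet> x \<le> m * (norm x)\<^sup>2" if x: "x \<in> V" for x
  proof (cases "x = 0")
    case False
    have "T ((1 / norm x) *\<^sub>R x) \<bullet> ((1 / norm x) *\<^sub>R x) \<le> m"
      by (rule le1[OF V_scale[OF x]]) (use False in simp)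
    then show ?thesis using False by (simp add: scaleR field_simps power2_eq_square)
  qed (simp add: zero)
  \<comment> \<open>By Cauchy-Schwarz for the form, \<open>\<parallel>T x\<parallel>\<^sup>4 \<le> \<langle>T x, x\<rangle> \<langle>T (T x), T x\<rangle>\<close>, and the last factor is at most \<open>m \<parallel>T x\<parallel>\<^sup>2\<close>.\<close>
  have Tsq: "(norm (T x))\<^sup>2 \<le> m * (T x \<bullet> x)" if x: "x \<in> V" for x
  proof (cases "T x = 0")
    case False
    have "((norm (T x))\<^sup>2)\<^sup>2 = (T x \<bullet> T x)\<^sup>2" by (simp add: power2_norm_eq_inner)
    also have "\<dots> \<le> (T x \<bullet> x) * (T (T x) \<bullet> T x)" by (rule form_cauchy_schwarz[OF T pos])
    also have "\<dots> \<le> (T x \<bullet> x) * (m * (norm (T x))\<^sup>2)"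
      using le[OF V_inv[OF x]] pos[of x] by (rule mult_left_mono)
    finally show ?thesis using False by (simp add: power2_eq_square mult.commute)
  qed simp
  have m0: "m > 0"
  proof -
    have "0 < (norm (T v))\<^sup>2" using False by simp
    also have "\<dots> \<le> m * (T v \<bullet> v)" by (rule Tsq[OF vV])
    finally show ?thesis using pos[of v] by (simp add: zero_less_mult_iff)
  qed
  have "\<exists>x. x \<in> V \<and> norm x = 1 \<and> m - 1 / Suc n < T x \<bullet> x" for n
    using less_cSupD[OF ne, of "m - 1 / Suc n"] unfolding m_def A_def by auto
  then obtain x where x: "\<And>n. x n \<in> V" "\<And>n. norm (x n) = 1" "\<And>n. m - 1 / Suc n < T (x n) \<bullet> x n"
    by metis
  have "\<forall>n. T (x n) \<in> closure (T ` cball 0 1)"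
    using x(2) closure_subset by (fastforce intro!: subsetD[OF closure_subset])
  then obtain l r where r: "strict_mono (r :: nat \<Rightarrow> nat)" "((\<lambda>n. T (x n)) \<circ> r) \<longlonglongrightarrow> l"
    using cpt unfolding compact_def by metis
  have "(norm (T (x n) - m *\<^sub>R x n))\<^sup>2 \<le> 2 * m / Suc n" for n
  proof -
    have "(norm (T (x n) - m *\<^sub>R x n))\<^sup>2 = (norm (T (x n)))\<^sup>2 - 2 * m * (T (x n) \<bullet> x n) + m\<^sup>2 * (norm (x n))\<^sup>2"
      unfolding power2_norm_eq_inner
      by (simp add: inner_diff_left inner_diff_right inner_commute power2_eq_square algebra_simps)
    also have "\<dots> \<le> m * m - m * (T (x n) \<bullet> x n)"
      using Tsq[OF x(1)[of n]] x(2) by (simp add: power2_eq_square)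
    also have "\<dots> = m * (m - T (x n) \<bullet> x n)" by (simp add: algebra_simps)
    also have "\<dots> \<le> m * (1 / Suc n)"
      using x(3)[of n] m0 by (intro mult_left_mono) auto
    also have "\<dots> \<le> 2 * m / Suc n" using m0 by (simp add: field_simps)
    finally show ?thesis .
  qed
  then have bnd: "\<forall>n. norm ((norm (T (x n) - m *\<^sub>R x n))\<^sup>2) \<le> 2 * m * (1 / Suc n)" by simp
  have "(\<lambda>n. 2 * m * (1 / Suc n)) \<longlonglongrightarrow> 2 * m * 0"
    by (intro tendsto_intros LIMSEQ_Suc[OF lim_1_over_n])
  then have "(\<lambda>n. 2 * m * (1 / Suc n)) \<longlonglongrightarrow> 0" by simp
  from Lim_null_comparison[OF always_eventually[OF bnd] this]
  have "(\<lambda>n. (norm (T (x n) - m *\<^sub>R x n))\<^sup>2) \<longlonglongrightarrow> 0" .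
  from tendsto_real_sqrt[OF this] have "(\<lambda>n. norm (T (x n) - m *\<^sub>R x n)) \<longlonglongrightarrow> 0" by simp
  then have "(\<lambda>n. T (x n) - m *\<^sub>R x n) \<longlonglongrightarrow> 0" by (rule tendsto_norm_zero_cancel)
  from tendsto_diff[OF r(2) LIMSEQ_subseq_LIMSEQ[OF this r(1)]]
  have "(\<lambda>n. m *\<^sub>R x (r n)) \<longlonglongrightarrow> l" by (simp add: comp_def)
  then have "(\<lambda>n. (1 / m) *\<^sub>R (m *\<^sub>R x (r n))) \<longlonglongrightarrow> (1 / m) *\<^sub>R l"
    by (rule tendsto_scaleR[OF tendsto_const])
  then have lim: "(\<lambda>n. x (r n)) \<longlonglongrightarrow> (1 / m) *\<^sub>R l" using m0 by simp
  let ?y = "(1 / m) *\<^sub>R l"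
  have "(\<lambda>n. T (x (r n))) \<longlonglongrightarrow> T ?y" by (rule tendsto[OF lim])
  moreover have "(\<lambda>n. T (x (r n))) \<longlonglongrightarrow> l" using r(2) by (simp add: comp_def)
  ultimately have "T ?y = l" by (rule LIMSEQ_unique)
  then have eig: "T ?y = m *\<^sub>R ?y" using m0 by simp
  from tendsto_norm[OF lim] have n1: "norm ?y = 1" unfolding x(2) by (rule LIMSEQ_const_iff[THEN iffD1, symmetric])
  have "?y \<bullet> e = 0" if "e \<in> E" for e
  proof -
    have "x (r n) \<bullet> e = 0" for n using x(1) that by (simp add: V_def)
    with tendsto_inner[OF lim tendsto_const, of e] have "(\<lambda>n. 0) \<longlonglongrightarrow> ?y \<bullet> e" by simp
    then show ?thesis by (rule LIMSEQ_const_iff[THEN iffD1, symmetric])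
  qed
  then show ?thesis using n1 eig by (intro that[of ?y m])
qed

text \<open>A maximal orthonormal set of eigenvectors is complete, because its orthogonal complement would
  otherwise contain a further eigenvector.\<close>

lemma spectral_theorem:
  fixes T :: "'a::{real_inner, complete_space} \<Rightarrow> 'a"
  assumes T: "selfadjoint T" and pos: "\<And>x. T x \<bullet> x \<ge> 0"
    and cpt: "compact (closure (T ` cball 0 1))"
  shows "\<exists>E. hilbert_basis E \<and> (\<forall>e\<in>E. \<exists>c. T e = c *\<^sub>R e)"
proof -
  obtain E where E: "orthonormal E" "\<forall>e\<in>E. \<exists>c. T e = c *\<^sub>R e"
    and max: "\<And>x. norm x = 1 \<Longrightarrow> \<exists>c. T x = c *\<^sub>R x \<Longrightarrow> (\<And>e. e \<in> E \<Longrightarrow> x \<bullet> e = 0) \<Longrightarrow> False"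
    by (rule maximal_orthonormal[of "\<lambda>x. \<exists>c. T x = c *\<^sub>R x"]) blast
  have "x = 0" if x: "\<And>e. e \<in> E \<Longrightarrow> x \<bullet> e = 0" for x
  proof (rule ccontr)
    assume "x \<noteq> 0"
    then obtain y c where "norm y = 1" "\<And>e. e \<in> E \<Longrightarrow> y \<bullet> e = 0" "T y = c *\<^sub>R y"
      using eigenvector_in_complement[OF T pos cpt, of E x] E(2) x by blast
    then show False using max[of y] by blast
  qed
  then have "hilbert_basis E" by (rule complete_orthonormal[OF E(1)])
  then show ?thesis using E(2) by blast
qed

text \<open>Bounded sets of finite expansions are relatively compact, as continuous images of cubes.\<close>

lemma compact_box:
  fixes F :: "'a::real_normed_vector set"
  assumes "finite F"
  shows "\<exists>C. compact C \<and> (\<forall>c. (\<forall>e\<in>F. \<bar>c e\<bar> \<le> K) \<longrightarrow> (\<Sum>e\<in>F. c e *\<^sub>R e) \<in> C)"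
  using assms
proof (induction F)
  case empty
  show ?case by (intro exI[of _ "{0}"]) simp
next
  case (insert a F)
  then obtain C where C: "compact C" "\<And>c. (\<forall>e\<in>F. \<bar>c e\<bar> \<le> K) \<Longrightarrow> (\<Sum>e\<in>F. c e *\<^sub>R e) \<in> C"
    by blast
  let ?D = "(\<lambda>t. t *\<^sub>R a) ` {-K..K}"
  have "compact ?D" by (intro compact_continuous_image continuous_intros) simp
  then have "compact {x + y |x y. x \<in> ?D \<and> y \<in> C}" using C(1) by (rule compact_sums)
  moreover have "(\<Sum>e\<in>insert a F. c e *\<^sub>R e) \<in> {x + y |x y. x \<in> ?D \<and> y \<in> C}"
    if c: "\<forall>e\<in>insert a F. \<bar>c e\<bar> \<le> K" for c
  proof -
    have "c a \<in> {-K..K}" using c by auto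
    then have "c a *\<^sub>R a \<in> ?D" by blast
    moreover have "(\<Sum>e\<in>F. c e *\<^sub>R e) \<in> C" using c by (intro C(2)) simp
    ultimately show ?thesis using insert.hyps by auto
  qed
  ultimately show ?case by blast
qed

lemma compact_closure_approx:
  fixes X :: "'a::complete_space set"
  assumes "\<And>d. d > 0 \<Longrightarrow> \<exists>C. compact C \<and> (\<forall>x\<in>X. \<exists>y\<in>C. dist x y < d)"
  shows "compact (closure X)"
  unfolding compact_eq_totally_bounded complete_eq_closed
proof (intro conjI allI impI)
  show "closed (closure X)" by simp
  fix d :: real assume "d > 0"
  then obtain C where C: "compact C" "\<And>x. x \<in> X \<Longrightarrow> \<exists>y\<in>C. dist x y < d / 3"
    using assms[of "d / 3"] by auto
  obtain k where k: "finite k" "C \<subseteq> (\<Union>y\<in>k. ball y (d / 3))"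
    using C(1) \<open>d > 0\<close> unfolding compact_eq_totally_bounded by (meson divide_pos_pos zero_less_numeral)
  have "closure X \<subseteq> (\<Union>y\<in>k. ball y d)"
  proof
    fix x assume "x \<in> closure X"
    then obtain x' where x': "x' \<in> X" "dist x' x < d / 3"
      using \<open>d > 0\<close> unfolding closure_approachable by (meson divide_pos_pos zero_less_numeral)
    obtain y where y: "y \<in> C" "dist x' y < d / 3" using C(2)[OF x'(1)] by auto
    obtain z where z: "z \<in> k" "dist z y < d / 3" using k(2) y(1) by auto
    have "dist z x \<le> dist z y + (dist x' y + dist x' x)"
      using dist_triangle[of z x y] dist_triangle2[of y x x'] dist_triangle[of y x x'] by (simp add: dist_commute)
    then have "dist z x < d" using x' y z by linarith
    then show "x \<in> (\<Union>y\<in>k. ball y d)" using z(1) by auto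
  qed
  then show "\<exists>k. finite k \<and> closure X \<subseteq> (\<Union>y\<in>k. ball y d)" using k(1) by blast
qed

text \<open>A positive operator with finite trace is compact: by the Cauchy-Schwarz inequality for its
  quadratic form, \<open>\<langle>S x, e\<rangle>\<^sup>2 \<le> \<langle>S x, x\<rangle> \<langle>S e, e\<rangle>\<close>, so the coefficients of \<open>S x\<close> have tails that are
  small uniformly on the unit ball, and \<open>S\<close> is a norm limit of finite rank operators.\<close>

lemma trace_class_compact:
  fixes S :: "'a::{real_inner, complete_space} \<Rightarrow> 'a"
  assumes S: "positive_trace_class S"
  shows "compact (closure (S ` cball 0 1))"
proof (rule compact_closure_approx)
  fix d :: real assume d: "d > 0"
  have sa: "selfadjoint S" and pos: "\<And>x. S x \<bullet> x \<ge> 0" using S by (auto simp: positive_trace_class_def)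
  obtain E :: "'a set" where E: "hilbert_basis E" by (rule hilbert_basis_exists)
  note on = hilbert_basis_orthonormal[OF E]
  have tr: "(\<lambda>e. S e \<bullet> e) summable_on E" using S E by (auto simp: positive_trace_class_def)
  let ?L = "infsum (\<lambda>e. S e \<bullet> e) E"
  interpret bounded_linear S using sa by (simp add: selfadjoint_def)
  obtain K where K: "K > 0" "\<And>x. norm (S x) \<le> norm x * K" using pos_bounded by blast
  have KS: "norm (S x) \<le> K" if "x \<in> cball 0 1" for x
    using order_trans[OF K(2)[of x], of K] that K(1) mult_right_mono[of "norm x" 1 K] by simp
  have Sxx: "S x \<bullet> x \<le> K" if "x \<in> cball 0 1" for x
    using norm_cauchy_schwarz[of "S x" x] KS[OF that] that mult_mono[of "norm (S x)" K "norm x" 1] K(1) by simp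
  \<comment> \<open>With trace tail \<open>\<delta>\<close> the squared error on the unit ball is at most \<open>K \<delta> < d\<^sup>2\<close>.\<close>
  define \<delta> where "\<delta> = d\<^sup>2 / (4 * K)"
  have \<delta>: "\<delta> > 0" using d K(1) by (simp add: \<delta>_def)
  obtain F where F: "finite F" "F \<subseteq> E" "dist (\<Sum>e\<in>F. S e \<bullet> e) ?L \<le> \<delta>"
    using infsum_finite_approximation[OF tr \<delta>] by blast
  obtain C where C: "compact C" "\<And>c. (\<forall>e\<in>F. \<bar>c e\<bar> \<le> K) \<Longrightarrow> (\<Sum>e\<in>F. c e *\<^sub>R e) \<in> C"
    using compact_box[OF F(1), of K] by blast
  have "dist (S x) (\<Sum>e\<in>F. (S x \<bullet> e) *\<^sub>R e) < d" if x: "x \<in> cball 0 1" for x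
  proof -
    have tail: "(\<Sum>e\<in>H. (S x \<bullet> e)\<^sup>2) \<le> (\<Sum>e\<in>F. (S x \<bullet> e)\<^sup>2) + K * \<delta>" if H: "finite H" "H \<subseteq> E" for H
    proof -
      have "(\<Sum>e\<in>H. (S x \<bullet> e)\<^sup>2) \<le> (\<Sum>e\<in>H \<union> F. (S x \<bullet> e)\<^sup>2)"
        using H F by (intro sum_mono2) auto
      also have "\<dots> = (\<Sum>e\<in>F. (S x \<bullet> e)\<^sup>2) + (\<Sum>e\<in>H - F. (S x \<bullet> e)\<^sup>2)"
        using H F sum.union_disjoint[of F "H - F" "\<lambda>e. (S x \<bullet> e)\<^sup>2"] by (simp add: Un_commute Un_Diff_cancel2)
      also have "(\<Sum>e\<in>H - F. (S x \<bullet> e)\<^sup>2) \<le> (\<Sum>e\<in>H - F. K * (S e \<bullet> e))"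
        using order_trans[OF form_cauchy_schwarz[OF sa pos] mult_right_mono[OF Sxx[OF x] pos]]
        by (intro sum_mono)
      also have "\<dots> = K * ((\<Sum>e\<in>H \<union> F. S e \<bullet> e) - (\<Sum>e\<in>F. S e \<bullet> e))"
        using H F sum.union_disjoint[of F "H - F" "\<lambda>e. S e \<bullet> e"]
        by (simp add: Un_commute Un_Diff_cancel2 sum_distrib_left)
      also have "\<dots> \<le> K * (?L - (\<Sum>e\<in>F. S e \<bullet> e))"
        using finite_sum_le_infsum[OF tr, of "H \<union> F"] H F pos K(1) by (intro mult_left_mono) auto
      also have "\<dots> \<le> K * \<delta>"
        using F(3) K(1) by (intro mult_left_mono) (auto simp: dist_real_def)
      finally show ?thesis by simp
    qed
    have "(norm (S x))\<^sup>2 \<le> (\<Sum>e\<in>F. (S x \<bullet> e)\<^sup>2) + K * \<delta>"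
      by (rule has_sum_le_finite_sums[OF parseval[OF E]]) (rule tail)
    then have "(norm (S x - (\<Sum>e\<in>F. (S x \<bullet> e) *\<^sub>R e)))\<^sup>2 \<le> K * \<delta>"
      using norm_minus_projection[OF on F(1,2), of "S x"] by simp
    also have "\<dots> < d\<^sup>2" using d K(1) by (simp add: \<delta>_def)
    finally show ?thesis using d by (simp add: dist_norm power_less_imp_less_base)
  qed
  moreover have "(\<Sum>e\<in>F. (S x \<bullet> e) *\<^sub>R e) \<in> C" if x: "x \<in> cball 0 1" for x
  proof (rule C(2), intro ballI)
    fix e assume "e \<in> F"
    then have "norm e = 1" using on F(2) by (auto simp: orthonormal_def)
    then show "\<bar>S x \<bullet> e\<bar> \<le> K" using Cauchy_Schwarz_ineq2[of "S x" e] KS[OF x] by simp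
  qed
  ultimately show "\<exists>C. compact C \<and> (\<forall>x\<in>S ` cball 0 1. \<exists>y\<in>C. dist x y < d)"
    using C(1) by blast
qed

section \<open>Operators diagonal in an orthonormal basis\<close>

definition diag :: "'a::real_inner set \<Rightarrow> ('a \<Rightarrow> real) \<Rightarrow> 'a \<Rightarrow> 'a" where
  "diag E c x = (\<Sum>\<^sub>\<infinity>e\<in>E. (c e * (x \<bullet> e)) *\<^sub>R e)"

text \<open>The multiplier \<open>c\<close> may be unbounded; \<open>diag E c x\<close> is meaningful for \<open>x\<close> in the following domain, as
  is needed for negative powers.\<close>

definition diag_dom :: "'a::real_inner set \<Rightarrow> ('a \<Rightarrow> real) \<Rightarrow> 'a set" where
  "diag_dom E c = {x. (\<lambda>e. (c e * (x \<bullet> e))\<^sup>2) summable_on E}"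

lemma op_powr_diag: "op_powr T r = diag (eigenbasis T) (\<lambda>e. (T e \<bullet> e) powr r)"
  by (simp add: fun_eq_iff op_powr_def diag_def)

lemma op_powr_dom_diag: "op_powr_dom T r = diag_dom (eigenbasis T) (\<lambda>e. (T e \<bullet> e) powr r)"
  by (simp add: op_powr_dom_def diag_dom_def)

lemma diag_cong: "(\<And>e. e \<in> E \<Longrightarrow> c e = d e) \<Longrightarrow> diag E c = diag E d"
  unfolding diag_def by (intro ext infsum_cong) simp

lemma diag_dom_dominated:
  assumes x: "x \<in> diag_dom E d" and le: "\<And>e. e \<in> E \<Longrightarrow> \<bar>c e\<bar> \<le> M * \<bar>d e\<bar>"
  shows "x \<in> diag_dom E c"
proof -
  have "(c e * (x \<bullet> e))\<^sup>2 \<le> M\<^sup>2 * (d e * (x \<bullet> e))\<^sup>2" if "e \<in> E" for e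
  proof -
    have "\<bar>c e\<bar> * \<bar>x \<bullet> e\<bar> \<le> (M * \<bar>d e\<bar>) * \<bar>x \<bullet> e\<bar>" using le[OF that] by (intro mult_right_mono) auto
    then have "\<bar>c e * (x \<bullet> e)\<bar> \<le> \<bar>M * (d e * (x \<bullet> e))\<bar>"
      by (simp add: abs_mult mult.assoc) (smt (verit) abs_ge_zero mult_nonneg_nonneg mult_right_mono)
    then show ?thesis by (simp add: abs_le_square_iff power_mult_distrib)
  qed
  moreover have "(\<lambda>e. M\<^sup>2 * (d e * (x \<bullet> e))\<^sup>2) summable_on E"
    using x by (intro summable_on_cmult_right) (simp add: diag_dom_def)
  ultimately show ?thesis
    unfolding diag_dom_def by (auto intro: summable_on_comparison_test)
qed

lemma diag_dom_bounded:
  assumes E: "hilbert_basis E" and c: "bounded (c ` E)"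
  shows "x \<in> diag_dom E c"
proof -
  obtain M where "\<And>e. e \<in> E \<Longrightarrow> \<bar>c e\<bar> \<le> M" using c by (auto simp: bounded_iff)
  moreover have "x \<in> diag_dom E (\<lambda>_. 1)"
    using bessel_summable[OF hilbert_basis_orthonormal[OF E]] by (simp add: diag_dom_def)
  ultimately show ?thesis using diag_dom_dominated[of x E "\<lambda>_. 1" c M] by simp
qed

lemma bounded_const_image: "(\<And>e. e \<in> E \<Longrightarrow> c e = k) \<Longrightarrow> bounded (c ` E)"
  by (rule bounded_subset[of "{k}"]) auto

context
  fixes E :: "'a::{real_inner, complete_space} set"
  assumes E: "hilbert_basis E"
begin

lemma diag_has_sum:
  "x \<in> diag_dom E c \<Longrightarrow> ((\<lambda>e. (c e * (x \<bullet> e)) *\<^sub>R e) has_sum diag E c x) E"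
  unfolding diag_def diag_dom_def
  by (simp add: orthonormal_summable[OF hilbert_basis_orthonormal[OF E]])

lemma diag_inner: "x \<in> diag_dom E c \<Longrightarrow> e \<in> E \<Longrightarrow> diag E c x \<bullet> e = c e * (x \<bullet> e)"
  using inner_orthonormal_has_sum[OF hilbert_basis_orthonormal[OF E] diag_has_sum] .

lemma diag_norm: "x \<in> diag_dom E c \<Longrightarrow> ((\<lambda>e. (c e * (x \<bullet> e))\<^sup>2) has_sum (norm (diag E c x))\<^sup>2) E"
  using norm_orthonormal_has_sum[OF hilbert_basis_orthonormal[OF E] diag_has_sum] .

lemma diag_dom_diag:
  "x \<in> diag_dom E d \<Longrightarrow> diag E d x \<in> diag_dom E c \<longleftrightarrow> x \<in> diag_dom E (\<lambda>e. c e * d e)"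
  by (simp add: diag_dom_def diag_inner mult.assoc cong: summable_on_cong)

lemma diag_diag:
  assumes "x \<in> diag_dom E d" "x \<in> diag_dom E (\<lambda>e. c e * d e)"
  shows "diag E c (diag E d x) = diag E (\<lambda>e. c e * d e) x"
  by (rule basis_eqI[OF E]) (use assms in \<open>simp add: diag_inner diag_dom_diag mult.assoc\<close>)

lemma diag_one: "(\<And>e. e \<in> E \<Longrightarrow> c e = 1) \<Longrightarrow> diag E c x = x"
  by (rule basis_eqI[OF E]) (simp add: diag_inner diag_dom_bounded[OF E bounded_const_image])

lemma diag_basis:
  assumes "f \<in> E" shows "diag E c f = c f *\<^sub>R f" and "f \<in> diag_dom E c"
proof -
  note on = orthonormal_inner[OF hilbert_basis_orthonormal[OF E]]
  have "((\<lambda>e. (c e * (f \<bullet> e))\<^sup>2) has_sum (\<Sum>e\<in>{f}. (c e * (f \<bullet> e))\<^sup>2)) E"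
    by (rule has_sum_finite_neutralI[where B = "{f}"]) (use assms in \<open>auto simp: on\<close>)
  then show d: "f \<in> diag_dom E c"
    unfolding diag_dom_def using has_sum_imp_summable by auto
  show "diag E c f = c f *\<^sub>R f"
    by (rule basis_eqI[OF E]) (use assms in \<open>auto simp: diag_inner[OF d] on\<close>)
qed

text \<open>For functions of one and the same operator, pointwise domination of the multipliers suffices; only
  the comparison of different operators needs the Heinz inequality.\<close>

lemma diag_dominated:
  assumes x: "x \<in> diag_dom E d" and le: "\<And>e. e \<in> E \<Longrightarrow> \<bar>c e\<bar> \<le> M * \<bar>d e\<bar>" and M: "M \<ge> 0"
  shows "norm (diag E c x) \<le> M * norm (diag E d x)"
proof -
  have "(norm (diag E c x))\<^sup>2 \<le> (norm (diag E (\<lambda>e. M * d e) x))\<^sup>2"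
  proof (rule has_sum_mono[OF diag_norm diag_norm])
    show "x \<in> diag_dom E c" by (rule diag_dom_dominated[OF x le])
    show "x \<in> diag_dom E (\<lambda>e. M * d e)" by (rule diag_dom_dominated[OF x, of _ M]) (use M in \<open>simp add: abs_mult\<close>)
    fix e assume "e \<in> E"
    from le[OF this] have "\<bar>c e\<bar> * \<bar>x \<bullet> e\<bar> \<le> (M * \<bar>d e\<bar>) * \<bar>x \<bullet> e\<bar>" by (intro mult_right_mono) auto
    then show "(c e * (x \<bullet> e))\<^sup>2 \<le> (M * d e * (x \<bullet> e))\<^sup>2"
      using M by (intro iffD1[OF abs_le_square_iff]) (simp add: abs_mult)
  qed
  also have "diag E (\<lambda>e. M * d e) x = M *\<^sub>R diag E d x"
    unfolding diag_def using infsum_scaleR_right[of M "\<lambda>e. (d e * (x \<bullet> e)) *\<^sub>R e" E]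
    by (simp add: mult.assoc)
  finally show ?thesis using M by (simp add: power2_le_iff_abs_le abs_mult)
qed

lemma bounded_linear_diag:
  assumes c: "bounded (c ` E)"
  shows "bounded_linear (diag E c)"
proof -
  note dom = diag_dom_bounded[OF E c]
  obtain M where M: "M > 0" "\<And>e. e \<in> E \<Longrightarrow> \<bar>c e\<bar> \<le> M" using c by (auto simp: bounded_pos)
  show ?thesis
  proof (rule bounded_linear_intro[where K = M])
    show "diag E c (x + y) = diag E c x + diag E c y" for x y
      by (rule basis_eqI[OF E]) (simp add: diag_inner[OF dom] inner_add_left algebra_simps)
    show "diag E c (r *\<^sub>R x) = r *\<^sub>R diag E c x" for r x
      by (rule basis_eqI[OF E]) (simp add: diag_inner[OF dom])
    show "norm (diag E c x) \<le> norm x * M" for x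
      using diag_dominated[of x "\<lambda>_. 1" c M] M
      by (simp add: diag_one diag_dom_bounded[OF E bounded_const_image] mult.commute)
  qed
qed

lemma diag_inner_has_sum:
  "x \<in> diag_dom E c \<Longrightarrow> ((\<lambda>e. c e * (x \<bullet> e) * (y \<bullet> e)) has_sum (diag E c x \<bullet> y)) E"
  using has_sum_inner[OF diag_has_sum, of x c y] by (simp add: inner_commute)

lemma diag_symmetric:
  assumes c: "bounded (c ` E)"
  shows "diag E c x \<bullet> y = x \<bullet> diag E c y"
proof -
  note dom = diag_dom_bounded[OF E c]
  have "((\<lambda>e. c e * (x \<bullet> e) * (y \<bullet> e)) has_sum (x \<bullet> diag E c y)) E"
    using diag_inner_has_sum[OF dom[of y], of x] by (simp add: inner_commute mult_ac)
  then show ?thesis using diag_inner_has_sum[OF dom[of x], of y] has_sum_unique by blast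
qed

lemma diag_finite_sum:
  assumes H: "finite H" "H \<subseteq> E"
  shows "(norm (diag E c (\<Sum>e\<in>H. a e *\<^sub>R e)))\<^sup>2 = (\<Sum>e\<in>H. (c e * a e)\<^sup>2)"
proof -
  note i = inner_orthonormal_sum[OF hilbert_basis_orthonormal[OF E] H]
  let ?x = "\<Sum>e\<in>H. a e *\<^sub>R e"
  have *: "((\<lambda>e. (c e * (?x \<bullet> e))\<^sup>2) has_sum (\<Sum>e\<in>H. (c e * a e)\<^sup>2)) E"
  proof (rule has_sum_finite_neutralI[OF H])
    show "(c e * (?x \<bullet> e))\<^sup>2 = 0" if "e \<in> E - H" for e using i[of e] that by simp
    show "(\<Sum>e\<in>H. (c e * a e)\<^sup>2) = (\<Sum>e\<in>H. (c e * (?x \<bullet> e))\<^sup>2)"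
      using H by (intro sum.cong) (auto simp: i)
  qed
  then have "?x \<in> diag_dom E c" unfolding diag_dom_def using has_sum_imp_summable by auto
  from has_sum_unique[OF diag_norm[OF this] *] show ?thesis .
qed

end

section \<open>Interpolation of operator inequalities\<close>

text \<open>The weight \<open>\<lambda> \<mu> / (\<lambda> + \<mu>)\<close> is the minimal value of \<open>\<lambda> (x - z)\<^sup>2 + \<mu> z\<^sup>2\<close> for \<open>x = 1\<close>. Minimizing the
  two sides of \<open>\<parallel>P (x - z)\<parallel>\<^sup>2 + \<mu> \<parallel>z\<parallel>\<^sup>2 \<le> \<parallel>Q (x - z)\<parallel>\<^sup>2 + \<mu> \<parallel>z\<parallel>\<^sup>2\<close> over \<open>z\<close> therefore compares the
  diagonal forms with these weights. Only a finite part of the left hand side and only a finite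
  expansion \<open>x\<close> are considered, so that the weights can be integrated over \<open>\<mu>\<close> term by term.\<close>

lemma resolvent_form_mono:
  fixes E F :: "'a::{real_inner, complete_space} set"
  assumes E: "hilbert_basis E" and F: "hilbert_basis F"
    and p: "\<And>e. e \<in> E \<Longrightarrow> p e > 0" "bounded (p ` E)" and q: "\<And>f. f \<in> F \<Longrightarrow> q f > 0"
    and le: "\<And>x. norm (diag E p x) \<le> norm (diag F q x)"
    and G: "finite G" "G \<subseteq> E" and H: "finite H" "H \<subseteq> F" and \<mu>: "\<mu> > 0"
  shows "(\<Sum>e\<in>G. (p e)\<^sup>2 * \<mu> / ((p e)\<^sup>2 + \<mu>) * ((\<Sum>f\<in>H. a f *\<^sub>R f) \<bullet> e)\<^sup>2)
    \<le> (\<Sum>f\<in>H. (q f)\<^sup>2 * \<mu> / ((q f)\<^sup>2 + \<mu>) * (a f)\<^sup>2)"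
proof -
  let ?x = "\<Sum>f\<in>H. a f *\<^sub>R f"
  \<comment> \<open>The minimizer of the right hand form, which makes the comparison sharp.\<close>
  define z where "z = (\<Sum>f\<in>H. ((q f)\<^sup>2 / ((q f)\<^sup>2 + \<mu>) * a f) *\<^sub>R f)"
  have min: "l * \<mu> / (l + \<mu>) * x\<^sup>2 \<le> l * (x - y)\<^sup>2 + \<mu> * y\<^sup>2" if "l > 0" for l x y :: real
  proof -
    \<comment> \<open>The difference is a square, which vanishes exactly at the minimizer \<open>y = l x / (l + \<mu>)\<close>.\<close>
    have "(l * (x - y)\<^sup>2 + \<mu> * y\<^sup>2) * (l + \<mu>) - l * \<mu> * x\<^sup>2 = (l * (x - y) - \<mu> * y)\<^sup>2"
      by (simp add: power2_eq_square algebra_simps)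
    then have "l * \<mu> * x\<^sup>2 \<le> (l * (x - y)\<^sup>2 + \<mu> * y\<^sup>2) * (l + \<mu>)"
      by (smt (verit) zero_le_power2)
    then show ?thesis using that \<mu> by (simp add: field_simps)
  qed
  have "?x - z = (\<Sum>f\<in>H. (a f - (q f)\<^sup>2 / ((q f)\<^sup>2 + \<mu>) * a f) *\<^sub>R f)"
    unfolding z_def by (simp add: sum_subtractf scaleR_diff_left)
  also have "\<dots> = (\<Sum>f\<in>H. (\<mu> / ((q f)\<^sup>2 + \<mu>) * a f) *\<^sub>R f)"
  proof (intro sum.cong refl arg_cong2[of _ _ _ _ "(*\<^sub>R)"])
    fix f
    have "(q f)\<^sup>2 + \<mu> > 0" using \<mu> by (simp add: add_nonneg_pos)
    then show "a f - (q f)\<^sup>2 / ((q f)\<^sup>2 + \<mu>) * a f = \<mu> / ((q f)\<^sup>2 + \<mu>) * a f"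
      by (simp add: field_simps)
  qed
  finally have xz: "?x - z = (\<Sum>f\<in>H. (\<mu> / ((q f)\<^sup>2 + \<mu>) * a f) *\<^sub>R f)" .
  have "(\<Sum>e\<in>G. (p e)\<^sup>2 * \<mu> / ((p e)\<^sup>2 + \<mu>) * (?x \<bullet> e)\<^sup>2)
      \<le> (\<Sum>e\<in>G. (p e)\<^sup>2 * (?x \<bullet> e - z \<bullet> e)\<^sup>2 + \<mu> * (z \<bullet> e)\<^sup>2)"
    using less_imp_neq[OF p(1)[OF subsetD[OF G(2)]]] by (intro sum_mono min) (simp add: eq_commute[of 0])
  also have "\<dots> = (\<Sum>e\<in>G. (p e * ((?x - z) \<bullet> e))\<^sup>2) + \<mu> * (\<Sum>e\<in>G. (z \<bullet> e)\<^sup>2)"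
    by (simp add: sum.distrib sum_distrib_left inner_diff_left power_mult_distrib)
  also have "\<dots> \<le> (norm (diag E p (?x - z)))\<^sup>2 + \<mu> * (norm z)\<^sup>2"
    using finite_sum_le_has_sum[OF diag_norm[OF E diag_dom_bounded[OF E p(2)]], of G "?x - z"] G \<mu>
    by (intro add_mono mult_left_mono bessel_finite[OF hilbert_basis_orthonormal[OF E] G]) auto
  also have "\<dots> \<le> (norm (diag F q (?x - z)))\<^sup>2 + \<mu> * (norm z)\<^sup>2"
    using le by (simp add: power_mono)
  also have "\<dots> = (\<Sum>f\<in>H. (q f * (\<mu> / ((q f)\<^sup>2 + \<mu>) * a f))\<^sup>2) + \<mu> * (\<Sum>f\<in>H. ((q f)\<^sup>2 / ((q f)\<^sup>2 + \<mu>) * a f)\<^sup>2)"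
    unfolding xz diag_finite_sum[OF F H] unfolding z_def norm_orthonormal_sum[OF hilbert_basis_orthonormal[OF F] H] ..
  also have "\<dots> = (\<Sum>f\<in>H. (q f)\<^sup>2 * \<mu> / ((q f)\<^sup>2 + \<mu>) * (a f)\<^sup>2)"
    unfolding sum_distrib_left sum.distrib[symmetric]
  proof (rule sum.cong[OF refl])
    fix f
    define d where "d = (q f)\<^sup>2 + \<mu>"
    have d: "d > 0" using \<mu> by (simp add: d_def add_nonneg_pos)
    have "(q f * (\<mu> / d * a f))\<^sup>2 + \<mu> * ((q f)\<^sup>2 / d * a f)\<^sup>2 = (q f)\<^sup>2 * \<mu> * (\<mu> + (q f)\<^sup>2) * (a f)\<^sup>2 / d\<^sup>2"
      using d by (simp add: power2_eq_square field_simps)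
    also have "\<mu> + (q f)\<^sup>2 = d" by (simp add: d_def)
    also have "(q f)\<^sup>2 * \<mu> * d * (a f)\<^sup>2 / d\<^sup>2 = (q f)\<^sup>2 * \<mu> / d * (a f)\<^sup>2"
      using d by (simp add: power2_eq_square)
    finally show "(q f * (\<mu> / ((q f)\<^sup>2 + \<mu>) * a f))\<^sup>2 + \<mu> * ((q f)\<^sup>2 / ((q f)\<^sup>2 + \<mu>) * a f)\<^sup>2
      = (q f)\<^sup>2 * \<mu> / ((q f)\<^sup>2 + \<mu>) * (a f)\<^sup>2" unfolding d_def .
  qed
  finally show ?thesis .
qed

text \<open>The substitution \<open>\<mu> = l v\<close> extracts the factor \<open>l powr \<theta>\<close>, so that \<open>c\<close> is the value at \<open>l = 1\<close>. It is
  finite because the integrand is at most \<open>\<mu> powr (\<theta> - 1)\<close> near \<open>0\<close> and \<open>\<mu> powr (\<theta> - 2)\<close> near infinity,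
  which is where \<open>0 < \<theta> < 1\<close> is essential.\<close>

lemma integral_resolvent_powr:
  fixes \<theta> :: real
  assumes \<theta>: "0 < \<theta>" "\<theta> < 1"
  obtains c where "c > 0"
    "\<And>l. l > 0 \<Longrightarrow> integrable lborel (\<lambda>\<mu>. indicator {0<..} \<mu> * (l * \<mu> powr (\<theta> - 1) / (l + \<mu>)))"
    "\<And>l. l > 0 \<Longrightarrow> (LINT \<mu>|lborel. indicator {0<..} \<mu> * (l * \<mu> powr (\<theta> - 1) / (l + \<mu>))) = c * l powr \<theta>"
proof -
  define h :: "real \<Rightarrow> real \<Rightarrow> real" where
    "h l \<mu> = indicator {0<..} \<mu> * (l * \<mu> powr (\<theta> - 1) / (l + \<mu>))" for l \<mu>
  have [measurable]: "h l \<in> borel_measurable borel" for l unfolding h_def by measurable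
  have fin: "integrable lborel (\<lambda>x. indicator \<Omega> x * x powr a)"
    if "((\<lambda>x. x powr a) has_integral I) \<Omega>" "\<Omega> \<in> sets borel" for \<Omega> :: "real set" and I a
  proof (rule integrableI_nonneg)
    show "(\<integral>\<^sup>+x. ennreal (indicator \<Omega> x * x powr a) \<partial>lborel) < \<infinity>"
      by (subst nn_integral_has_integral_lebesgue[OF _ that(1)]) auto
  qed (use that(2) in auto)
  have "integrable lborel (\<lambda>x. indicator {0..1} x * x powr (\<theta> - 1) + indicator {1..} x * x powr (\<theta> - 2))"
    using fin[OF has_integral_powr_from_0[of "\<theta> - 1" 1]] fin[OF has_integral_powr_to_inf[of "\<theta> - 2" 1]] \<theta>
    by (intro Bochner_Integration.integrable_add) simp_all
  then have h1: "integrable lborel (h 1)"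
  proof (rule Bochner_Integration.integrable_bound)
    have "\<bar>h 1 x\<bar> \<le> indicator {0..1} x * x powr (\<theta> - 1) + indicator {1..} x * x powr (\<theta> - 2)" for x
    proof -
      have "x powr (\<theta> - 1) / (1 + x) \<le> x powr (\<theta> - 1)" if "x > 0"
        using that by (simp add: field_simps)
      moreover have "x powr (\<theta> - 1) / (1 + x) \<le> x powr (\<theta> - 2)" if "x > 0"
      proof -
        have "x powr (\<theta> - 1) = x * x powr (\<theta> - 2)" using that by (simp add: powr_mult_base)
        then show ?thesis using that by (simp add: field_simps)
      qed
      ultimately show ?thesis
        by (cases "x > 0"; cases "x \<le> 1") (auto simp: h_def indicator_def)
    qed
    then show "AE x in lborel. norm (h 1 x) \<le> norm (indicator {0..1} x * x powr (\<theta> - 1) + indicator {1..} x * x powr (\<theta> - 2))"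
      by (intro AE_I2) (simp add: abs_of_nonneg)
  qed simp
  have scale: "h l (0 + l * v) = l powr (\<theta> - 1) * h 1 v" if l: "l > 0" for l v
  proof (cases "v > 0")
    case True
    have "l * (l * v) powr (\<theta> - 1) / (l + l * v) = (l * (l powr (\<theta> - 1) * v powr (\<theta> - 1))) / (l * (1 + v))"
      using l True by (simp add: powr_mult distrib_left)
    also have "\<dots> = l powr (\<theta> - 1) * (v powr (\<theta> - 1) / (1 + v))"
      using l by simp
    finally show ?thesis using l True by (simp add: h_def)
  qed (use l in \<open>simp add: h_def zero_less_mult_iff\<close>)
  have int: "integrable lborel (h l)" if l: "l > 0" for l
  proof -
    have "integrable lborel (\<lambda>v. h l (0 + l * v))"
      unfolding scale[OF l] using h1 by simp
    then show ?thesis using lborel_integrable_real_affine_iff[of l "h l" 0] l by simp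
  qed
  have val: "integral\<^sup>L lborel (h l) = integral\<^sup>L lborel (h 1) * l powr \<theta>" if l: "l > 0" for l
  proof -
    have "integral\<^sup>L lborel (h l) = l * (l powr (\<theta> - 1) * integral\<^sup>L lborel (h 1))"
      using lborel_integral_real_affine[of l "h l" 0] l unfolding scale[OF l] by simp
    then show ?thesis using powr_mult_base[of l "\<theta> - 1"] l by (simp add: mult_ac)
  qed
  have nonneg: "h 1 x \<ge> 0" for x by (auto simp: h_def indicator_def)
  have "integral\<^sup>L lborel (h 1) \<noteq> 0"
  proof
    assume "integral\<^sup>L lborel (h 1) = 0"
    then have "AE x in lborel. h 1 x = 0"
      using integral_nonneg_eq_0_iff_AE[OF h1] nonneg by simp
    then have "AE x in lborel. x \<notin> {0<..<1::real}"
      by eventually_elim (auto simp: h_def indicator_def)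
    then have "emeasure lborel {0<..<1::real} = 0"
      by (subst (asm) AE_iff_measurable[of "{0<..<1::real}"]) auto
    then show False by simp
  qed
  then have "integral\<^sup>L lborel (h 1) > 0"
    using integral_nonneg_AE[of "h 1" lborel] nonneg by (simp add: less_le)
  then show ?thesis
    using that int val unfolding h_def by blast
qed

text \<open>Up to a positive constant, \<open>l powr \<theta>\<close> is for \<open>0 < \<theta> < 1\<close> the integral of the weights \<open>l \<mu> / (l + \<mu>)\<close>
  against \<open>\<mu> powr (\<theta> - 2)\<close>; hence the comparison of those weights passes to the powers. Finite
  expansions are dense, and the finite parts of the left hand side exhaust its norm.\<close>

lemma heinz_inequality:
  fixes E F :: "'a::{real_inner, complete_space} set"
  assumes E: "hilbert_basis E" and F: "hilbert_basis F"
    and p: "\<And>e. e \<in> E \<Longrightarrow> p e > 0" "bounded (p ` E)"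
    and q: "\<And>f. f \<in> F \<Longrightarrow> q f > 0" "bounded ((\<lambda>f. q f powr \<theta>) ` F)"
    and le: "\<And>x. norm (diag E p x) \<le> norm (diag F q x)"
    and \<theta>: "0 \<le> \<theta>" "\<theta> \<le> 1"
  shows "norm (diag E (\<lambda>e. p e powr \<theta>) x) \<le> norm (diag F (\<lambda>f. q f powr \<theta>) x)"
proof -
  consider "\<theta> = 0" | "\<theta> = 1" | "0 < \<theta>" "\<theta> < 1" using \<theta> by linarith
  then show ?thesis
  proof cases
    case 1
    have "p e \<noteq> 0" if "e \<in> E" for e using p(1)[OF that] by simp
    moreover have "q f \<noteq> 0" if "f \<in> F" for f using q(1)[OF that] by simp
    ultimately show ?thesis using 1 by (simp add: diag_one[OF E] diag_one[OF F])
  next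
    case 2
    have "diag E (\<lambda>e. p e powr \<theta>) = diag E p"
      using p(1) 2 by (intro diag_cong) (simp add: less_imp_le)
    moreover have "diag F (\<lambda>f. q f powr \<theta>) = diag F q"
      using q(1) 2 by (intro diag_cong) (simp add: less_imp_le)
    ultimately show ?thesis using le by simp
  next
    case 3
    obtain c where c: "c > 0"
      "\<And>l. l > 0 \<Longrightarrow> integrable lborel (\<lambda>\<mu>. indicator {0<..} \<mu> * (l * \<mu> powr (\<theta> - 1) / (l + \<mu>)))"
      "\<And>l. l > 0 \<Longrightarrow> (LINT \<mu>|lborel. indicator {0<..} \<mu> * (l * \<mu> powr (\<theta> - 1) / (l + \<mu>))) = c * l powr \<theta>"
      by (rule integral_resolvent_powr[OF 3]) blast
    define h :: "real \<Rightarrow> real \<Rightarrow> real" where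
      "h l \<mu> = indicator {0<..} \<mu> * (l * \<mu> powr (\<theta> - 1) / (l + \<mu>))" for l \<mu>
    have h: "integrable lborel (h l)" "integral\<^sup>L lborel (h l) = c * l powr \<theta>" if "l > 0" for l
      using c(2,3)[OF that] unfolding h_def by auto
    have hk: "h l \<mu> = \<mu> powr (\<theta> - 2) * (l * \<mu> / (l + \<mu>))" if "\<mu> > 0" for l \<mu>
    proof -
      have "\<mu> powr (\<theta> - 1) = \<mu> * \<mu> powr (\<theta> - 2)" using that by (simp add: powr_mult_base)
      then show ?thesis using that by (simp add: h_def)
    qed
    have sq: "(r\<^sup>2) powr \<theta> = (r powr \<theta>)\<^sup>2" if "r > 0" for r :: real
      using that by (simp add: power2_eq_square powr_mult)
    have fin: "(\<Sum>e\<in>G. (p e powr \<theta> * ((\<Sum>f\<in>H. (x \<bullet> f) *\<^sub>R f) \<bullet> e))\<^sup>2) \<le> (\<Sum>f\<in>H. (q f powr \<theta> * (x \<bullet> f))\<^sup>2)"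
      if G: "finite G" "G \<subseteq> E" and H: "finite H" "H \<subseteq> F" for G H
    proof -
      let ?b = "\<lambda>e. ((\<Sum>f\<in>H. (x \<bullet> f) *\<^sub>R f) \<bullet> e)\<^sup>2"
      have pG: "p e > 0" if "e \<in> G" for e using p(1) G(2) that by auto
      have qH: "q f > 0" if "f \<in> H" for f using q(1) H(2) that by auto
      have hp: "integrable lborel (h ((p e)\<^sup>2))" "integral\<^sup>L lborel (h ((p e)\<^sup>2)) = c * (p e)\<^sup>2 powr \<theta>" if "e \<in> G" for e
        using h[of "(p e)\<^sup>2"] pG[OF that] by simp_all
      have hq: "integrable lborel (h ((q f)\<^sup>2))" "integral\<^sup>L lborel (h ((q f)\<^sup>2)) = c * (q f)\<^sup>2 powr \<theta>" if "f \<in> H" for f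
        using h[of "(q f)\<^sup>2"] qH[OF that] by simp_all
      have "(\<Sum>e\<in>G. c * ((p e)\<^sup>2 powr \<theta>) * ?b e) = (LINT \<mu>|lborel. (\<Sum>e\<in>G. h ((p e)\<^sup>2) \<mu> * ?b e))"
        by (subst Bochner_Integration.integral_sum) (simp_all add: hp)
      also have "\<dots> \<le> (LINT \<mu>|lborel. (\<Sum>f\<in>H. h ((q f)\<^sup>2) \<mu> * (x \<bullet> f)\<^sup>2))"
      proof (rule integral_mono)
        show "integrable lborel (\<lambda>\<mu>. \<Sum>e\<in>G. h ((p e)\<^sup>2) \<mu> * ?b e)" by (simp add: hp)
        show "integrable lborel (\<lambda>\<mu>. \<Sum>f\<in>H. h ((q f)\<^sup>2) \<mu> * (x \<bullet> f)\<^sup>2)" by (simp add: hq)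
        fix \<mu> :: real
        show "(\<Sum>e\<in>G. h ((p e)\<^sup>2) \<mu> * ?b e) \<le> (\<Sum>f\<in>H. h ((q f)\<^sup>2) \<mu> * (x \<bullet> f)\<^sup>2)"
        proof (cases "\<mu> > 0")
          case True
          show ?thesis
            unfolding hk[OF True] mult.assoc sum_distrib_left[symmetric]
            using resolvent_form_mono[OF E F p q(1) le G H True, of "\<lambda>f. x \<bullet> f"]
            by (intro mult_left_mono) (simp_all add: mult.assoc)
        qed (simp add: h_def)
      qed
      also have "\<dots> = (\<Sum>f\<in>H. c * ((q f)\<^sup>2 powr \<theta>) * (x \<bullet> f)\<^sup>2)"
        by (subst Bochner_Integration.integral_sum) (simp_all add: hq)
      finally have "c * (\<Sum>e\<in>G. ((p e)\<^sup>2 powr \<theta>) * ?b e) \<le> c * (\<Sum>f\<in>H. ((q f)\<^sup>2 powr \<theta>) * (x \<bullet> f)\<^sup>2)"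
        by (simp add: sum_distrib_left mult.assoc)
      then have "(\<Sum>e\<in>G. ((p e)\<^sup>2 powr \<theta>) * ?b e) \<le> (\<Sum>f\<in>H. ((q f)\<^sup>2 powr \<theta>) * (x \<bullet> f)\<^sup>2)"
        using c(1) by simp
      then show ?thesis using pG qH by (simp add: sq power_mult_distrib)
    qed
    let ?Q = "diag F (\<lambda>f. q f powr \<theta>) x"
    have part: "(\<Sum>e\<in>G. (p e powr \<theta> * (x \<bullet> e))\<^sup>2) \<le> (norm ?Q)\<^sup>2" if G: "finite G" "G \<subseteq> E" for G
    proof (rule tendsto_upperbound)
      have "((\<lambda>H. \<Sum>f\<in>H. (x \<bullet> f) *\<^sub>R f) \<longlongrightarrow> x) (finite_subsets_at_top F)"
        using basis_expansion[OF F, of x] unfolding has_sum_def .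
      then show "((\<lambda>H. \<Sum>e\<in>G. (p e powr \<theta> * ((\<Sum>f\<in>H. (x \<bullet> f) *\<^sub>R f) \<bullet> e))\<^sup>2)
          \<longlongrightarrow> (\<Sum>e\<in>G. (p e powr \<theta> * (x \<bullet> e))\<^sup>2)) (finite_subsets_at_top F)"
        by (intro tendsto_intros)
      show "\<forall>\<^sub>F H in finite_subsets_at_top F.
          (\<Sum>e\<in>G. (p e powr \<theta> * ((\<Sum>f\<in>H. (x \<bullet> f) *\<^sub>R f) \<bullet> e))\<^sup>2) \<le> (norm ?Q)\<^sup>2"
      proof (rule eventually_finite_subsets_at_top_weakI)
        fix H assume H: "finite H" "H \<subseteq> F"
        have "(\<Sum>f\<in>H. (q f powr \<theta> * (x \<bullet> f))\<^sup>2) \<le> (norm ?Q)\<^sup>2"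
          by (rule finite_sum_le_has_sum[OF diag_norm[OF F diag_dom_bounded[OF F q(2)]] H]) simp
        then show "(\<Sum>e\<in>G. (p e powr \<theta> * ((\<Sum>f\<in>H. (x \<bullet> f) *\<^sub>R f) \<bullet> e))\<^sup>2) \<le> (norm ?Q)\<^sup>2"
          using fin[OF G H] by linarith
      qed
    qed simp
    have "(\<lambda>e. (p e powr \<theta> * (x \<bullet> e))\<^sup>2) summable_on E"
      by (rule nonneg_bounded_partial_sums_imp_summable_on[where C = "(norm ?Q)\<^sup>2"])
         (auto simp: eventually_finite_subsets_at_top intro!: exI[of _ "{}"] part)
    then have "((\<lambda>e. (p e powr \<theta> * (x \<bullet> e))\<^sup>2) has_sum (norm (diag E (\<lambda>e. p e powr \<theta>) x))\<^sup>2) E"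
      by (intro diag_norm[OF E]) (simp add: diag_dom_def)
    then have "(norm (diag E (\<lambda>e. p e powr \<theta>) x))\<^sup>2 \<le> (norm ?Q)\<^sup>2"
      by (rule has_sum_le_finite_sums) (rule part)
    then show ?thesis by (simp add: power2_le_iff_abs_le)
  qed
qed

lemma bounded_powr_image:
  fixes c :: "'a \<Rightarrow> real"
  assumes "bounded (c ` E)" "\<And>e. e \<in> E \<Longrightarrow> c e > 0" "r \<ge> 0"
  shows "bounded ((\<lambda>e. c e powr r) ` E)"
proof -
  obtain K where "\<And>e. e \<in> E \<Longrightarrow> \<bar>c e\<bar> \<le> K" using assms(1) by (auto simp: bounded_iff)
  then have "\<bar>c e powr r\<bar> \<le> K powr r" if "e \<in> E" for e
    using assms(2)[OF that] assms(3) that by (auto intro!: powr_mono2 dest: abs_le_D1)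
  then show ?thesis by (auto simp: bounded_iff)
qed

text \<open>The constant is absorbed into \<open>q\<close>, and \<open>C powr \<theta> \<le> C\<close> since \<open>C \<ge> 1\<close>.\<close>

lemma heinz_inequality_const:
  fixes E F :: "'a::{real_inner, complete_space} set"
  assumes E: "hilbert_basis E" and F: "hilbert_basis F"
    and p: "\<And>e. e \<in> E \<Longrightarrow> p e > 0" "bounded (p ` E)"
    and q: "\<And>f. f \<in> F \<Longrightarrow> q f > 0" "bounded (q ` F)"
    and C: "C \<ge> 1" and le: "\<And>x. norm (diag E p x) \<le> C * norm (diag F q x)"
    and \<theta>: "0 \<le> \<theta>" "\<theta> \<le> 1"
  shows "norm (diag E (\<lambda>e. p e powr \<theta>) x) \<le> C * norm (diag F (\<lambda>f. q f powr \<theta>) x)"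
proof -
  have Cq: "bounded ((\<lambda>f. C * q f) ` F)"
    using bounded_scaling[OF q(2), of C] by (simp add: image_image)
  have scale: "C * norm (diag F q x) \<le> norm (diag F (\<lambda>f. C * q f) x)" for x
  proof -
    have "norm (diag F q x) \<le> (1 / C) * norm (diag F (\<lambda>f. C * q f) x)"
      using C by (intro diag_dominated[OF F diag_dom_bounded[OF F Cq]]) (auto simp: abs_mult)
    then show ?thesis using C by (simp add: field_simps)
  qed
  have "norm (diag E (\<lambda>e. p e powr \<theta>) x) \<le> norm (diag F (\<lambda>f. (C * q f) powr \<theta>) x)"
  proof (rule heinz_inequality[OF E F p _ _ _ \<theta>])
    show "C * q f > 0" if "f \<in> F" for f using q(1)[OF that] C by simp
    then show "bounded ((\<lambda>f. (C * q f) powr \<theta>) ` F)" by (intro bounded_powr_image[OF Cq _ \<theta>(1)])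
    show "norm (diag E p x) \<le> norm (diag F (\<lambda>f. C * q f) x)" for x
      using le[of x] scale[of x] by linarith
  qed
  also have "\<dots> \<le> C * norm (diag F (\<lambda>f. q f powr \<theta>) x)"
  proof (rule diag_dominated[OF F diag_dom_bounded[OF F bounded_powr_image[OF q(2,1) \<theta>(1)]]])
    fix f assume "f \<in> F"
    have "C powr \<theta> \<le> C powr 1" using C \<theta> by (intro powr_mono) auto
    then show "\<bar>(C * q f) powr \<theta>\<bar> \<le> C * \<bar>q f powr \<theta>\<bar>"
      using C q(1)[OF \<open>f \<in> F\<close>] by (simp add: powr_mult mult_right_mono)
  qed (use C in auto)
  finally show ?thesis .
qed

text \<open>Picard's criterion for the range of one diagonal operator inside that of another: with
  \<open>y = P g\<close>, testing \<open>\<langle>y, x\<rangle> = \<langle>g, P x\<rangle> \<le> C \<parallel>g\<parallel> \<parallel>Q x\<parallel>\<close> on the finite sections \<open>x\<close> of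
  \<open>Q\<^sup>-\<^sup>2 y\<close> bounds the finite sections of \<open>\<parallel>Q\<^sup>-\<^sup>1 y\<parallel>\<^sup>2\<close> by \<open>C\<^sup>2 \<parallel>g\<parallel>\<^sup>2\<close>.\<close>

lemma range_inclusion:
  fixes E F :: "'a::{real_inner, complete_space} set"
  assumes E: "hilbert_basis E" and F: "hilbert_basis F"
    and c: "bounded (c ` E)" and d: "\<And>f. f \<in> F \<Longrightarrow> d f > 0"
    and C: "C \<ge> 0" and le: "\<And>x. norm (diag E c x) \<le> C * norm (diag F d x)"
  shows "diag E c g \<in> diag_dom F (\<lambda>f. inverse (d f))"
    and "norm (diag F (\<lambda>f. inverse (d f)) (diag E c g)) \<le> C * norm g"
proof -
  let ?y = "diag E c g"
  have fin: "(\<Sum>f\<in>H. (inverse (d f) * (?y \<bullet> f))\<^sup>2) \<le> (C * norm g)\<^sup>2" if H: "finite H" "H \<subseteq> F" for H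
  proof -
    let ?Q = "\<Sum>f\<in>H. (inverse (d f) * (?y \<bullet> f))\<^sup>2"
    define x where "x = (\<Sum>f\<in>H. ((inverse (d f))\<^sup>2 * (?y \<bullet> f)) *\<^sub>R f)"
    have dH: "d f > 0" if "f \<in> H" for f using d H(2) that by auto
    have "?Q = ?y \<bullet> x"
      unfolding x_def inner_sum_right by (simp add: power2_eq_square mult_ac)
    also have "\<dots> = g \<bullet> diag E c x" by (rule diag_symmetric[OF E c])
    also have "\<dots> \<le> norm g * norm (diag E c x)" by (rule norm_cauchy_schwarz)
    also have "\<dots> \<le> (C * norm g) * norm (diag F d x)"
      using mult_left_mono[OF le[of x], of "norm g"] by (simp add: mult_ac)
    finally have le': "?Q \<le> (C * norm g) * norm (diag F d x)" .
    have "(norm (diag F d x))\<^sup>2 = (\<Sum>f\<in>H. (d f * ((inverse (d f))\<^sup>2 * (?y \<bullet> f)))\<^sup>2)"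
      unfolding x_def by (rule diag_finite_sum[OF F H])
    also have "\<dots> = ?Q"
    proof (rule sum.cong[OF refl])
      fix f assume "f \<in> H"
      have "d f * (inverse (d f))\<^sup>2 = inverse (d f)"
        using dH[OF \<open>f \<in> H\<close>] by (simp add: power2_eq_square field_simps)
      then show "(d f * ((inverse (d f))\<^sup>2 * (?y \<bullet> f)))\<^sup>2 = (inverse (d f) * (?y \<bullet> f))\<^sup>2"
        by (simp flip: mult.assoc)
    qed
    finally have Q: "?Q = (norm (diag F d x))\<^sup>2" ..
    then have "norm (diag F d x) * norm (diag F d x) \<le> (C * norm g) * norm (diag F d x)"
      using le' by (simp add: power2_eq_square)
    then have "norm (diag F d x) \<le> C * norm g"
      using C by (cases "norm (diag F d x) = 0") auto
    then show ?thesis unfolding Q by (rule power_mono) simp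
  qed
  show dom: "?y \<in> diag_dom F (\<lambda>f. inverse (d f))"
    unfolding diag_dom_def mem_Collect_eq
    by (rule nonneg_bounded_partial_sums_imp_summable_on[where C = "(C * norm g)\<^sup>2"])
       (auto simp: eventually_finite_subsets_at_top intro!: exI[of _ "{}"] fin)
  have "(norm (diag F (\<lambda>f. inverse (d f)) ?y))\<^sup>2 \<le> (C * norm g)\<^sup>2"
    by (rule has_sum_le_finite_sums[OF diag_norm[OF F dom]]) (rule fin)
  then show "norm (diag F (\<lambda>f. inverse (d f)) ?y) \<le> C * norm g"
    using C by (simp add: power2_le_iff_abs_le)
qed

section \<open>Eigenbases\<close>

lemma eigenbasis:
  fixes T :: "'a::{real_inner, complete_space} \<Rightarrow> 'a"
  assumes "selfadjoint T" "\<And>x. T x \<bullet> x \<ge> 0" "compact (closure (T ` cball 0 1))"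
  shows "hilbert_basis (eigenbasis T)" and "e \<in> eigenbasis T \<Longrightarrow> T e = (T e \<bullet> e) *\<^sub>R e"
proof -
  have *: "hilbert_basis (eigenbasis T) \<and> (\<forall>e\<in>eigenbasis T. \<exists>c. T e = c *\<^sub>R e)"
    unfolding eigenbasis_def using spectral_theorem[OF assms] by (rule someI_ex)
  then show "hilbert_basis (eigenbasis T)" ..
  assume e: "e \<in> eigenbasis T"
  then obtain c where c: "T e = c *\<^sub>R e" using * by blast
  have "e \<bullet> e = 1" using * e by (simp add: hilbert_basis_def dot_square_norm)
  then show "T e = (T e \<bullet> e) *\<^sub>R e" using c by simp
qed

lemma eigenvalues_bounded:
  assumes "bounded_linear T" and "orthonormal E"
  shows "bounded ((\<lambda>e. T e \<bullet> e) ` E)"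
proof -
  obtain K where K: "\<And>x. norm (T x) \<le> norm x * K" using bounded_linear.nonneg_bounded[OF assms(1)] by blast
  have "\<bar>T e \<bullet> e\<bar> \<le> K" if "e \<in> E" for e
    using Cauchy_Schwarz_ineq2[of "T e" e] K[of e] assms(2) that by (simp add: orthonormal_def)
  then show ?thesis by (auto simp: bounded_iff)
qed

lemma compact_operator_bounded_linear:
  assumes "compact_operator T"
  shows "bounded_linear T"
proof -
  have lin: "linear T" using assms by (simp add: compact_operator_def)
  have "bounded (T ` cball 0 1)"
    using assms bounded_subset[OF compact_imp_bounded closure_subset] by (auto simp: compact_operator_def)
  then obtain K where K: "\<And>x. norm x \<le> 1 \<Longrightarrow> norm (T x) \<le> K" unfolding bounded_iff by (metis image_eqI mem_cball_0)
  show ?thesis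
  proof (rule bounded_linear_intro[where K = K])
    fix x
    show "norm (T x) \<le> norm x * K"
    proof (cases "x = 0")
      case False
      have "norm (T ((1 / norm x) *\<^sub>R x)) \<le> K" by (rule K) (use False in simp)
      then show ?thesis using False by (simp add: linear_cmul[OF lin] field_simps)
    qed (simp add: linear_0[OF lin])
  qed (use lin in \<open>simp_all add: linear_add linear_cmul\<close>)
qed

section \<open>The forward operator in the Hilbert scale\<close>

text \<open>In the following locale \<open>E\<close>, \<open>\<sigma>\<close> are the eigenvectors and eigenvalues of \<open>S\<close>, and \<open>F\<close>, \<open>\<rho>\<close> those of
  \<open>G = B\<^sup>* B\<close>. The two operators need not commute; only the norms of powers of the two operators can be
  compared, by the link condition.\<close>

locale linked_operator =
  fixes A :: "'x::{real_inner, complete_space, second_countable_topology} \<Rightarrow> 'y::real_inner" and S :: "'x \<Rightarrow> 'x" and \<nu> C :: real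
  assumes A_compact: "compact_operator A"
    and S_trace: "positive_trace_class S" and S_pos: "positive_definite S"
    and nu_pos: "\<nu> > 0" and C_gt_1: "C > 1"
    and link: "\<And>x. (1 / C) * scale_norm S \<nu> x \<le> norm (A x)" "\<And>x. norm (A x) \<le> C * scale_norm S \<nu> x"
begin

definition "E = eigenbasis S"
definition "\<sigma> e = S e \<bullet> e"
definition "B = A \<circ> op_powr S (1 / 2)"
definition "G = adjoint B \<circ> B"
definition "F = eigenbasis G"
definition "\<rho> f = G f \<bullet> f"

lemma E_basis: "hilbert_basis E" and S_eigen: "e \<in> E \<Longrightarrow> S e = \<sigma> e *\<^sub>R e"
  unfolding E_def \<sigma>_def using S_trace
  by (auto intro!: eigenbasis trace_class_compact simp: positive_trace_class_def)

lemma sigma_pos: "e \<in> E \<Longrightarrow> \<sigma> e > 0"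
  using S_pos E_basis unfolding positive_definite_def \<sigma>_def hilbert_basis_def
  by (metis norm_zero zero_neq_one)

lemma sigma_bounded: "bounded (\<sigma> ` E)"
  using eigenvalues_bounded[OF _ hilbert_basis_orthonormal[OF E_basis], of S] S_trace
  by (simp add: positive_trace_class_def selfadjoint_def \<sigma>_def)

lemma sigma_powr_bounded: "r \<ge> 0 \<Longrightarrow> bounded ((\<lambda>e. \<sigma> e powr r) ` E)"
  by (rule bounded_powr_image[OF sigma_bounded sigma_pos])

lemma S_powr: "op_powr S r = diag E (\<lambda>e. \<sigma> e powr r)"
  by (simp add: op_powr_diag E_def \<sigma>_def)

lemma S_powr_dom: "op_powr_dom S r = diag_dom E (\<lambda>e. \<sigma> e powr r)"
  by (simp add: op_powr_dom_diag E_def \<sigma>_def)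

lemma S_powr_dom_UNIV: "r \<ge> 0 \<Longrightarrow> x \<in> op_powr_dom S r"
  unfolding S_powr_dom by (intro diag_dom_bounded[OF E_basis] sigma_powr_bounded)

lemma S_powr_bounded_linear: "r \<ge> 0 \<Longrightarrow> bounded_linear (op_powr S r)"
  unfolding S_powr by (intro bounded_linear_diag[OF E_basis] sigma_powr_bounded)

lemma S_powr_symmetric: "r \<ge> 0 \<Longrightarrow> op_powr S r x \<bullet> y = x \<bullet> op_powr S r y"
  unfolding S_powr by (intro diag_symmetric[OF E_basis] sigma_powr_bounded)

lemma S_powr_inner: "x \<in> op_powr_dom S r \<Longrightarrow> e \<in> E \<Longrightarrow> op_powr S r x \<bullet> e = \<sigma> e powr r * (x \<bullet> e)"
  unfolding S_powr S_powr_dom by (rule diag_inner[OF E_basis])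

lemma S_powr_S_powr:
  "x \<in> op_powr_dom S r \<Longrightarrow> x \<in> op_powr_dom S (q + r) \<Longrightarrow> op_powr S q (op_powr S r x) = op_powr S (q + r) x"
  unfolding S_powr S_powr_dom by (simp add: diag_diag[OF E_basis] powr_add)

lemma S_powr_0: "op_powr S 0 x = x"
  unfolding S_powr by (rule diag_one[OF E_basis]) (use sigma_pos in \<open>simp add: order_less_imp_not_eq2\<close>)

lemma S_powr_dom_mono:
  assumes x: "x \<in> op_powr_dom S r" and "r \<le> q"
  shows "x \<in> op_powr_dom S q"
proof -
  obtain K where K: "\<And>e. e \<in> E \<Longrightarrow> \<sigma> e powr (q - r) \<le> K"
    using sigma_powr_bounded[of "q - r"] assms(2) by (auto simp: bounded_iff)
  have "\<bar>\<sigma> e powr q\<bar> \<le> K * \<bar>\<sigma> e powr r\<bar>" if "e \<in> E" for e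
  proof -
    have "\<sigma> e powr q = \<sigma> e powr (q - r) * \<sigma> e powr r" by (simp flip: powr_add)
    also have "\<dots> \<le> K * \<sigma> e powr r" by (intro mult_right_mono K that) simp
    finally show ?thesis by simp
  qed
  with x show ?thesis unfolding S_powr_dom by (rule diag_dom_dominated)
qed

lemma A_bounded_linear: "bounded_linear A"
  by (rule compact_operator_bounded_linear[OF A_compact])

lemma B_bounded_linear: "bounded_linear B"
  unfolding B_def comp_def
  by (intro bounded_linear_compose[OF A_bounded_linear] S_powr_bounded_linear) simp

lemma B_norm:
  "(1 / C) * norm (op_powr S ((1 + \<nu>) / 2) x) \<le> norm (B x)"
  "norm (B x) \<le> C * norm (op_powr S ((1 + \<nu>) / 2) x)"
proof -
  have "scale_norm S \<nu> (op_powr S (1 / 2) x) = norm (op_powr S ((1 + \<nu>) / 2) x)"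
    unfolding scale_norm_def
    by (subst S_powr_S_powr) (use nu_pos in \<open>auto intro!: S_powr_dom_UNIV simp: add_divide_distrib add.commute\<close>)
  then show "(1 / C) * norm (op_powr S ((1 + \<nu>) / 2) x) \<le> norm (B x)"
    "norm (B x) \<le> C * norm (op_powr S ((1 + \<nu>) / 2) x)"
    using link[of "op_powr S (1 / 2) x"] by (simp_all add: B_def)
qed

lemma G_form: "G x \<bullet> y = B x \<bullet> B y"
  using adjoint_inner[OF B_bounded_linear, of y "B x"] by (simp add: G_def inner_commute)

lemma G_bounded_linear: "bounded_linear G"
  unfolding G_def comp_def
  by (intro bounded_linear_compose[OF bounded_linear_adjoint B_bounded_linear] B_bounded_linear)

text \<open>Up to a scaling by the norm \<open>R\<close> of \<open>S\<^sup>1\<^sup>/\<^sup>2\<close>, the image of the unit ball under \<open>G\<close> lies in the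
  image under \<open>B\<^sup>*\<close> of the compact closure of \<open>A (cball 0 1)\<close>.\<close>

lemma G_compact: "compact (closure (G ` cball 0 1))"
proof -
  obtain R where R: "R > 0" "\<And>x. norm (op_powr S (1 / 2) x) \<le> norm x * R"
    using bounded_linear.pos_bounded[OF S_powr_bounded_linear[of "1 / 2"]] by auto
  interpret A: bounded_linear A by (rule A_bounded_linear)
  let ?T = "\<lambda>y. R *\<^sub>R adjoint B y"
  interpret B': bounded_linear "adjoint B" by (rule bounded_linear_adjoint[OF B_bounded_linear])
  have "compact (?T ` closure (A ` cball 0 1))"
    using A_compact unfolding compact_operator_def
    by (intro compact_continuous_image continuous_intros B'.continuous_on) auto
  moreover have "G ` cball 0 1 \<subseteq> ?T ` closure (A ` cball 0 1)"
  proof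
    fix y assume "y \<in> G ` cball 0 1"
    then obtain x where x: "norm x \<le> 1" "y = G x" by auto
    let ?z = "(1 / R) *\<^sub>R op_powr S (1 / 2) x"
    have "norm (op_powr S (1 / 2) x) \<le> R" using R(2)[of x] mult_right_mono[OF x(1) less_imp_le[OF R(1)]] by linarith
    then have "A ?z \<in> closure (A ` cball 0 1)"
      using R(1) by (intro subsetD[OF closure_subset] imageI) (simp add: field_simps)
    moreover have "B x = R *\<^sub>R A ?z" using R(1) by (simp add: B_def A.scaleR)
    then have "y = ?T (A ?z)" by (simp add: x(2) G_def B'.scaleR)
    ultimately show "y \<in> ?T ` closure (A ` cball 0 1)" by blast
  qed
  ultimately show ?thesis
    by (metis closure_minimal compact_Int_closed compact_imp_closed closed_closure inf.absorb_iff2)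
qed

lemma G_selfadjoint: "selfadjoint G"
  unfolding selfadjoint_def using G_bounded_linear
  by (simp add: G_form) (metis G_form inner_commute)

lemma F_basis: "hilbert_basis F" and G_eigen: "f \<in> F \<Longrightarrow> G f = \<rho> f *\<^sub>R f"
proof -
  have "G x \<bullet> x \<ge> 0" for x by (simp add: G_form)
  note eig = eigenbasis[OF G_selfadjoint this G_compact]
  show "hilbert_basis F" unfolding F_def by (rule eig(1))
  show "f \<in> F \<Longrightarrow> G f = \<rho> f *\<^sub>R f" unfolding F_def \<rho>_def by (rule eig(2))
qed

lemma B_eq_0: "B x = 0 \<Longrightarrow> x = 0"
proof -
  assume "B x = 0"
  then have "norm (op_powr S ((1 + \<nu>) / 2) x) \<le> 0" using B_norm(1)[of x] C_gt_1 by (simp add: field_simps)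
  then have "op_powr S ((1 + \<nu>) / 2) x \<bullet> e = 0" for e by simp
  then have "x \<bullet> e = 0" if "e \<in> E" for e
    using S_powr_inner[of x "(1 + \<nu>) / 2" e] S_powr_dom_UNIV[of "(1 + \<nu>) / 2" x] nu_pos sigma_pos[OF that] that
    by simp
  then show "x = 0" using basis_eqI[OF E_basis, of x 0] by simp
qed

lemma rho_pos: "f \<in> F \<Longrightarrow> \<rho> f > 0"
proof -
  assume "f \<in> F"
  then have "norm f = 1" using F_basis by (simp add: hilbert_basis_def)
  then have "B f \<noteq> 0" using B_eq_0 by fastforce
  then show ?thesis by (simp add: \<rho>_def G_form)
qed

lemma rho_bounded: "bounded (\<rho> ` F)"
  using eigenvalues_bounded[OF G_bounded_linear hilbert_basis_orthonormal[OF F_basis]] by (simp add: \<rho>_def)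

lemma rho_powr_bounded: "r \<ge> 0 \<Longrightarrow> bounded ((\<lambda>f. \<rho> f powr r) ` F)"
  by (rule bounded_powr_image[OF rho_bounded rho_pos])

lemma G_powr: "op_powr G r = diag F (\<lambda>f. \<rho> f powr r)"
  by (simp add: op_powr_diag F_def \<rho>_def)

lemma G_diag: "G = diag F \<rho>"
proof
  fix x show "G x = diag F \<rho> x"
  proof (rule basis_eqI[OF F_basis])
    fix f assume f: "f \<in> F"
    have "G x \<bullet> f = x \<bullet> G f" by (rule selfadjoint_swap[OF G_selfadjoint])
    then show "G x \<bullet> f = diag F \<rho> x \<bullet> f"
      using f by (simp add: G_eigen diag_inner[OF F_basis] diag_dom_bounded[OF F_basis rho_bounded])
  qed
qed

lemma B_norm_has_sum: "((\<lambda>f. \<rho> f * (x \<bullet> f)\<^sup>2) has_sum (norm (B x))\<^sup>2) F"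
proof -
  have "((\<lambda>f. \<rho> f * (x \<bullet> f) * (x \<bullet> f)) has_sum (G x \<bullet> x)) F"
    unfolding G_diag by (rule diag_inner_has_sum[OF F_basis diag_dom_bounded[OF F_basis rho_bounded]])
  then show ?thesis by (simp add: G_form dot_square_norm power2_eq_square mult.assoc)
qed

lemma norm_G_sqrt: "norm (op_powr G (1 / 2) x) = norm (B x)"
proof -
  have "((\<lambda>f. (\<rho> f powr (1 / 2) * (x \<bullet> f))\<^sup>2) has_sum (norm (op_powr G (1 / 2) x))\<^sup>2) F"
    unfolding G_powr by (intro diag_norm[OF F_basis] diag_dom_bounded[OF F_basis] rho_powr_bounded) auto
  moreover have "(\<rho> f powr (1 / 2) * (x \<bullet> f))\<^sup>2 = \<rho> f * (x \<bullet> f)\<^sup>2" if "f \<in> F" for f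
    using rho_pos[OF that] by (simp add: power_mult_distrib powr_half_sqrt)
  ultimately have "((\<lambda>f. \<rho> f * (x \<bullet> f)\<^sup>2) has_sum (norm (op_powr G (1 / 2) x))\<^sup>2) F"
    by (simp cong: has_sum_cong)
  then show ?thesis using B_norm_has_sum[of x] has_sum_unique power2_eq_imp_eq by (metis norm_ge_zero)
qed

text \<open>The link condition says that \<open>G\<^sup>1\<^sup>/\<^sup>2\<close> and \<open>S\<^sup>(\<^sup>1\<^sup>+\<^sup>\<nu>\<^sup>)\<^sup>/\<^sup>2\<close> have comparable norms; the Heinz
  inequality extends this to the powers of order \<open>\<theta>\<close>.\<close>

lemma S_le_G:
  assumes "0 \<le> \<theta>" "\<theta> \<le> 1"
  shows "norm (op_powr S (\<theta> * (1 + \<nu>) / 2) x) \<le> C * norm (op_powr G (\<theta> / 2) x)"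
proof -
  have "norm (diag E (\<lambda>e. (\<sigma> e powr ((1 + \<nu>) / 2)) powr \<theta>) x) \<le> C * norm (diag F (\<lambda>f. (\<rho> f powr (1 / 2)) powr \<theta>) x)"
  proof (rule heinz_inequality_const[OF E_basis F_basis _ _ _ _ _ _ assms])
    fix x
    show "norm (diag E (\<lambda>e. \<sigma> e powr ((1 + \<nu>) / 2)) x) \<le> C * norm (diag F (\<lambda>f. \<rho> f powr (1 / 2)) x)"
      using B_norm(1)[of x] norm_G_sqrt[of x] C_gt_1 by (simp add: S_powr G_powr field_simps)
  qed (use C_gt_1 nu_pos sigma_pos rho_pos in \<open>auto intro!: sigma_powr_bounded rho_powr_bounded simp: order_less_imp_not_eq2\<close>)
  then show ?thesis by (simp add: S_powr G_powr powr_powr mult_ac)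
qed

lemma G_le_S:
  assumes "0 \<le> \<theta>" "\<theta> \<le> 1"
  shows "norm (op_powr G (\<theta> / 2) x) \<le> C * norm (op_powr S (\<theta> * (1 + \<nu>) / 2) x)"
proof -
  have "norm (diag F (\<lambda>f. (\<rho> f powr (1 / 2)) powr \<theta>) x) \<le> C * norm (diag E (\<lambda>e. (\<sigma> e powr ((1 + \<nu>) / 2)) powr \<theta>) x)"
  proof (rule heinz_inequality_const[OF F_basis E_basis _ _ _ _ _ _ assms])
    fix x
    show "norm (diag F (\<lambda>f. \<rho> f powr (1 / 2)) x) \<le> C * norm (diag E (\<lambda>e. \<sigma> e powr ((1 + \<nu>) / 2)) x)"
      using B_norm(2)[of x] norm_G_sqrt[of x] by (simp add: S_powr G_powr)
  qed (use C_gt_1 nu_pos sigma_pos rho_pos in \<open>auto intro!: sigma_powr_bounded rho_powr_bounded simp: order_less_imp_not_eq2\<close>)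
  then show ?thesis by (simp add: S_powr G_powr powr_powr mult_ac)
qed

text \<open>By Picard's criterion the range of a power of \<open>S\<close> lies in the domain of the corresponding negative
  power of \<open>G\<close>. This is used both to solve the source equation and to bound \<open>G\<^sup>-\<^sup>\<tau>\<close> in the variance.\<close>

lemma S_range_in_G_range:
  assumes "0 \<le> \<theta>" "\<theta> \<le> 1"
  shows "op_powr S (\<theta> * (1 + \<nu>) / 2) g \<in> op_powr_dom G (- \<theta> / 2)"
    and "norm (op_powr G (- \<theta> / 2) (op_powr S (\<theta> * (1 + \<nu>) / 2) g)) \<le> C * norm g"
proof -
  have eq: "(\<lambda>f. inverse (\<rho> f powr (\<theta> / 2))) = (\<lambda>f. \<rho> f powr (- \<theta> / 2))"
    by (simp add: powr_minus)
  have c: "bounded ((\<lambda>e. \<sigma> e powr (\<theta> * (1 + \<nu>) / 2)) ` E)"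
    using assms nu_pos by (intro sigma_powr_bounded) auto
  have d: "\<rho> f powr (\<theta> / 2) > 0" if "f \<in> F" for f using rho_pos[OF that] by simp
  have C: "C \<ge> 0" using C_gt_1 by simp
  have le: "norm (diag E (\<lambda>e. \<sigma> e powr (\<theta> * (1 + \<nu>) / 2)) x) \<le> C * norm (diag F (\<lambda>f. \<rho> f powr (\<theta> / 2)) x)" for x
    using S_le_G[OF assms] by (simp add: S_powr G_powr)
  have r: "diag E (\<lambda>e. \<sigma> e powr (\<theta> * (1 + \<nu>) / 2)) g \<in> diag_dom F (\<lambda>f. inverse (\<rho> f powr (\<theta> / 2)))"
    "norm (diag F (\<lambda>f. inverse (\<rho> f powr (\<theta> / 2))) (diag E (\<lambda>e. \<sigma> e powr (\<theta> * (1 + \<nu>) / 2)) g)) \<le> C * norm g"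
    by (rule range_inclusion[OF E_basis F_basis c d C le], assumption)+
  show "op_powr S (\<theta> * (1 + \<nu>) / 2) g \<in> op_powr_dom G (- \<theta> / 2)"
    using r(1) unfolding eq by (simp add: S_powr op_powr_dom_diag F_def \<rho>_def)
  show "norm (op_powr G (- \<theta> / 2) (op_powr S (\<theta> * (1 + \<nu>) / 2) g)) \<le> C * norm g"
    using r(2) unfolding eq by (simp add: S_powr G_powr)
qed

end

section \<open>Scalar estimates for the filters\<close>

lemma le_powr_of_le_min:
  fixes a x q :: real
  assumes "a \<le> 1" "a \<le> x" "x > 0" "0 \<le> q" "q \<le> 1"
  shows "a \<le> x powr q"
proof (cases "x \<ge> 1")
  case True
  then show ?thesis using ge_one_powr_ge_zero[of x q] assms by linarith
next
  case False
  then have "x powr 1 \<le> x powr q" using assms by (intro powr_mono') auto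
  then show ?thesis using assms by simp
qed

text \<open>The average of the powers is at most \<open>1\<close> and, by the geometric sum, at most \<open>\<alpha> / (n r)\<close>. Averaging
  yields the first power of \<open>1 / n\<close> and no more; this is the saturation behind \<open>s \<le> \<nu> + 2\<close>.\<close>

lemma averaged_filter_bound:
  fixes \<alpha> r q :: real
  assumes "\<alpha> > 0" "r > 0" "n \<ge> 1" "0 \<le> q" "q \<le> 1"
  shows "(1 / real n) * (\<Sum>k=1..n. (\<alpha> / (\<alpha> + r)) ^ k) \<le> (\<alpha> / (real n * r)) powr q"
proof (rule le_powr_of_le_min[OF _ _ _ assms(4,5)])
  let ?x = "\<alpha> / (\<alpha> + r)"
  have x: "0 < ?x" "?x < 1" "1 - ?x = r / (\<alpha> + r)" using assms by (auto simp: field_simps)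
  have "(\<Sum>k=1..n. ?x ^ k) \<le> (\<Sum>k=1..n. 1)"
    using x by (intro sum_mono power_le_one) auto
  then show "(1 / real n) * (\<Sum>k=1..n. ?x ^ k) \<le> 1" using assms(3) by (simp add: field_simps)
  have "(\<Sum>k=1..n. y ^ k) * (1 - y) = y - y ^ Suc n" for y :: real
  proof (induction n)
    case (Suc n)
    have "(\<Sum>k=1..Suc n. y ^ k) * (1 - y) = (\<Sum>k=1..n. y ^ k) * (1 - y) + y ^ Suc n * (1 - y)"
      by (simp add: distrib_right)
    also have "\<dots> = y - y ^ Suc (Suc n)" unfolding Suc.IH by (simp add: algebra_simps)
    finally show ?case .
  qed simp
  from this[of ?x] have "(\<Sum>k=1..n. ?x ^ k) * (1 - ?x) = ?x - ?x ^ Suc n" .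
  then have "(\<Sum>k=1..n. ?x ^ k) * (r / (\<alpha> + r)) \<le> \<alpha> / (\<alpha> + r)"
    unfolding x(3) using x zero_le_power[of ?x "Suc n"] by linarith
  then have "(\<Sum>k=1..n. ?x ^ k) * r / (\<alpha> + r) \<le> \<alpha> / (\<alpha> + r)" by simp
  then have "(\<Sum>k=1..n. ?x ^ k) * r \<le> \<alpha>"
    using assms(1,2) by (simp add: divide_le_cancel)
  then have "(\<Sum>k=1..n. ?x ^ k) \<le> \<alpha> / r"
    using assms(2) by (simp only: pos_le_divide_eq)
  then have "(1 / real n) * (\<Sum>k=1..n. ?x ^ k) \<le> (1 / real n) * (\<alpha> / r)"
    by (intro mult_left_mono) auto
  then show "(1 / real n) * (\<Sum>k=1..n. ?x ^ k) \<le> \<alpha> / (real n * r)" by simp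
qed (use assms in auto)

text \<open>With \<open>b = 1 - (\<alpha> / (\<alpha> + r))\<^sup>m\<close> the left hand side is \<open>b\<^sup>2 / r\<close>. Both \<open>b \<le> 1\<close> and \<open>b \<le> n r / \<alpha>\<close> hold,
  and the free parameter \<open>\<tau>\<close> interpolates between these two bounds.\<close>

lemma noise_filter_bound:
  fixes \<alpha> r \<tau> :: real
  assumes "\<alpha> > 0" "r > 0" "m \<le> n" "n \<ge> 1" "0 \<le> \<tau>" "\<tau> \<le> 1"
  shows "r * ((1 / (\<alpha> + r)) * (\<Sum>j<m. (\<alpha> / (\<alpha> + r)) ^ j))\<^sup>2 \<le> (real n / \<alpha>) powr (1 - \<tau>) * r powr (- \<tau>)"
proof -
  let ?x = "\<alpha> / (\<alpha> + r)"
  define b where "b = r * ((1 / (\<alpha> + r)) * (\<Sum>j<m. ?x ^ j))"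
  have x: "0 < ?x" "?x < 1" "1 - ?x = r / (\<alpha> + r)" using assms by (auto simp: field_simps)
  have "(1 - ?x) * (\<Sum>j<m. ?x ^ j) = 1 - ?x ^ m" by (rule one_diff_power_eq[symmetric])
  then have "b = 1 - ?x ^ m" unfolding x(3) by (simp add: b_def)
  then have b: "0 \<le> b" "b \<le> 1" using x by (simp_all add: power_le_one)
  have "(\<Sum>j<m. ?x ^ j) \<le> (\<Sum>j<m. 1)" using x by (intro sum_mono power_le_one) auto
  also have "\<dots> \<le> real n" using assms by simp
  finally have "b \<le> r * ((1 / (\<alpha> + r)) * real n)"
    unfolding b_def using assms by (intro mult_left_mono) auto
  also have "\<dots> \<le> r * ((1 / \<alpha>) * real n)"
    using assms by (intro mult_left_mono mult_right_mono frac_le) auto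
  finally have "b \<le> real n / \<alpha> * r" by (simp add: mult_ac)
  then have "b \<le> (real n / \<alpha> * r) powr (1 - \<tau>)"
    using assms b by (intro le_powr_of_le_min) auto
  then have "b * b \<le> (real n / \<alpha> * r) powr (1 - \<tau>)"
    using b mult_left_le[of b b] by linarith
  also have "\<dots> = r * ((real n / \<alpha>) powr (1 - \<tau>) * r powr (- \<tau>))"
    using assms powr_mult_base[of r "- \<tau>"] powr_mult[of "real n / \<alpha>" r "1 - \<tau>"] by simp
  finally have "r * (r * ((1 / (\<alpha> + r)) * (\<Sum>j<m. ?x ^ j))\<^sup>2) \<le> r * ((real n / \<alpha>) powr (1 - \<tau>) * r powr (- \<tau>))"
    by (simp add: b_def power2_eq_square mult_ac)
  then show ?thesis using assms(2) by simp
qed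

section \<open>The source element\<close>

lemma funpow_bounded_linear:
  fixes T :: "'a::real_normed_vector \<Rightarrow> 'a"
  assumes "bounded_linear T" shows "bounded_linear (T ^^ k)"
proof (induction k)
  case 0
  show ?case by (simp add: id_def bounded_linear_ident)
next
  case (Suc k)
  show ?case using bounded_linear_compose[OF assms Suc] by (simp add: comp_def)
qed

lemma bounded_abs_image: "(\<And>f. f \<in> F' \<Longrightarrow> \<bar>c f\<bar> \<le> (k::real)) \<Longrightarrow> bounded (c ` F')"
  by (auto simp: bounded_iff)

context linked_operator begin

lemma G_powr_dom: "op_powr_dom G r = diag_dom F (\<lambda>f. \<rho> f powr r)"
  by (simp add: op_powr_dom_diag F_def \<rho>_def)

lemma G_powr_dom_UNIV: "r \<ge> 0 \<Longrightarrow> x \<in> op_powr_dom G r"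
  unfolding G_powr_dom by (intro diag_dom_bounded[OF F_basis] rho_powr_bounded)

lemma G_powr_bounded_linear: "r \<ge> 0 \<Longrightarrow> bounded_linear (op_powr G r)"
  unfolding G_powr by (intro bounded_linear_diag[OF F_basis] rho_powr_bounded)

lemma G_powr_cancel:
  assumes "x \<in> op_powr_dom G r"
  shows "op_powr G r x \<in> op_powr_dom G (- r)" and "op_powr G (- r) (op_powr G r x) = x"
proof -
  have 1: "\<rho> f powr - r * \<rho> f powr r = 1" if "f \<in> F" for f
    using rho_pos[OF that] by (simp flip: powr_add add: order_less_imp_not_eq2)
  then have dom: "x \<in> diag_dom F (\<lambda>f. \<rho> f powr - r * \<rho> f powr r)"
    by (intro diag_dom_bounded[OF F_basis] bounded_const_image)
  show "op_powr G r x \<in> op_powr_dom G (- r)"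
    using assms dom unfolding G_powr G_powr_dom by (simp add: diag_dom_diag[OF F_basis])
  show "op_powr G (- r) (op_powr G r x) = x"
    using assms dom 1 unfolding G_powr G_powr_dom
    by (simp add: diag_diag[OF F_basis] diag_one[OF F_basis])
qed

lemma source_solution_iff: "source_solution A S \<nu> s w z \<longleftrightarrow>
  (if s \<ge> 1 then w \<in> op_powr_dom S (- 1 / 2) \<and> op_powr S (- 1 / 2) w = op_powr G ((s - 1) / (2 * (1 + \<nu>))) z
   else scale_inv_sqrt S s w \<in> scale_completion S (1 - s) \<and>
     (\<forall>\<xi>\<in>scale_inv_sqrt S s w. (\<lambda>m. op_powr G ((1 - s) / (2 * (1 + \<nu>))) (\<xi> m)) \<longlonglongrightarrow> z))"
  unfolding source_solution_def Let_def B_def[symmetric] G_def[symmetric] ..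

text \<open>For \<open>s \<ge> 1\<close> the element \<open>S\<^sup>-\<^sup>1\<^sup>/\<^sup>2 w\<close> lies in the range of \<open>S\<^sup>(\<^sup>s\<^sup>-\<^sup>1\<^sup>)\<^sup>/\<^sup>2\<close>, hence in the domain of the
  negative power of \<open>G\<close> that solves the source equation; here \<open>s \<le> \<nu> + 2\<close> keeps the interpolation
  parameter \<open>\<theta>\<close> at most \<open>1\<close>.\<close>

lemma source_solution_ge_1:
  assumes s: "1 \<le> s" "s \<le> \<nu> + 2" and w: "w \<in> op_powr_dom S (- s / 2)"
  shows "\<exists>!z. source_solution A S \<nu> s w z"
proof -
  define \<theta> where "\<theta> = (s - 1) / (1 + \<nu>)"
  have \<theta>: "0 \<le> \<theta>" "\<theta> \<le> 1" "\<theta> * (1 + \<nu>) / 2 = (s - 1) / 2" "(s - 1) / (2 * (1 + \<nu>)) = \<theta> / 2"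
    using s nu_pos by (auto simp: \<theta>_def field_simps)
  define g where "g = op_powr S (- s / 2) w"
  have w': "w \<in> op_powr_dom S (- 1 / 2)" by (rule S_powr_dom_mono[OF w]) (use s in simp)
  have "op_powr S ((s - 1) / 2) g = op_powr S ((s - 1) / 2 + - s / 2) w"
    unfolding g_def by (rule S_powr_S_powr[OF w]) (use w' in \<open>simp add: diff_divide_distrib\<close>)
  then have v: "op_powr S (- 1 / 2) w = op_powr S (\<theta> * (1 + \<nu>) / 2) g"
    unfolding \<theta>(3) by (simp add: diff_divide_distrib)
  define z where "z = op_powr G (- \<theta> / 2) (op_powr S (- 1 / 2) w)"
  have "op_powr S (- 1 / 2) w = op_powr G (\<theta> / 2) z"
    unfolding z_def v using G_powr_cancel(2)[OF S_range_in_G_range(1)[OF \<theta>(1,2), of g]] by simp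
  moreover have "z' = z''" if "op_powr G (\<theta> / 2) z' = op_powr G (\<theta> / 2) z''" for z' z''
    using G_powr_cancel(2)[OF G_powr_dom_UNIV] that \<theta>(1) by (metis divide_nonneg_pos zero_less_numeral)
  ultimately show ?thesis
    unfolding source_solution_iff \<theta>(4) using w' s(1) by auto
qed

text \<open>For \<open>s < 1\<close> the completion is represented by the operator \<open>S\<^sup>(\<^sup>1\<^sup>-\<^sup>s\<^sup>)\<^sup>/\<^sup>2\<close>: a sequence \<open>\<xi>\<close> belongs to
  the class of \<open>S\<^sup>-\<^sup>1\<^sup>/\<^sup>2 w\<close> iff its image converges to \<open>S\<^sup>-\<^sup>s\<^sup>/\<^sup>2 w\<close>.\<close>

lemma scale_inv_sqrt_iff:
  assumes s: "0 \<le> s" "s < 1" and w: "w \<in> op_powr_dom S (- s / 2)"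
  shows "\<xi> \<in> scale_inv_sqrt S s w \<longleftrightarrow> (\<lambda>m. op_powr S ((1 - s) / 2) (\<xi> m)) \<longlonglongrightarrow> op_powr S (- s / 2) w"
    and "op_powr S (1 / 2) x - w = op_powr S (s / 2) (op_powr S ((1 - s) / 2) x - op_powr S (- s / 2) w)"
proof -
  let ?g = "op_powr S (- s / 2) w"
  interpret P: bounded_linear "op_powr S (s / 2)" by (rule S_powr_bounded_linear) (use s in simp)
  have dom: "x \<in> op_powr_dom S r" if "r \<ge> 0" for x r using S_powr_dom_UNIV that .
  have "op_powr S (s / 2) ?g = w"
    using S_powr_S_powr[OF w, of "s / 2"] S_powr_dom_UNIV[of 0 w] by (simp add: S_powr_0)
  moreover have "op_powr S (s / 2) (op_powr S ((1 - s) / 2) x) = op_powr S (1 / 2) x" for x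
    using s by (subst S_powr_S_powr) (auto intro!: dom simp: field_simps)
  ultimately show eq: "op_powr S (1 / 2) x - w = op_powr S (s / 2) (op_powr S ((1 - s) / 2) x - ?g)" for x
    by (simp add: P.diff)
  have "op_powr S (- s / 2) (op_powr S (s / 2) y) = y" for y
    using s by (subst S_powr_S_powr) (auto intro!: dom simp: S_powr_0)
  then have "scale_norm S (- s) (op_powr S (1 / 2) x - w) = norm (op_powr S ((1 - s) / 2) x - ?g)" for x
    unfolding eq scale_norm_def by simp
  then show "\<xi> \<in> scale_inv_sqrt S s w \<longleftrightarrow> (\<lambda>m. op_powr S ((1 - s) / 2) (\<xi> m)) \<longlonglongrightarrow> ?g"
    unfolding scale_inv_sqrt_def
    by (simp add: tendsto_norm_zero_iff LIM_zero_iff)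
qed

text \<open>The range contains all eigenvectors.\<close>

lemma S_powr_dense_range:
  assumes "r \<ge> 0"
  obtains \<xi> where "(\<lambda>m. op_powr S r (\<xi> m)) \<longlonglongrightarrow> g"
proof -
  interpret P: bounded_linear "op_powr S r" by (rule S_powr_bounded_linear[OF assms])
  have "subspace (range (op_powr S r))"
    by (rule linear_subspace_image[OF P.linear_axioms subspace_UNIV])
  moreover have "e \<in> range (op_powr S r)" if "e \<in> E" for e
  proof -
    have "op_powr S r ((1 / \<sigma> e powr r) *\<^sub>R e) = e"
      unfolding P.scaleR using diag_basis(1)[OF E_basis that, of "\<lambda>e. \<sigma> e powr r"] sigma_pos[OF that]
      by (simp add: S_powr)
    then show ?thesis by (metis rangeI)
  qed
  ultimately have "span E \<subseteq> range (op_powr S r)" by (intro span_minimal) auto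
  then have "g \<in> closure (range (op_powr S r))"
    using closure_mono[of "span E"] E_basis unfolding hilbert_basis_def by blast
  then obtain h where h: "\<forall>m. h m \<in> range (op_powr S r)" "h \<longlonglongrightarrow> g"
    unfolding closure_sequential by blast
  from h(1) have "\<forall>m. \<exists>x. h m = op_powr S r x" by auto
  from choice[OF this] obtain \<xi> where "\<forall>m. h m = op_powr S r (\<xi> m)" ..
  then have "h = (\<lambda>m. op_powr S r (\<xi> m))" by auto
  then show ?thesis using h(2) by (intro that[of \<xi>]) simp
qed

text \<open>For \<open>s < 1\<close> the power of \<open>G\<close> in the source equation is dominated by the norm of the completion, so
  it maps Cauchy sequences to convergent ones and equivalent sequences to the same limit.\<close>

lemma source_solution_less_1:
  assumes s: "0 \<le> s" "s < 1" and w: "w \<in> op_powr_dom S (- s / 2)"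
  shows "\<exists>!z. source_solution A S \<nu> s w z"
proof -
  define \<theta> where "\<theta> = (1 - s) / (1 + \<nu>)"
  have \<theta>: "0 \<le> \<theta>" "\<theta> \<le> 1" "\<theta> * (1 + \<nu>) / 2 = (1 - s) / 2" "(1 - s) / (2 * (1 + \<nu>)) = \<theta> / 2"
    using s nu_pos by (auto simp: \<theta>_def field_simps)
  define g where "g = op_powr S (- s / 2) w"
  define J where "J = op_powr S ((1 - s) / 2)"
  define P where "P = op_powr G (\<theta> / 2)"
  interpret J: bounded_linear J unfolding J_def by (rule S_powr_bounded_linear) (use s in simp)
  interpret P: bounded_linear P unfolding P_def by (rule G_powr_bounded_linear) (use \<theta> in simp)
  have PJ: "norm (P x) \<le> C * norm (J x)" for x
    using G_le_S[OF \<theta>(1,2), of x] unfolding \<theta>(3) P_def J_def .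
  have X: "\<xi> \<in> scale_inv_sqrt S s w \<longleftrightarrow> (\<lambda>m. J (\<xi> m)) \<longlonglongrightarrow> g" for \<xi>
    unfolding J_def g_def by (rule scale_inv_sqrt_iff(1)[OF s w])
  have cauchy: "scale_Cauchy S (1 - s) \<xi> \<longleftrightarrow> Cauchy (\<lambda>m. J (\<xi> m))" for \<xi>
    unfolding scale_Cauchy_def Cauchy_def scale_norm_def J_def[symmetric] dist_norm J.diff by simp
  \<comment> \<open>A representative, which shows that the class is nonempty and that the solution is unique.\<close>
  obtain \<xi>\<^sub>0 where \<xi>0: "(\<lambda>m. J (\<xi>\<^sub>0 m)) \<longlonglongrightarrow> g"
    unfolding J_def by (rule S_powr_dense_range[of "(1 - s) / 2"]) (use s in auto)
  have "scale_inv_sqrt S s w = scale_equiv S (1 - s) `` {\<xi>\<^sub>0}"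
  proof (intro set_eqI iffI)
    fix \<zeta> assume "\<zeta> \<in> scale_inv_sqrt S s w"
    then have z: "(\<lambda>m. J (\<zeta> m)) \<longlonglongrightarrow> g" by (simp add: X)
    have "(\<lambda>m. norm (J (\<xi>\<^sub>0 m) - J (\<zeta> m))) \<longlonglongrightarrow> norm (g - g)"
      by (intro tendsto_intros \<xi>0 z)
    then show "\<zeta> \<in> scale_equiv S (1 - s) `` {\<xi>\<^sub>0}"
      using z \<xi>0 by (auto simp: scale_equiv_def cauchy LIMSEQ_imp_Cauchy scale_norm_def J_def[symmetric] J.diff)
  next
    fix \<zeta> assume "\<zeta> \<in> scale_equiv S (1 - s) `` {\<xi>\<^sub>0}"
    then have "(\<lambda>m. norm (J (\<xi>\<^sub>0 m) - J (\<zeta> m))) \<longlonglongrightarrow> 0"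
      by (simp add: scale_equiv_def scale_norm_def J_def[symmetric] J.diff)
    then have "(\<lambda>m. J (\<xi>\<^sub>0 m) - J (\<zeta> m)) \<longlonglongrightarrow> 0" by (rule tendsto_norm_zero_cancel)
    from tendsto_diff[OF \<xi>0 this] show "\<zeta> \<in> scale_inv_sqrt S s w" by (simp add: X)
  qed
  then have completion: "scale_inv_sqrt S s w \<in> scale_completion S (1 - s)"
    using \<xi>0 by (auto simp: scale_completion_def cauchy LIMSEQ_imp_Cauchy intro!: quotientI)
  have "Cauchy (\<lambda>m. P (\<xi>\<^sub>0 m))"
  proof (rule CauchyI)
    fix d :: real assume d: "d > 0"
    then have "d / C > 0" using C_gt_1 by simp
    then obtain N where N: "\<And>m n. m \<ge> N \<Longrightarrow> n \<ge> N \<Longrightarrow> norm (J (\<xi>\<^sub>0 m) - J (\<xi>\<^sub>0 n)) < d / C"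
      using CauchyD[OF LIMSEQ_imp_Cauchy[OF \<xi>0]] by blast
    have "norm (P (\<xi>\<^sub>0 m) - P (\<xi>\<^sub>0 n)) < d" if "m \<ge> N" "n \<ge> N" for m n
    proof -
      have "norm (P (\<xi>\<^sub>0 m) - P (\<xi>\<^sub>0 n)) \<le> C * norm (J (\<xi>\<^sub>0 m) - J (\<xi>\<^sub>0 n))"
        using PJ[of "\<xi>\<^sub>0 m - \<xi>\<^sub>0 n"] by (simp add: P.diff J.diff)
      also have "\<dots> < d" using N[OF that] C_gt_1 by (simp add: field_simps)
      finally show ?thesis .
    qed
    then show "\<exists>N. \<forall>m\<ge>N. \<forall>n\<ge>N. norm (P (\<xi>\<^sub>0 m) - P (\<xi>\<^sub>0 n)) < d" by blast
  qed
  then obtain z where z: "(\<lambda>m. P (\<xi>\<^sub>0 m)) \<longlonglongrightarrow> z" using Cauchy_convergent_iff convergent_def by blast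
  have "(\<lambda>m. P (\<xi> m)) \<longlonglongrightarrow> z" if "\<xi> \<in> scale_inv_sqrt S s w" for \<xi>
  proof -
    have "(\<lambda>m. J (\<xi> m)) \<longlonglongrightarrow> g" using that by (simp add: X)
    from tendsto_diff[OF this \<xi>0] have "(\<lambda>m. J (\<xi> m - \<xi>\<^sub>0 m)) \<longlonglongrightarrow> 0" by (simp add: J.diff)
    from tendsto_mult[OF tendsto_const tendsto_norm[OF this], of C]
    have lim: "(\<lambda>m. C * norm (J (\<xi> m - \<xi>\<^sub>0 m))) \<longlonglongrightarrow> 0" by simp
    have "\<forall>m. norm (P (\<xi> m - \<xi>\<^sub>0 m)) \<le> C * norm (J (\<xi> m - \<xi>\<^sub>0 m))" using PJ by blast
    from Lim_null_comparison[OF always_eventually[OF this] lim]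
    have "(\<lambda>m. P (\<xi> m - \<xi>\<^sub>0 m)) \<longlonglongrightarrow> 0" .
    from tendsto_add[OF this z] show ?thesis by (simp add: P.diff)
  qed
  then have sol: "source_solution A S \<nu> s w z"
    unfolding source_solution_iff \<theta>(4) P_def using completion s(2) by simp
  moreover have "z' = z" if "source_solution A S \<nu> s w z'" for z'
  proof -
    have "\<xi>\<^sub>0 \<in> scale_inv_sqrt S s w" using \<xi>0 by (simp add: X)
    then have "(\<lambda>m. P (\<xi>\<^sub>0 m)) \<longlonglongrightarrow> z'"
      using that s(2) unfolding source_solution_iff \<theta>(4) P_def by simp
    then show ?thesis using z LIMSEQ_unique by blast
  qed
  ultimately show ?thesis by blast
qed

section \<open>The gain and the error propagation operator\<close>

text \<open>The errors satisfy \<open>u\<^sub>n - u\<^sub>d = K \<eta>\<^sub>n + (I - K A) (u\<^sub>n\<^sub>-\<^sub>1 - u\<^sub>d)\<close>. The propagator \<open>I - K A\<close> is not symmetric,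
  but \<open>(I - K A) S\<^sup>1\<^sup>/\<^sup>2 = S\<^sup>1\<^sup>/\<^sup>2 \<alpha> (\<alpha> + G)\<^sup>-\<^sup>1\<close>, so that its powers become powers of the damping factors.\<close>

definition "propagator \<alpha> x = x - kalman_gain A S \<alpha> (A x)"

definition "damping \<alpha> f = \<alpha> / (\<alpha> + \<rho> f)"

lemma damping_bounds: "\<alpha> > 0 \<Longrightarrow> f \<in> F \<Longrightarrow> 0 < damping \<alpha> f \<and> damping \<alpha> f < 1"
  using rho_pos[of f] by (simp add: damping_def field_simps)

lemma damping_power_bounded: "\<alpha> > 0 \<Longrightarrow> bounded ((\<lambda>f. damping \<alpha> f ^ k) ` F)"
  using damping_bounds[of \<alpha>] by (intro bounded_abs_image[of _ _ 1]) (auto simp: power_le_one less_imp_le)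

lemma resolvent_bounded: "\<alpha> > 0 \<Longrightarrow> bounded ((\<lambda>f. 1 / (\<alpha> + \<rho> f)) ` F)"
proof (rule bounded_abs_image)
  fix f assume "\<alpha> > 0" "f \<in> F"
  then show "\<bar>1 / (\<alpha> + \<rho> f)\<bar> \<le> 1 / \<alpha>" using rho_pos[of f] by (simp add: frac_le)
qed

lemma kalman_gain_diag:
  assumes \<alpha>: "\<alpha> > 0"
  shows "kalman_gain A S \<alpha> y = op_powr S (1 / 2) (diag F (\<lambda>f. 1 / (\<alpha> + \<rho> f)) (adjoint B y))"
proof -
  let ?T = "\<lambda>x. \<alpha> *\<^sub>R x + G x" and ?D = "diag F (\<lambda>f. 1 / (\<alpha> + \<rho> f))"
  note D = diag_inner[OF F_basis diag_dom_bounded[OF F_basis resolvent_bounded[OF \<alpha>]]]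
  note Gi = diag_inner[OF F_basis diag_dom_bounded[OF F_basis rho_bounded], folded G_diag]
  have ne: "\<alpha> + \<rho> f \<noteq> 0" if "f \<in> F" for f using rho_pos[OF that] \<alpha> by simp
  have 1: "?D (?T x) = x" for x
  proof (rule basis_eqI[OF F_basis])
    fix f assume f: "f \<in> F"
    have "?D (?T x) \<bullet> f = (\<alpha> + \<rho> f) * (x \<bullet> f) / (\<alpha> + \<rho> f)"
      using f by (simp add: D Gi inner_add_left distrib_right)
    then show "?D (?T x) \<bullet> f = x \<bullet> f" using ne[OF f] by simp
  qed
  have 2: "?T (?D x) = x" for x
  proof (rule basis_eqI[OF F_basis])
    fix f assume f: "f \<in> F"
    have "?T (?D x) \<bullet> f = \<alpha> * ((x \<bullet> f) / (\<alpha> + \<rho> f)) + \<rho> f * ((x \<bullet> f) / (\<alpha> + \<rho> f))"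
      using f by (simp add: D Gi inner_add_left)
    also have "\<dots> = (\<alpha> + \<rho> f) * ((x \<bullet> f) / (\<alpha> + \<rho> f))" by (rule distrib_right[symmetric])
    finally have "?T (?D x) \<bullet> f = (\<alpha> + \<rho> f) * ((x \<bullet> f) / (\<alpha> + \<rho> f))" .
    then show "?T (?D x) \<bullet> f = x \<bullet> f" using ne[OF f] by simp
  qed
  have "inv ?T = ?D" by (rule inv_equality) (use 1 2 in auto)
  then show ?thesis
    unfolding kalman_gain_def Let_def B_def[symmetric] by (simp add: G_def)
qed

lemma kalman_gain_bounded_linear:
  assumes "\<alpha> > 0" shows "bounded_linear (kalman_gain A S \<alpha>)"
  unfolding kalman_gain_diag[OF assms]
  by (intro bounded_linear_compose[OF S_powr_bounded_linear] bounded_linear_compose[OF bounded_linear_diag[OF F_basis]]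
      resolvent_bounded assms bounded_linear_adjoint B_bounded_linear) simp

lemma kalman_gain_inner:
  assumes \<alpha>: "\<alpha> > 0"
  shows "kalman_gain A S \<alpha> y \<bullet> x = y \<bullet> B (diag F (\<lambda>f. 1 / (\<alpha> + \<rho> f)) (op_powr S (1 / 2) x))"
proof -
  have "kalman_gain A S \<alpha> y \<bullet> x = adjoint B y \<bullet> diag F (\<lambda>f. 1 / (\<alpha> + \<rho> f)) (op_powr S (1 / 2) x)"
    by (simp add: kalman_gain_diag[OF \<alpha>] S_powr_symmetric diag_symmetric[OF F_basis resolvent_bounded[OF \<alpha>]])
  then show ?thesis
    using adjoint_inner[OF B_bounded_linear] by (simp add: inner_commute)
qed

lemma adjoint_kalman_gain:
  assumes \<alpha>: "\<alpha> > 0"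
  shows "adjoint (kalman_gain A S \<alpha>) = (\<lambda>x. B (diag F (\<lambda>f. 1 / (\<alpha> + \<rho> f)) (op_powr S (1 / 2) x)))"
  by (rule adjoint_unique) (simp add: kalman_gain_inner[OF \<alpha>])

lemma propagator_bounded_linear: "\<alpha> > 0 \<Longrightarrow> bounded_linear (propagator \<alpha>)"
  unfolding propagator_def
  by (intro bounded_linear_sub bounded_linear_ident
      bounded_linear_compose[OF kalman_gain_bounded_linear A_bounded_linear])

lemma propagator_S_sqrt:
  assumes \<alpha>: "\<alpha> > 0"
  shows "propagator \<alpha> (op_powr S (1 / 2) x) = op_powr S (1 / 2) (diag F (damping \<alpha>) x)"
proof -
  interpret P: bounded_linear "op_powr S (1 / 2)" by (rule S_powr_bounded_linear) simp
  note D = diag_inner[OF F_basis diag_dom_bounded[OF F_basis resolvent_bounded[OF \<alpha>]]]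
  note Gi = diag_inner[OF F_basis diag_dom_bounded[OF F_basis rho_bounded], folded G_diag]
  have R: "diag F (damping \<alpha>) x \<bullet> f = damping \<alpha> f * (x \<bullet> f)" if "f \<in> F" for f
    using damping_power_bounded[OF \<alpha>, of 1] that
    by (intro diag_inner[OF F_basis diag_dom_bounded[OF F_basis]]) simp_all
  have "x - diag F (\<lambda>f. 1 / (\<alpha> + \<rho> f)) (G x) = diag F (damping \<alpha>) x"
  proof (rule basis_eqI[OF F_basis])
    fix f assume f: "f \<in> F"
    show "(x - diag F (\<lambda>f. 1 / (\<alpha> + \<rho> f)) (G x)) \<bullet> f = diag F (damping \<alpha>) x \<bullet> f"
      using f rho_pos[OF f] \<alpha> by (simp add: D Gi R inner_diff_left damping_def field_simps)
  qed
  moreover have "propagator \<alpha> (op_powr S (1 / 2) x) = op_powr S (1 / 2) (x - diag F (\<lambda>f. 1 / (\<alpha> + \<rho> f)) (G x))"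
    unfolding propagator_def kalman_gain_diag[OF \<alpha>] P.diff by (simp add: G_def B_def)
  ultimately show ?thesis by simp
qed

lemma diag_damping_power:
  assumes \<alpha>: "\<alpha> > 0"
  shows "diag F (damping \<alpha>) (diag F (\<lambda>f. damping \<alpha> f ^ k) x) = diag F (\<lambda>f. damping \<alpha> f ^ Suc k) x"
  using diag_diag[OF F_basis diag_dom_bounded[OF F_basis damping_power_bounded[OF \<alpha>, of k]]
      diag_dom_bounded[OF F_basis, of "\<lambda>f. damping \<alpha> f * damping \<alpha> f ^ k" x]] damping_power_bounded[OF \<alpha>, of "Suc k"]
  by simp

lemma propagator_power_S_sqrt:
  assumes \<alpha>: "\<alpha> > 0"
  shows "(propagator \<alpha> ^^ k) (op_powr S (1 / 2) x) = op_powr S (1 / 2) (diag F (\<lambda>f. damping \<alpha> f ^ k) x)"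
  by (induction k) (simp_all add: diag_one[OF F_basis] propagator_S_sqrt[OF \<alpha>] diag_damping_power[OF \<alpha>, simplified])

lemma propagator_power_inner:
  "\<alpha> > 0 \<Longrightarrow> (propagator \<alpha> ^^ k) x \<bullet> y = x \<bullet> (adjoint (propagator \<alpha>) ^^ k) y"
  by (induction k arbitrary: x y) (simp_all add: adjoint_inner[OF propagator_bounded_linear] flip: funpow_swap1)

lemma S_sqrt_adjoint_propagator_power:
  assumes \<alpha>: "\<alpha> > 0"
  shows "op_powr S (1 / 2) ((adjoint (propagator \<alpha>) ^^ k) y) = diag F (\<lambda>f. damping \<alpha> f ^ k) (op_powr S (1 / 2) y)"
proof -
  show ?thesis
  proof (rule basis_eqI[OF E_basis])
    fix e
    have "op_powr S (1 / 2) ((adjoint (propagator \<alpha>) ^^ k) y) \<bullet> e = (propagator \<alpha> ^^ k) (op_powr S (1 / 2) e) \<bullet> y"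
      using propagator_power_inner[OF \<alpha>, of k "op_powr S (1 / 2) e" y] S_powr_symmetric[of "1 / 2" "(adjoint (propagator \<alpha>) ^^ k) y" e]
      by (simp add: inner_commute)
    also have "\<dots> = diag F (\<lambda>f. damping \<alpha> f ^ k) (op_powr S (1 / 2) y) \<bullet> e"
      using diag_symmetric[OF F_basis damping_power_bounded[OF \<alpha>], of k e "op_powr S (1 / 2) y"]
        S_powr_symmetric[of "1 / 2" "diag F (\<lambda>f. damping \<alpha> f ^ k) e" y]
      by (simp add: propagator_power_S_sqrt[OF \<alpha>] inner_commute)
    finally show "op_powr S (1 / 2) ((adjoint (propagator \<alpha>) ^^ k) y) \<bullet> e = diag F (\<lambda>f. damping \<alpha> f ^ k) (op_powr S (1 / 2) y) \<bullet> e" .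
  qed
qed

section \<open>The deterministic error\<close>

definition "mean_propagator \<alpha> n w = (1 / real n) *\<^sub>R (\<Sum>k=1..n. (propagator \<alpha> ^^ k) w)"

lemma bounded_linear_mean_propagator: "\<alpha> > 0 \<Longrightarrow> bounded_linear (mean_propagator \<alpha> n)"
  unfolding mean_propagator_def
  by (intro bounded_linear_const_scaleR bounded_linear_sum funpow_bounded_linear propagator_bounded_linear)

text \<open>The bound \<open>t \<le> \<nu>\<close> enters here: \<open>S\<^sup>(\<^sup>t\<^sup>+\<^sup>1\<^sup>)\<^sup>/\<^sup>2\<close> is compared with a power of \<open>G\<close> of order at most \<open>1/2\<close>.\<close>

lemma scale_norm_S_sqrt:
  assumes t: "0 \<le> t" "t \<le> \<nu>"
  shows "scale_norm S t (op_powr S (1 / 2) x) \<le> C * norm (op_powr G ((t + 1) / (2 * (1 + \<nu>))) x)"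
proof -
  define \<theta> where "\<theta> = (t + 1) / (1 + \<nu>)"
  have \<theta>: "0 \<le> \<theta>" "\<theta> \<le> 1" "\<theta> * (1 + \<nu>) / 2 = (t + 1) / 2" "(t + 1) / (2 * (1 + \<nu>)) = \<theta> / 2"
    using t nu_pos by (auto simp: \<theta>_def field_simps)
  have "scale_norm S t (op_powr S (1 / 2) x) = norm (op_powr S ((t + 1) / 2) x)"
    unfolding scale_norm_def
    by (subst S_powr_S_powr) (use t in \<open>auto intro!: S_powr_dom_UNIV simp: add_divide_distrib\<close>)
  also have "\<dots> \<le> C * norm (op_powr G (\<theta> / 2) x)"
    using S_le_G[OF \<theta>(1,2)] unfolding \<theta>(3) .
  finally show ?thesis unfolding \<theta>(4) .
qed

text \<open>The exponents of \<open>\<rho>\<close> on the two sides differ by \<open>q = (s + t) / (2 (1 + \<nu>))\<close>, and \<open>\<rho>\<^sup>q\<close> times the averaged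
  filter is at most \<open>(\<alpha> / n)\<^sup>q\<close>. The statement covers both signs of the exponent of \<open>G\<close> on the right,
  which is the norm of the source element.\<close>

lemma mean_propagator_S_sqrt_bound:
  assumes \<alpha>: "\<alpha> > 0" and n: "n \<ge> 1" and s: "0 \<le> s" "s \<le> \<nu> + 2" and t: "0 \<le> t" "t \<le> \<nu>"
    and x: "x \<in> op_powr_dom G ((1 - s) / (2 * (1 + \<nu>)))"
  shows "scale_norm S t (mean_propagator \<alpha> n (op_powr S (1 / 2) x))
    \<le> C * ((\<alpha> / real n) powr ((s + t) / (2 * (1 + \<nu>))) * norm (op_powr G ((1 - s) / (2 * (1 + \<nu>))) x))"
proof -
  interpret P: bounded_linear "op_powr S (1 / 2)" by (rule S_powr_bounded_linear) simp
  define a where "a f = (1 / real n) * (\<Sum>k=1..n. damping \<alpha> f ^ k)" for f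
  define q where "q = (s + t) / (2 * (1 + \<nu>))"
  define d where "d = (1 - s) / (2 * (1 + \<nu>))"
  define h where "h = (t + 1) / (2 * (1 + \<nu>))"
  have q: "0 \<le> q" "q \<le> 1" using s t nu_pos by (auto simp: q_def field_simps)
  have h: "h = d + q" "h \<ge> 0" using t nu_pos by (auto simp: h_def d_def q_def simp flip: add_divide_distrib)
  have "0 \<le> damping \<alpha> f ^ k" if "f \<in> F" for f k using damping_bounds[OF \<alpha> that] by simp
  then have a: "0 \<le> a f" "a f \<le> (\<alpha> / (real n * \<rho> f)) powr q" if f: "f \<in> F" for f
    using averaged_filter_bound[OF \<alpha> rho_pos[OF f] n q] f by (simp_all add: a_def damping_def sum_nonneg)
  have a1: "\<bar>a f\<bar> \<le> 1" if f: "f \<in> F" for f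
  proof -
    have "a f \<le> (\<alpha> / (real n * \<rho> f)) powr 0"
      using averaged_filter_bound[OF \<alpha> rho_pos[OF f] n, of 0] unfolding a_def damping_def by simp
    also have "\<dots> = 1" using rho_pos[OF f] \<alpha> n by simp
    finally show ?thesis using a(1)[OF f] by simp
  qed
  have "mean_propagator \<alpha> n (op_powr S (1 / 2) x) = op_powr S (1 / 2) ((1 / real n) *\<^sub>R (\<Sum>k=1..n. diag F (\<lambda>f. damping \<alpha> f ^ k) x))"
    unfolding mean_propagator_def by (simp add: propagator_power_S_sqrt[OF \<alpha>] P.scaleR P.sum)
  also have "(1 / real n) *\<^sub>R (\<Sum>k=1..n. diag F (\<lambda>f. damping \<alpha> f ^ k) x) = diag F a x"
  proof (rule basis_eqI[OF F_basis])
    fix f assume f: "f \<in> F"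
    have "diag F (\<lambda>f. damping \<alpha> f ^ k) x \<bullet> f = damping \<alpha> f ^ k * (x \<bullet> f)" for k
      by (intro diag_inner[OF F_basis diag_dom_bounded[OF F_basis damping_power_bounded[OF \<alpha>]] f])
    moreover have "diag F a x \<bullet> f = a f * (x \<bullet> f)"
      by (rule diag_inner[OF F_basis diag_dom_bounded[OF F_basis bounded_abs_image[OF a1]] f])
    ultimately show "((1 / real n) *\<^sub>R (\<Sum>k=1..n. diag F (\<lambda>f. damping \<alpha> f ^ k) x)) \<bullet> f = diag F a x \<bullet> f"
      by (simp add: a_def[of f] inner_sum_left sum_distrib_right)
  qed
  finally have "scale_norm S t (mean_propagator \<alpha> n (op_powr S (1 / 2) x)) \<le> C * norm (op_powr G h (diag F a x))"
    using scale_norm_S_sqrt[OF t] by (simp add: h_def)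
  also have "op_powr G h (diag F a x) = diag F (\<lambda>f. \<rho> f powr h * a f) x"
  proof -
    obtain K where K: "\<And>f. f \<in> F \<Longrightarrow> \<bar>\<rho> f powr h\<bar> \<le> K" using rho_powr_bounded[OF h(2)] by (auto simp: bounded_iff)
    have "\<bar>\<rho> f powr h * a f\<bar> \<le> K" if "f \<in> F" for f
      using mult_mono[OF K[OF that] a1[OF that]] order_trans[OF abs_ge_zero K[OF that]] by (simp add: abs_mult)
    then show ?thesis
      unfolding G_powr by (intro diag_diag[OF F_basis] diag_dom_bounded[OF F_basis] bounded_abs_image) (use a1 in auto)
  qed
  also have "norm (diag F (\<lambda>f. \<rho> f powr h * a f) x) \<le> (\<alpha> / real n) powr q * norm (diag F (\<lambda>f. \<rho> f powr d) x)"
  proof (rule diag_dominated[OF F_basis])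
    show "x \<in> diag_dom F (\<lambda>f. \<rho> f powr d)" using x by (simp add: G_powr_dom d_def)
    fix f assume f: "f \<in> F"
    have "\<rho> f powr h * a f \<le> \<rho> f powr h * (\<alpha> / (real n * \<rho> f)) powr q"
      by (intro mult_left_mono a(2) f) simp
    also have "\<dots> = \<rho> f powr d * (\<rho> f * (\<alpha> / (real n * \<rho> f))) powr q"
      unfolding h(1) powr_add mult.assoc powr_mult ..
    also have "\<rho> f * (\<alpha> / (real n * \<rho> f)) = \<alpha> / real n" using rho_pos[OF f] by simp
    finally show "\<bar>\<rho> f powr h * a f\<bar> \<le> (\<alpha> / real n) powr q * \<bar>\<rho> f powr d\<bar>"
      using a(1)[OF f] by (simp add: abs_mult mult.commute)
  qed simp
  finally show ?thesis using C_gt_1 by (simp add: G_powr q_def d_def)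
qed

text \<open>For \<open>s \<ge> 1\<close> the preceding bound applies to \<open>x = S\<^sup>-\<^sup>1\<^sup>/\<^sup>2 w\<close> itself. For \<open>s < 1\<close> it is applied to the
  members of a sequence that represents this element, and passes to the limit.\<close>

lemma bias_bound:
  assumes \<alpha>: "\<alpha> > 0" and n: "n \<ge> 1" and s: "0 \<le> s" "s \<le> \<nu> + 2" and t: "0 \<le> t" "t \<le> \<nu>"
    and w: "w \<in> op_powr_dom S (- s / 2)" and z: "source_solution A S \<nu> s w z"
  shows "scale_norm S t (mean_propagator \<alpha> n w) \<le> C * ((\<alpha> / real n) powr ((s + t) / (2 * (1 + \<nu>))) * norm z)"
proof (cases "s \<ge> 1")
  case True
  define p where "p = (s - 1) / (2 * (1 + \<nu>))"
  have p: "p \<ge> 0" "(1 - s) / (2 * (1 + \<nu>)) = - p" using True nu_pos by (auto simp: p_def field_simps)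
  have wd: "w \<in> op_powr_dom S (- 1 / 2)" and v: "op_powr S (- 1 / 2) w = op_powr G p z"
    using z True by (simp_all add: source_solution_iff p_def)
  have "op_powr S (1 / 2) (op_powr S (- 1 / 2) w) = w"
    using S_powr_S_powr[OF wd, of "1 / 2"] S_powr_dom_UNIV[of 0 w] by (simp add: S_powr_0)
  then show ?thesis
    using mean_propagator_S_sqrt_bound[OF \<alpha> n s t, of "op_powr G p z"] G_powr_cancel[OF G_powr_dom_UNIV[OF p(1)], of z]
    unfolding p(2) v by simp
next
  case False
  then have s1: "s < 1" by simp
  define d where "d = (1 - s) / (2 * (1 + \<nu>))"
  define q where "q = (s + t) / (2 * (1 + \<nu>))"
  obtain \<xi> where \<xi>: "(\<lambda>m. op_powr S ((1 - s) / 2) (\<xi> m)) \<longlonglongrightarrow> op_powr S (- s / 2) w"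
    by (rule S_powr_dense_range[of "(1 - s) / 2"]) (use s1 in auto)
  have Gz: "(\<lambda>m. op_powr G d (\<xi> m)) \<longlonglongrightarrow> z"
    using z False scale_inv_sqrt_iff(1)[OF s(1) s1 w, of \<xi>] \<xi> by (simp add: source_solution_iff d_def)
  interpret P: bounded_linear "op_powr S (s / 2)" by (rule S_powr_bounded_linear) (use s in simp)
  interpret T: bounded_linear "op_powr S (t / 2)" by (rule S_powr_bounded_linear) (use t in simp)
  interpret m: bounded_linear "mean_propagator \<alpha> n" by (rule bounded_linear_mean_propagator[OF \<alpha>])
  have "(\<lambda>m. op_powr S (1 / 2) (\<xi> m) - w) \<longlonglongrightarrow> op_powr S (s / 2) (op_powr S (- s / 2) w - op_powr S (- s / 2) w)"
    unfolding scale_inv_sqrt_iff(2)[OF s(1) s1 w] by (intro P.tendsto tendsto_diff \<xi> tendsto_const)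
  then have "(\<lambda>m. op_powr S (1 / 2) (\<xi> m)) \<longlonglongrightarrow> w" by (simp add: P.zero LIM_zero_iff)
  then have "(\<lambda>m. scale_norm S t (mean_propagator \<alpha> n (op_powr S (1 / 2) (\<xi> m)))) \<longlonglongrightarrow> scale_norm S t (mean_propagator \<alpha> n w)"
    unfolding scale_norm_def by (intro tendsto_norm T.tendsto m.tendsto)
  moreover have "(\<lambda>m. C * ((\<alpha> / real n) powr q * norm (op_powr G d (\<xi> m)))) \<longlonglongrightarrow> C * ((\<alpha> / real n) powr q * norm z)"
    by (intro tendsto_mult tendsto_const tendsto_norm Gz)
  moreover have "d \<ge> 0" using s1 nu_pos by (simp add: d_def)
  then have "scale_norm S t (mean_propagator \<alpha> n (op_powr S (1 / 2) (\<xi> m))) \<le> C * ((\<alpha> / real n) powr q * norm (op_powr G d (\<xi> m)))" for m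
    unfolding q_def d_def by (intro mean_propagator_S_sqrt_bound[OF \<alpha> n s t] G_powr_dom_UNIV)
  ultimately show ?thesis unfolding q_def by (intro LIMSEQ_le) blast+
qed

section \<open>The noise amplification\<close>

text \<open>The coefficient of the noise \<open>\<eta>\<^sub>k\<close> in the \<open>e\<close>-component of the averaged error, weighted by
  \<open>S\<^sup>t\<^sup>/\<^sup>2\<close>, has the squared norm \<open>\<langle>\<phi>(G) S\<^sup>(\<^sup>t\<^sup>+\<^sup>1\<^sup>)\<^sup>/\<^sup>2 e, S\<^sup>(\<^sup>t\<^sup>+\<^sup>1\<^sup>)\<^sup>/\<^sup>2 e\<rangle>\<close> where \<open>\<phi>(\<rho>)\<close> is at most a multiple of
  \<open>\<rho>\<^sup>-\<^sup>\<tau>\<close>. The range inclusion replaces \<open>G\<^sup>-\<^sup>\<tau>\<close> by \<open>S\<^sup>-\<^sup>\<tau>\<^sup>(\<^sup>1\<^sup>+\<^sup>\<nu>\<^sup>)\<close>.\<close>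

lemma noise_coefficient_bound:
  assumes \<alpha>: "\<alpha> > 0" and n: "n \<ge> 1" and m: "m \<le> n" and t: "0 \<le> t" and \<tau>: "0 \<le> \<tau>" "\<tau> \<le> 1" and e: "e \<in> E"
  shows "(norm (adjoint (kalman_gain A S \<alpha>) (\<Sum>j<m. (adjoint (propagator \<alpha>) ^^ j) (op_powr S (t / 2) e))))\<^sup>2
    \<le> (real n / \<alpha>) powr (1 - \<tau>) * (C\<^sup>2 * \<sigma> e powr (t + 1 - \<tau> * (1 + \<nu>)))"
proof -
  interpret P: bounded_linear "op_powr S (1 / 2)" by (rule S_powr_bounded_linear) simp
  define R where "R = diag F (\<lambda>f. 1 / (\<alpha> + \<rho> f))"
  define x where "x = op_powr S (1 / 2) (op_powr S (t / 2) e)"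
  define c where "c f = (1 / (\<alpha> + \<rho> f)) * (\<Sum>j<m. damping \<alpha> f ^ j)" for f
  have Rinner: "R y \<bullet> f = 1 / (\<alpha> + \<rho> f) * (y \<bullet> f)" if "f \<in> F" for y f
    unfolding R_def by (rule diag_inner[OF F_basis diag_dom_bounded[OF F_basis resolvent_bounded[OF \<alpha>]] that])
  have adj: "adjoint (kalman_gain A S \<alpha>) (\<Sum>j<m. (adjoint (propagator \<alpha>) ^^ j) (op_powr S (t / 2) e))
      = B (R (\<Sum>j<m. diag F (\<lambda>f. damping \<alpha> f ^ j) x))"
    by (simp add: adjoint_kalman_gain[OF \<alpha>] R_def x_def P.sum S_sqrt_adjoint_propagator_power[OF \<alpha>])
  have "R (\<Sum>j<m. diag F (\<lambda>f. damping \<alpha> f ^ j) x) \<bullet> f = c f * (x \<bullet> f)" if f: "f \<in> F" for f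
    using diag_inner[OF F_basis diag_dom_bounded[OF F_basis damping_power_bounded[OF \<alpha>]] f]
    by (simp add: Rinner[OF f] c_def inner_sum_left sum_distrib_right)
  then have "((\<lambda>f. \<rho> f * (c f * (x \<bullet> f))\<^sup>2) has_sum
      (norm (adjoint (kalman_gain A S \<alpha>) (\<Sum>j<m. (adjoint (propagator \<alpha>) ^^ j) (op_powr S (t / 2) e))))\<^sup>2) F"
    unfolding adj using B_norm_has_sum[of "R (\<Sum>j<m. diag F (\<lambda>f. damping \<alpha> f ^ j) x)"] by (simp cong: has_sum_cong)
  moreover have x: "x = op_powr S (\<tau> * (1 + \<nu>) / 2) (\<sigma> e powr ((t + 1 - \<tau> * (1 + \<nu>)) / 2) *\<^sub>R e)"
  proof -
    have 1: "op_powr S r (k *\<^sub>R e) = (\<sigma> e powr r * k) *\<^sub>R e" if "r \<ge> 0" for r k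
      using diag_basis(1)[OF E_basis e] linear_scale[OF bounded_linear.linear[OF S_powr_bounded_linear[OF that]]]
      by (simp add: S_powr)
    have "x = (\<sigma> e powr (1 / 2) * \<sigma> e powr (t / 2)) *\<^sub>R e"
      unfolding x_def using 1[of "1 / 2" "\<sigma> e powr (t / 2)"] 1[of "t / 2" 1] t by simp
    moreover have "op_powr S (\<tau> * (1 + \<nu>) / 2) (\<sigma> e powr ((t + 1 - \<tau> * (1 + \<nu>)) / 2) *\<^sub>R e)
        = (\<sigma> e powr (\<tau> * (1 + \<nu>) / 2) * \<sigma> e powr ((t + 1 - \<tau> * (1 + \<nu>)) / 2)) *\<^sub>R e"
      using \<tau> nu_pos by (intro 1) auto
    moreover have "\<sigma> e powr (\<tau> * (1 + \<nu>) / 2) * \<sigma> e powr ((t + 1 - \<tau> * (1 + \<nu>)) / 2) = \<sigma> e powr (1 / 2) * \<sigma> e powr (t / 2)"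
      unfolding powr_add[symmetric] by (intro arg_cong[of _ _ "(powr) (\<sigma> e)"]) (simp add: field_simps)
    ultimately show ?thesis by simp
  qed
  let ?k = "\<sigma> e powr ((t + 1 - \<tau> * (1 + \<nu>)) / 2)" and ?M = "(real n / \<alpha>) powr (1 - \<tau>)"
  have xd: "x \<in> op_powr_dom G (- \<tau> / 2)" and xn: "norm (op_powr G (- \<tau> / 2) x) \<le> C * norm (?k *\<^sub>R e)"
    using S_range_in_G_range[OF \<tau>, of "?k *\<^sub>R e"] by (simp_all only: x)
  have "((\<lambda>f. (\<rho> f powr (- \<tau> / 2) * (x \<bullet> f))\<^sup>2) has_sum (norm (op_powr G (- \<tau> / 2) x))\<^sup>2) F"
    using diag_norm[OF F_basis] xd unfolding G_powr G_powr_dom .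
  then have "((\<lambda>f. ?M * (\<rho> f powr (- \<tau> / 2) * (x \<bullet> f))\<^sup>2) has_sum (?M * (norm (op_powr G (- \<tau> / 2) x))\<^sup>2)) F"
    by (rule has_sum_cmult_right)
  ultimately have "(norm (adjoint (kalman_gain A S \<alpha>) (\<Sum>j<m. (adjoint (propagator \<alpha>) ^^ j) (op_powr S (t / 2) e))))\<^sup>2
      \<le> ?M * (norm (op_powr G (- \<tau> / 2) x))\<^sup>2"
  proof (rule has_sum_mono)
    fix f assume f: "f \<in> F"
    have "\<rho> f * (c f)\<^sup>2 \<le> ?M * \<rho> f powr (- \<tau>)"
      unfolding c_def damping_def by (rule noise_filter_bound[OF \<alpha> rho_pos[OF f] m n \<tau>])
    also have "\<rho> f powr (- \<tau>) = (\<rho> f powr (- \<tau> / 2))\<^sup>2"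
      by (simp add: power2_eq_square flip: powr_add)
    finally show "\<rho> f * (c f * (x \<bullet> f))\<^sup>2 \<le> ?M * (\<rho> f powr (- \<tau> / 2) * (x \<bullet> f))\<^sup>2"
      unfolding power_mult_distrib mult.assoc[symmetric] by (rule mult_right_mono) simp
  qed
  also have "\<dots> \<le> ?M * (C * norm (?k *\<^sub>R e))\<^sup>2"
    by (intro mult_left_mono power_mono xn) auto
  also have "norm (?k *\<^sub>R e) = ?k" using E_basis e by (simp add: hilbert_basis_def)
  also have "(C * ?k)\<^sup>2 = C\<^sup>2 * \<sigma> e powr (t + 1 - \<tau> * (1 + \<nu>))"
    by (simp add: power_mult_distrib power2_eq_square flip: powr_add)
  finally show ?thesis .
qed

end

section \<open>Second moments\<close>

context prob_space begin

lemma white_noise_moments: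
  assumes W: "white_noise M \<gamma> W" and \<gamma>: "\<gamma> > 0"
  shows "integrable M (W h)" and "expectation (W h) = 0"
    and "integrable M (\<lambda>\<omega>. (W h \<omega>)\<^sup>2)" and "expectation (\<lambda>\<omega>. (W h \<omega>)\<^sup>2) = \<gamma>\<^sup>2 * (norm h)\<^sup>2"
proof -
  have [measurable]: "W g \<in> borel_measurable M" for g using W by (simp add: white_noise_def)
  have "integrable M (W h) \<and> expectation (W h) = 0 \<and> integrable M (\<lambda>\<omega>. (W h \<omega>)\<^sup>2)
    \<and> expectation (\<lambda>\<omega>. (W h \<omega>)\<^sup>2) = \<gamma>\<^sup>2 * (norm h)\<^sup>2"
  proof (cases "h = 0")
    case True
    have "AE \<omega> in M. W (0 *\<^sub>R h + 0 *\<^sub>R h) \<omega> = 0 * W h \<omega> + 0 * W h \<omega>"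
      using W unfolding white_noise_def by blast
    then have 0: "AE \<omega> in M. W h \<omega> = 0" by (simp add: True)
    then have 1: "AE \<omega> in M. (W h \<omega>)\<^sup>2 = 0" by eventually_elim simp
    have "integrable M (W h) \<longleftrightarrow> integrable M (\<lambda>_. 0::real)"
      by (rule integrable_cong_AE[OF _ _ 0]) simp_all
    moreover have "expectation (W h) = expectation (\<lambda>_. 0::real)"
      by (rule integral_cong_AE[OF _ _ 0]) simp_all
    moreover have "integrable M (\<lambda>\<omega>. (W h \<omega>)\<^sup>2) \<longleftrightarrow> integrable M (\<lambda>_. 0::real)"
      by (rule integrable_cong_AE[OF _ _ 1]) simp_all
    moreover have "expectation (\<lambda>\<omega>. (W h \<omega>)\<^sup>2) = expectation (\<lambda>_. 0::real)"
      by (rule integral_cong_AE[OF _ _ 1]) simp_all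
    ultimately show ?thesis using True by simp
  next
    case False
    define s where "s = \<gamma> * norm h"
    have s: "s > 0" using False \<gamma> by (simp add: s_def)
    have D: "distributed M lborel (W h) (\<lambda>x. ennreal (normal_density 0 s x))"
      using W False unfolding white_noise_def s_def by blast
    have "integrable lborel (\<lambda>x. normal_density 0 s x * x)"
      using integrable_normal_moment_nz_1[OF s, of 0] .
    then have 1: "integrable M (W h)"
      using distributed_integrable[OF D, of "\<lambda>x. x"] by simp
    have 2: "expectation (W h) = 0"
      using distributed_integral[OF D, of "\<lambda>x. x"] integral_normal_moment_nz_1[OF s, of 0] by simp
    have "integrable lborel (\<lambda>x. normal_density 0 s x * x\<^sup>2)"
      using integrable_normal_moment[OF s, of 0 2] by simp
    then have 3: "integrable M (\<lambda>\<omega>. (W h \<omega>)\<^sup>2)"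
      using distributed_integrable[OF D, of "\<lambda>x. x\<^sup>2"] by simp
    have "expectation (\<lambda>\<omega>. (W h \<omega>)\<^sup>2) = (LINT x|lborel. normal_density 0 s x * x\<^sup>2)"
      using distributed_integral[OF D, of "\<lambda>x. x\<^sup>2"] by simp
    also have "\<dots> = s\<^sup>2"
      using integral_normal_moment_even[OF s, of 0 1] s by (simp add: fact_2)
    finally show ?thesis using 1 2 3 by (simp add: s_def power_mult_distrib)
  qed
  then show "integrable M (W h)" "expectation (W h) = 0" "integrable M (\<lambda>\<omega>. (W h \<omega>)\<^sup>2)"
    "expectation (\<lambda>\<omega>. (W h \<omega>)\<^sup>2) = \<gamma>\<^sup>2 * (norm h)\<^sup>2" by auto
qed

text \<open>Independent centred variables are orthogonal, so second moments add up.\<close>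

lemma iid_white_noise_second_moment:
  assumes \<eta>: "iid_white_noise M \<gamma> \<eta>" and \<gamma>: "\<gamma> > 0" and I: "finite I" "I \<subseteq> {1..}"
  shows "integrable M (\<lambda>\<omega>. (\<Sum>k\<in>I. \<eta> k (h k) \<omega>)\<^sup>2)"
    and "expectation (\<lambda>\<omega>. (\<Sum>k\<in>I. \<eta> k (h k) \<omega>)\<^sup>2) = \<gamma>\<^sup>2 * (\<Sum>k\<in>I. (norm (h k))\<^sup>2)"
proof -
  define X where "X k \<omega> = \<eta> k (h k) \<omega>" for k \<omega>
  have wn: "white_noise M \<gamma> (\<eta> k)" if "k \<in> I" for k
    using \<eta> I(2) that by (auto simp: iid_white_noise_def)
  have "indep_vars (\<lambda>_. \<Pi>\<^sub>M h\<in>UNIV. borel) (\<lambda>k \<omega> h. \<eta> k h \<omega>) {1..}"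
    using \<eta> by (simp add: iid_white_noise_def)
  then have "indep_vars (\<lambda>_. borel) (\<lambda>k \<omega>. (\<lambda>f. f (h k)) (\<lambda>h. \<eta> k h \<omega>)) {1..}"
    by (rule indep_vars_compose2) (rule measurable_component_singleton, simp)
  then have ind: "indep_vars (\<lambda>_. borel) X {1..}" by (simp add: X_def[abs_def])
  have pair: "integrable M (\<lambda>\<omega>. X i \<omega> * X j \<omega>) \<and>
      expectation (\<lambda>\<omega>. X i \<omega> * X j \<omega>) = (if i = j then \<gamma>\<^sup>2 * (norm (h i))\<^sup>2 else 0)"
    if ij: "i \<in> I" "j \<in> I" for i j
  proof (cases "i = j")
    case True
    then show ?thesis using white_noise_moments(3,4)[OF wn[OF ij(1)] \<gamma>, of "h i"]
      by (simp add: X_def power2_eq_square)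
  next
    case False
    have ind': "indep_vars (\<lambda>_. borel) X {i, j}"
      by (rule indep_vars_subset[OF ind]) (use ij I(2) in auto)
    have int: "integrable M (X k)" "expectation (X k) = 0" if "k \<in> {i, j}" for k
      using white_noise_moments(1,2)[OF wn \<gamma>, of k "h k"] that ij unfolding X_def by auto
    show ?thesis
      using indep_vars_lebesgue_integral[OF _ ind' int(1)] indep_vars_integrable[OF _ ind' int(1)] False int(2)
      by simp
  qed
  have sq: "(\<Sum>k\<in>I. \<eta> k (h k) \<omega>)\<^sup>2 = (\<Sum>i\<in>I. \<Sum>j\<in>I. X i \<omega> * X j \<omega>)" for \<omega>
    by (simp add: X_def power2_eq_square sum_product)
  show "integrable M (\<lambda>\<omega>. (\<Sum>k\<in>I. \<eta> k (h k) \<omega>)\<^sup>2)"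
    unfolding sq using pair by (intro Bochner_Integration.integrable_sum) blast
  have "expectation (\<lambda>\<omega>. (\<Sum>k\<in>I. \<eta> k (h k) \<omega>)\<^sup>2) = (\<Sum>i\<in>I. \<Sum>j\<in>I. expectation (\<lambda>\<omega>. X i \<omega> * X j \<omega>))"
    unfolding sq using pair by (simp add: Bochner_Integration.integral_sum)
  also have "\<dots> = (\<Sum>i\<in>I. \<Sum>j\<in>I. if i = j then \<gamma>\<^sup>2 * (norm (h i))\<^sup>2 else 0)"
    by (intro sum.cong refl) (simp add: pair)
  also have "\<dots> = \<gamma>\<^sup>2 * (\<Sum>k\<in>I. (norm (h k))\<^sup>2)"
    using I(1) by (simp add: sum_distrib_left)
  finally show "expectation (\<lambda>\<omega>. (\<Sum>k\<in>I. \<eta> k (h k) \<omega>)\<^sup>2) = \<gamma>\<^sup>2 * (\<Sum>k\<in>I. (norm (h k))\<^sup>2)" .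
qed

end

lemma nn_integral_count_space_has_sum:
  fixes g :: "'a \<Rightarrow> real"
  assumes "(g has_sum l) E" "\<And>e. e \<in> E \<Longrightarrow> g e \<ge> 0"
  shows "(\<integral>\<^sup>+e. ennreal (g e) \<partial>count_space E) = ennreal l"
proof -
  have abs: "Infinite_Set_Sum.abs_summable_on g E"
    unfolding abs_summable_equivalent[symmetric] summable_on_iff_abs_summable_on_real[symmetric]
    by (rule has_sum_imp_summable[OF assms(1)])
  have "infsetsum g E = l" using infsetsum_infsum[OF abs] infsumI[OF assms(1)] by simp
  then show ?thesis using nn_integral_conv_infsetsum[OF abs] assms(2) by simp
qed

lemma has_sum_finite_sum:
  fixes f :: "'i \<Rightarrow> 'a \<Rightarrow> 'b::topological_comm_monoid_add"
  assumes "finite I" "\<And>i. i \<in> I \<Longrightarrow> (f i has_sum l i) A"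
  shows "((\<lambda>x. \<Sum>i\<in>I. f i x) has_sum (\<Sum>i\<in>I. l i)) A"
  using assms by (induction I) (auto intro: has_sum_add)

context linked_operator begin

text \<open>The trace may be evaluated in the eigenbasis: by Parseval, a partial sum of eigenvalues is
  the sum over any other basis of a part of the diagonal entries.\<close>

lemma sum_eigenvalues_le_trace:
  assumes dom: "op_powr_dom S q = UNIV" and tr: "positive_trace_class (op_powr S q)"
  shows "(\<lambda>e. \<sigma> e powr q) summable_on E" and "infsum (\<lambda>e. \<sigma> e powr q) E \<le> op_trace (op_powr S q)"
proof -
  let ?T = "op_powr S q"
  define E' :: "'x set" where "E' = (SOME E. hilbert_basis E)"
  have E': "hilbert_basis E'"
    unfolding E'_def using E_basis by (rule someI)
  have sum: "((\<lambda>h. ?T h \<bullet> h) has_sum op_trace ?T) E'"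
    using tr E' unfolding op_trace_def E'_def[symmetric] positive_trace_class_def by simp
  have fin: "(\<Sum>e\<in>H. \<sigma> e powr q) \<le> op_trace ?T" if H: "finite H" "H \<subseteq> E" for H
  proof -
    have "((\<lambda>h. \<Sum>e\<in>H. \<sigma> e powr q * (e \<bullet> h)\<^sup>2) has_sum (\<Sum>e\<in>H. \<sigma> e powr q * (norm e)\<^sup>2)) E'"
      by (intro has_sum_finite_sum H has_sum_cmult_right parseval[OF E'])
    moreover have "(\<Sum>e\<in>H. \<sigma> e powr q * (norm e)\<^sup>2) = (\<Sum>e\<in>H. \<sigma> e powr q)"
      using E_basis H(2) by (intro sum.cong) (auto simp: hilbert_basis_def)
    ultimately have "((\<lambda>h. \<Sum>e\<in>H. \<sigma> e powr q * (e \<bullet> h)\<^sup>2) has_sum (\<Sum>e\<in>H. \<sigma> e powr q)) E'"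
      by simp
    then show ?thesis
    proof (rule has_sum_mono[OF _ sum])
      fix h :: 'x
      have "h \<in> op_powr_dom S q" using dom by simp
      then have "((\<lambda>e. \<sigma> e powr q * (h \<bullet> e) * (h \<bullet> e)) has_sum (?T h \<bullet> h)) E"
        unfolding S_powr S_powr_dom by (rule diag_inner_has_sum[OF E_basis])
      from finite_sum_le_has_sum[OF this H]
      show "(\<Sum>e\<in>H. \<sigma> e powr q * (e \<bullet> h)\<^sup>2) \<le> ?T h \<bullet> h"
        by (simp add: power2_eq_square mult.assoc inner_commute)
    qed
  qed
  show summable: "(\<lambda>e. \<sigma> e powr q) summable_on E"
    by (rule nonneg_bounded_partial_sums_imp_summable_on[where C = "op_trace ?T"])
       (auto simp: eventually_finite_subsets_at_top intro!: exI[of _ "{}"] fin)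
  show "infsum (\<lambda>e. \<sigma> e powr q) E \<le> op_trace ?T"
    by (rule infsum_le_finite_sums[OF summable]) (rule fin)
qed

text \<open>Countability of the eigenbasis permits the exchange of its sum with the expectation.\<close>

lemma countable_E: "countable E"
proof -
  have "\<sigma> summable_on E"
    using S_trace E_basis unfolding positive_trace_class_def \<sigma>_def by blast
  then have "countable {e\<in>E. \<sigma> e \<noteq> 0}" by (rule summable_countable_real)
  also have "{e\<in>E. \<sigma> e \<noteq> 0} = E" using sigma_pos by fastforce
  finally show ?thesis .
qed

section \<open>The averaged error\<close>

text \<open>The noise part of the sum of the errors \<open>1, \<dots>, n\<close>: the innovation \<open>N\<^sub>k\<close> enters in step \<open>k\<close> and has been
  propagated \<open>j = 0, \<dots>, n - k\<close> times in the errors from step \<open>k\<close> on.\<close>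

definition "noise_sum \<alpha> N n = (\<Sum>k=1..n. \<Sum>j<n + 1 - k. (propagator \<alpha> ^^ j) (N k))"

text \<open>The terms \<open>L\<^sup>i\<^sup>-\<^sup>k N\<^sub>k\<close> of the \<open>i\<close>-th error are regrouped by \<open>k\<close>, because the innovations \<open>N\<^sub>k\<close> are the
  independent quantities.\<close>

lemma sum_error:
  assumes \<alpha>: "\<alpha> > 0" and d0: "d 0 = w" and step: "\<And>n. n \<ge> 1 \<Longrightarrow> d n = N n + propagator \<alpha> (d (n - 1))"
  shows "(\<Sum>i=1..n. d i) = (\<Sum>i=1..n. (propagator \<alpha> ^^ i) w) + noise_sum \<alpha> N n"
proof -
  interpret L: bounded_linear "propagator \<alpha>" by (rule propagator_bounded_linear[OF \<alpha>])
  have d: "d n = (propagator \<alpha> ^^ n) w + (\<Sum>k=1..n. (propagator \<alpha> ^^ (n - k)) (N k))" for n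
  proof (induction n)
    case 0
    show ?case by (simp add: d0)
  next
    case (Suc n)
    have "propagator \<alpha> (\<Sum>k=1..n. (propagator \<alpha> ^^ (n - k)) (N k)) = (\<Sum>k=1..n. (propagator \<alpha> ^^ (Suc n - k)) (N k))"
      unfolding L.sum by (intro sum.cong) (auto simp: Suc_diff_le)
    then show ?case using step[of "Suc n"] by (simp add: Suc L.add)
  qed
  show ?thesis
  proof (induction n)
    case 0
    show ?case by (simp add: noise_sum_def)
  next
    case (Suc n)
    have "noise_sum \<alpha> N (Suc n) = (\<Sum>k=1..n. \<Sum>j<Suc (n + 1 - k). (propagator \<alpha> ^^ j) (N k)) + N (Suc n)"
      unfolding noise_sum_def by (simp add: Suc_diff_le)
    also have "\<dots> = noise_sum \<alpha> N n + ((\<Sum>k=1..n. (propagator \<alpha> ^^ (Suc n - k)) (N k)) + N (Suc n))"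
      unfolding noise_sum_def by (simp add: sum.distrib)
    also have "(\<Sum>k=1..n. (propagator \<alpha> ^^ (Suc n - k)) (N k)) + N (Suc n) = (\<Sum>k=1..Suc n. (propagator \<alpha> ^^ (Suc n - k)) (N k))"
      by simp
    finally have ns: "noise_sum \<alpha> N (Suc n) = noise_sum \<alpha> N n + (\<Sum>k=1..Suc n. (propagator \<alpha> ^^ (Suc n - k)) (N k))" .
    have "(\<Sum>i=1..Suc n. d i) = (\<Sum>i=1..n. d i) + d (Suc n)" by simp
    also have "\<dots> = ((\<Sum>i=1..n. (propagator \<alpha> ^^ i) w) + noise_sum \<alpha> N n)
        + ((propagator \<alpha> ^^ Suc n) w + (\<Sum>k=1..Suc n. (propagator \<alpha> ^^ (Suc n - k)) (N k)))"
      unfolding Suc.IH d[of "Suc n"] ..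
    also have "\<dots> = ((\<Sum>i=1..n. (propagator \<alpha> ^^ i) w) + (propagator \<alpha> ^^ Suc n) w) + noise_sum \<alpha> N (Suc n)"
      unfolding ns by (simp only: add_ac)
    finally show ?case by simp
  qed
qed

lemma noise_sum_inner:
  assumes \<alpha>: "\<alpha> > 0"
  shows "noise_sum \<alpha> N n \<bullet> y = (\<Sum>k=1..n. N k \<bullet> (\<Sum>j<n + 1 - k. (adjoint (propagator \<alpha>) ^^ j) y))"
  unfolding noise_sum_def by (simp add: inner_sum_left inner_sum_right propagator_power_inner[OF \<alpha>])

text \<open>The mean square of the noise part is computed coefficientwise in the eigenbasis of \<open>S\<close>. Every
  coefficient is a sum of independent centred Gaussian variables; the bounds of their variances by
  a power of \<open>\<sigma>\<close> are summed over the eigenbasis and produce the trace.\<close>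

lemma noise_second_moment:
  fixes M :: "'w measure"
  assumes \<alpha>: "\<alpha> > 0" and \<gamma>: "\<gamma> > 0" and n: "n \<ge> 1" and t: "0 \<le> t" and \<tau>: "0 \<le> \<tau>" "\<tau> \<le> 1"
    and tr: "op_powr_dom S (t + 1 - \<tau> * (1 + \<nu>)) = UNIV" "positive_trace_class (op_powr S (t + 1 - \<tau> * (1 + \<nu>)))"
    and M: "prob_space M" and \<eta>: "iid_white_noise M \<gamma> \<eta>"
    and N: "\<And>k. k \<ge> 1 \<Longrightarrow> N k \<in> borel_measurable M"
      "\<And>k x. k \<ge> 1 \<Longrightarrow> AE \<omega> in M. N k \<omega> \<bullet> x = \<eta> k (adjoint (kalman_gain A S \<alpha>) x) \<omega>"
  defines "V \<equiv> \<lambda>\<omega>. (1 / real n) *\<^sub>R noise_sum \<alpha> (\<lambda>k. N k \<omega>) n"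
  shows "V \<in> borel_measurable M"
    and "integrable M (\<lambda>\<omega>. (norm (op_powr S (t / 2) (V \<omega>)))\<^sup>2)"
    and "(LINT \<omega>|M. (norm (op_powr S (t / 2) (V \<omega>)))\<^sup>2)
      \<le> C\<^sup>2 * (\<gamma>\<^sup>2 / \<alpha> * op_trace (op_powr S (t + 1 - \<tau> * (1 + \<nu>))) * (real n / \<alpha>) powr (- \<tau>))"
proof -
  interpret prob_space M by (rule M)
  define q where "q = t + 1 - \<tau> * (1 + \<nu>)"
  define \<beta> where "\<beta> = C\<^sup>2 * (\<gamma>\<^sup>2 / \<alpha> * (real n / \<alpha>) powr (- \<tau>))"
  have \<beta>: "\<beta> \<ge> 0" using \<alpha> by (simp add: \<beta>_def)
  have meas: "T \<in> borel_measurable borel" if "bounded_linear T" for T :: "'x \<Rightarrow> 'x"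
    by (intro borel_measurable_continuous_onI linear_continuous_on that)
  have pm: "(\<lambda>\<omega>. (propagator \<alpha> ^^ j) (N k \<omega>)) \<in> borel_measurable M" if "k \<ge> 1" for j k
    by (rule measurable_compose[OF N(1)[OF that] meas[OF funpow_bounded_linear[OF propagator_bounded_linear[OF \<alpha>]]]])
  show V[measurable]: "V \<in> borel_measurable M"
    unfolding V_def noise_sum_def by (intro borel_measurable_scaleR borel_measurable_const borel_measurable_sum pm) simp
  have T[measurable]: "op_powr S (t / 2) \<in> borel_measurable borel"
    by (rule meas[OF S_powr_bounded_linear]) (use t in simp)
  define h where "h e k = adjoint (kalman_gain A S \<alpha>) (\<Sum>j<n + 1 - k. (adjoint (propagator \<alpha>) ^^ j) (op_powr S (t / 2) e))" for e k
  have coef: "(\<integral>\<^sup>+\<omega>. ennreal ((op_powr S (t / 2) (V \<omega>) \<bullet> e)\<^sup>2) \<partial>M) \<le> ennreal (\<beta> * \<sigma> e powr q)" if e: "e \<in> E" for e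
  proof -
    have "AE \<omega> in M. \<forall>k\<in>{1..n}. N k \<omega> \<bullet> (\<Sum>j<n + 1 - k. (adjoint (propagator \<alpha>) ^^ j) (op_powr S (t / 2) e)) = \<eta> k (h e k) \<omega>"
      unfolding h_def by (intro AE_finite_allI N(2)) auto
    then have "AE \<omega> in M. ennreal ((op_powr S (t / 2) (V \<omega>) \<bullet> e)\<^sup>2) = ennreal ((1 / real n)\<^sup>2 * (\<Sum>k=1..n. \<eta> k (h e k) \<omega>)\<^sup>2)"
    proof eventually_elim
      case (elim \<omega>)
      have "op_powr S (t / 2) (V \<omega>) \<bullet> e = V \<omega> \<bullet> op_powr S (t / 2) e"
        using t by (intro S_powr_symmetric) simp
      also have "\<dots> = (1 / real n) * (\<Sum>k=1..n. \<eta> k (h e k) \<omega>)"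
        using elim by (simp add: V_def noise_sum_inner[OF \<alpha>])
      finally show ?case by (simp only: power_mult_distrib)
    qed
    then have "(\<integral>\<^sup>+\<omega>. ennreal ((op_powr S (t / 2) (V \<omega>) \<bullet> e)\<^sup>2) \<partial>M)
        = (\<integral>\<^sup>+\<omega>. ennreal ((1 / real n)\<^sup>2 * (\<Sum>k=1..n. \<eta> k (h e k) \<omega>)\<^sup>2) \<partial>M)"
      by (rule nn_integral_cong_AE)
    also have "\<dots> = ennreal (expectation (\<lambda>\<omega>. (1 / real n)\<^sup>2 * (\<Sum>k=1..n. \<eta> k (h e k) \<omega>)\<^sup>2))"
      using iid_white_noise_second_moment(1)[OF \<eta> \<gamma>, of "{1..n}" "h e"]
      by (intro nn_integral_eq_integral) auto
    also have "expectation (\<lambda>\<omega>. (1 / real n)\<^sup>2 * (\<Sum>k=1..n. \<eta> k (h e k) \<omega>)\<^sup>2) = (1 / real n)\<^sup>2 * (\<gamma>\<^sup>2 * (\<Sum>k=1..n. (norm (h e k))\<^sup>2))"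
      using iid_white_noise_second_moment(2)[OF \<eta> \<gamma>, of "{1..n}" "h e"] by simp
    also have "\<dots> \<le> (1 / real n)\<^sup>2 * (\<gamma>\<^sup>2 * (\<Sum>k=1..n. (real n / \<alpha>) powr (1 - \<tau>) * (C\<^sup>2 * \<sigma> e powr q)))"
      unfolding h_def q_def
      by (intro mult_left_mono sum_mono noise_coefficient_bound[OF \<alpha> n _ t \<tau> e]) auto
    also have "\<dots> = \<gamma>\<^sup>2 * (C\<^sup>2 * \<sigma> e powr q) * ((real n / \<alpha>) powr (1 - \<tau>) / real n)"
      using n by (simp add: power2_eq_square field_simps)
    also have "(real n / \<alpha>) powr (1 - \<tau>) / real n = (1 / \<alpha>) * (real n / \<alpha>) powr (- \<tau>)"
      using powr_mult_base[of "real n / \<alpha>" "- \<tau>"] n \<alpha> by (simp add: field_simps)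
    also have "\<gamma>\<^sup>2 * (C\<^sup>2 * \<sigma> e powr q) * ((1 / \<alpha>) * (real n / \<alpha>) powr (- \<tau>)) = \<beta> * \<sigma> e powr q"
      by (simp add: \<beta>_def)
    finally show ?thesis by (simp add: ennreal_leI)
  qed
  note tr' = sum_eigenvalues_le_trace[OF tr, folded q_def]
  have bdd: "(\<integral>\<^sup>+\<omega>. ennreal ((norm (op_powr S (t / 2) (V \<omega>)))\<^sup>2) \<partial>M) \<le> ennreal (\<beta> * op_trace (op_powr S q))"
  proof -
    have "(\<integral>\<^sup>+\<omega>. ennreal ((norm (op_powr S (t / 2) (V \<omega>)))\<^sup>2) \<partial>M)
        = (\<integral>\<^sup>+\<omega>. \<integral>\<^sup>+e. ennreal ((op_powr S (t / 2) (V \<omega>) \<bullet> e)\<^sup>2) \<partial>count_space E \<partial>M)"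
      by (intro nn_integral_cong nn_integral_count_space_has_sum[symmetric] parseval[OF E_basis]) auto
    also have "\<dots> = (\<integral>\<^sup>+e. \<integral>\<^sup>+\<omega>. ennreal ((op_powr S (t / 2) (V \<omega>) \<bullet> e)\<^sup>2) \<partial>M \<partial>count_space E)"
      by (rule nn_integral_count_space_nn_integral[OF countable_E]) measurable
    also have "\<dots> \<le> (\<integral>\<^sup>+e. ennreal (\<beta> * \<sigma> e powr q) \<partial>count_space E)"
      by (intro nn_integral_mono) (simp add: coef)
    also have "\<dots> = ennreal (\<beta> * infsum (\<lambda>e. \<sigma> e powr q) E)"
      using \<beta> by (intro nn_integral_count_space_has_sum has_sum_cmult_right has_sum_infsum tr'(1)) auto
    also have "\<dots> \<le> ennreal (\<beta> * op_trace (op_powr S q))"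
      by (intro ennreal_leI mult_left_mono tr'(2) \<beta>)
    finally show ?thesis .
  qed
  show int: "integrable M (\<lambda>\<omega>. (norm (op_powr S (t / 2) (V \<omega>)))\<^sup>2)"
    using bdd by (intro integrableI_nonneg) (auto simp: less_top[symmetric] top_unique)
  have "op_trace (op_powr S q) \<ge> 0"
    by (rule order_trans[OF infsum_nonneg tr'(2)]) simp
  then have "(LINT \<omega>|M. (norm (op_powr S (t / 2) (V \<omega>)))\<^sup>2) \<le> \<beta> * op_trace (op_powr S q)"
    using bdd \<beta> by (subst (asm) nn_integral_eq_integral[OF int]) auto
  then show "(LINT \<omega>|M. (norm (op_powr S (t / 2) (V \<omega>)))\<^sup>2)
      \<le> C\<^sup>2 * (\<gamma>\<^sup>2 / \<alpha> * op_trace (op_powr S (t + 1 - \<tau> * (1 + \<nu>))) * (real n / \<alpha>) powr (- \<tau>))"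
    by (simp add: \<beta>_def q_def mult_ac)
qed

text \<open>The error is the sum of a deterministic and a random part, and \<open>(a + b)\<^sup>2 \<le> 2 a\<^sup>2 + 2 b\<^sup>2\<close> separates
  them at the price of the factor \<open>2\<close>.\<close>

lemma averaged_error_bound:
  fixes M :: "'w measure"
  assumes \<alpha>: "\<alpha> > 0" and \<gamma>: "\<gamma> > 0" and n: "n \<ge> 1" and s: "0 \<le> s" "s \<le> \<nu> + 2" and t: "0 \<le> t" "t \<le> \<nu>"
    and \<tau>: "0 \<le> \<tau>" "\<tau> \<le> 1"
    and tr: "op_powr_dom S (t + 1 - \<tau> * (1 + \<nu>)) = UNIV" "positive_trace_class (op_powr S (t + 1 - \<tau> * (1 + \<nu>)))"
    and w: "u\<^sub>0 - u\<^sub>d \<in> op_powr_dom S (- s / 2)" and z: "source_solution A S \<nu> s (u\<^sub>0 - u\<^sub>d) z\<^sub>0"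
    and M: "prob_space M" and \<eta>: "iid_white_noise M \<gamma> \<eta>"
    and u: "threedvar M A S \<alpha> u\<^sub>0 (\<lambda>k. observation A u\<^sub>d (\<eta> k)) u"
  shows "integrable M (\<lambda>\<omega>. (scale_norm S t (iterate_average u n \<omega> - u\<^sub>d))\<^sup>2)"
    and "(LINT \<omega>|M. (scale_norm S t (iterate_average u n \<omega> - u\<^sub>d))\<^sup>2)
      \<le> 2 * C\<^sup>2 * ((real n / \<alpha>) powr (- (s + t) / (1 + \<nu>)) * (norm z\<^sub>0)\<^sup>2
        + \<gamma>\<^sup>2 / \<alpha> * op_trace (op_powr S (t + 1 - \<tau> * (1 + \<nu>))) * (real n / \<alpha>) powr (- \<tau>))"
proof -
  interpret prob_space M by (rule M)
  define K where "K = kalman_gain A S \<alpha>"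
  interpret K: bounded_linear K unfolding K_def by (rule kalman_gain_bounded_linear[OF \<alpha>])
  interpret A: bounded_linear A by (rule A_bounded_linear)
  interpret T: bounded_linear "op_powr S (t / 2)" by (rule S_powr_bounded_linear) (use t in simp)
  obtain Ky where Ky: "\<And>k. k \<ge> 1 \<Longrightarrow> cylindrical_image M K (observation A u\<^sub>d (\<eta> k)) (Ky k)"
    "\<And>k \<omega>. k \<ge> 1 \<Longrightarrow> u k \<omega> = Ky k \<omega> + (u (k - 1) \<omega> - K (A (u (k - 1) \<omega>)))"
    and u0: "\<And>\<omega>. u 0 \<omega> = u\<^sub>0"
    using u unfolding threedvar_def Let_def K_def[symmetric] by blast
  \<comment> \<open>The image of the noise alone: the deterministic part of the observation is removed.\<close>
  define N where "N k \<omega> = Ky k \<omega> - K (A u\<^sub>d)" for k \<omega>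
  have Nm: "N k \<in> borel_measurable M" if "k \<ge> 1" for k
    using Ky(1)[OF that] unfolding N_def cylindrical_image_def by (intro borel_measurable_diff) auto
  have Ni: "AE \<omega> in M. N k \<omega> \<bullet> x = \<eta> k (adjoint (kalman_gain A S \<alpha>) x) \<omega>" if "k \<ge> 1" for k x
  proof -
    have ae: "AE \<omega> in M. Ky k \<omega> \<bullet> x = observation A u\<^sub>d (\<eta> k) (adjoint K x) \<omega>"
      using Ky(1)[OF that] unfolding cylindrical_image_def by blast
    have Kx: "K (A u\<^sub>d) \<bullet> x = A u\<^sub>d \<bullet> adjoint K x"
      unfolding K_def adjoint_kalman_gain[OF \<alpha>] by (rule kalman_gain_inner[OF \<alpha>])
    from ae show ?thesis
      by eventually_elim (simp add: N_def inner_diff_left observation_def Kx flip: K_def)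
  qed
  define V where "V \<omega> = (1 / real n) *\<^sub>R noise_sum \<alpha> (\<lambda>k. N k \<omega>) n" for \<omega>
  define b where "b = mean_propagator \<alpha> n (u\<^sub>0 - u\<^sub>d)"
  have err: "iterate_average u n \<omega> - u\<^sub>d = b + V \<omega>" for \<omega>
  proof -
    have step: "u k \<omega> - u\<^sub>d = N k \<omega> + propagator \<alpha> (u (k - 1) \<omega> - u\<^sub>d)" if "k \<ge> 1" for k
      unfolding propagator_def K_def[symmetric] N_def using Ky(2)[OF that, of \<omega>] by (simp add: A.diff K.diff)
    have "iterate_average u n \<omega> - u\<^sub>d = (1 / real n) *\<^sub>R (\<Sum>k=1..n. u k \<omega> - u\<^sub>d)"
      using n by (simp add: iterate_average_def sum_subtractf scaleR_diff_right sum_constant_scaleR)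
    also have "(\<Sum>k=1..n. u k \<omega> - u\<^sub>d) = (\<Sum>i=1..n. (propagator \<alpha> ^^ i) (u\<^sub>0 - u\<^sub>d)) + noise_sum \<alpha> (\<lambda>k. N k \<omega>) n"
      by (rule sum_error[OF \<alpha>, where d = "\<lambda>k. u k \<omega> - u\<^sub>d"]) (simp_all only: u0 step)
    finally show ?thesis by (simp add: b_def V_def mean_propagator_def scaleR_add_right)
  qed
  let ?f = "\<lambda>\<omega>. (scale_norm S t (iterate_average u n \<omega> - u\<^sub>d))\<^sup>2"
  let ?v = "\<lambda>\<omega>. (norm (op_powr S (t / 2) (V \<omega>)))\<^sup>2"
  define \<beta> where "\<beta> = \<gamma>\<^sup>2 / \<alpha> * op_trace (op_powr S (t + 1 - \<tau> * (1 + \<nu>))) * (real n / \<alpha>) powr (- \<tau>)"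
  have V[measurable]: "V \<in> borel_measurable M" and vi: "integrable M ?v" and vle: "expectation ?v \<le> C\<^sup>2 * \<beta>"
    using noise_second_moment[OF \<alpha> \<gamma> n t(1) \<tau> tr M \<eta> Nm Ni] unfolding V_def \<beta>_def by auto
  define \<kappa> where "\<kappa> = (real n / \<alpha>) powr (- (s + t) / (1 + \<nu>)) * (norm z\<^sub>0)\<^sup>2"
  have half: "a / (2 * k) + a / (2 * k) = a / k" for a k :: real
    by (cases "k = 0") (simp_all add: field_simps)
  have bias: "(scale_norm S t b)\<^sup>2 \<le> C\<^sup>2 * \<kappa>"
  proof -
    have "(scale_norm S t b)\<^sup>2 \<le> (C * ((\<alpha> / real n) powr ((s + t) / (2 * (1 + \<nu>))) * norm z\<^sub>0))\<^sup>2"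
      unfolding b_def by (intro power_mono bias_bound[OF \<alpha> n s t w z]) (simp add: scale_norm_def)
    also have "\<dots> = C\<^sup>2 * (((\<alpha> / real n) powr ((s + t) / (2 * (1 + \<nu>))))\<^sup>2 * (norm z\<^sub>0)\<^sup>2)"
      by (simp only: power_mult_distrib)
    also have "((\<alpha> / real n) powr ((s + t) / (2 * (1 + \<nu>))))\<^sup>2 = (\<alpha> / real n) powr ((s + t) / (1 + \<nu>))"
      unfolding power2_eq_square powr_add[symmetric] half ..
    also have "\<alpha> / real n = inverse (real n / \<alpha>)" by simp
    also have "inverse (real n / \<alpha>) powr ((s + t) / (1 + \<nu>)) = (real n / \<alpha>) powr (- (s + t) / (1 + \<nu>))"
      using n \<alpha> by (simp only: inverse_powr powr_minus[symmetric] minus_divide_left)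
    finally show ?thesis unfolding \<kappa>_def .
  qed
  have f_le: "?f \<omega> \<le> 2 * (C\<^sup>2 * \<kappa>) + 2 * ?v \<omega>" for \<omega>
  proof -
    have "?f \<omega> \<le> (scale_norm S t b + norm (op_powr S (t / 2) (V \<omega>)))\<^sup>2"
      unfolding err scale_norm_def T.add by (intro power_mono norm_triangle_ineq) simp
    also have "\<dots> \<le> 2 * (scale_norm S t b)\<^sup>2 + 2 * ?v \<omega>"
      using zero_le_power2[of "scale_norm S t b - norm (op_powr S (t / 2) (V \<omega>))"]
      by (simp add: power2_eq_square algebra_simps)
    finally show ?thesis using bias by linarith
  qed
  have gi: "integrable M (\<lambda>\<omega>. 2 * (C\<^sup>2 * \<kappa>) + 2 * ?v \<omega>)" using vi by simp
  have [measurable]: "op_powr S (t / 2) \<in> borel_measurable borel"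
    by (intro borel_measurable_continuous_onI linear_continuous_on T.bounded_linear_axioms)
  have "?f \<in> borel_measurable M"
    unfolding err scale_norm_def by measurable
  then show fi: "integrable M ?f"
    using f_le by (intro Bochner_Integration.integrable_bound[OF gi]) (auto intro!: AE_I2 order_trans[OF f_le])
  have "expectation ?f \<le> expectation (\<lambda>\<omega>. 2 * (C\<^sup>2 * \<kappa>) + 2 * ?v \<omega>)"
    by (rule integral_mono[OF fi gi f_le])
  also have "\<dots> = 2 * (C\<^sup>2 * \<kappa>) + 2 * expectation ?v"
    using vi by (simp add: prob_space)
  also have "\<dots> \<le> 2 * C\<^sup>2 * (\<kappa> + \<beta>)"
    using vle by (simp add: distrib_left)
  finally show "expectation ?f \<le> 2 * C\<^sup>2 * ((real n / \<alpha>) powr (- (s + t) / (1 + \<nu>)) * (norm z\<^sub>0)\<^sup>2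
      + \<gamma>\<^sup>2 / \<alpha> * op_trace (op_powr S (t + 1 - \<tau> * (1 + \<nu>))) * (real n / \<alpha>) powr (- \<tau>))"
    unfolding \<kappa>_def \<beta>_def .
qed

end

section \<open>The error estimate\<close>

theorem theorem1p6:
  fixes A :: "'x::{real_inner, complete_space, second_countable_topology}
                \<Rightarrow> 'y::{real_inner, complete_space, second_countable_topology}"
    and S :: "'x \<Rightarrow> 'x"
    and \<nu> s t \<tau> :: real
  assumes A: "compact_operator A"
    and S: "positive_trace_class S" "positive_definite S"
           "closure (op_powr_dom S (- 1)) = UNIV"
    and \<nu>: "\<nu> > 0"
    and link: "\<exists>C>1. \<forall>x. (1 / C) * scale_norm S \<nu> x \<le> norm (A x) \<and>
                          norm (A x) \<le> C * scale_norm S \<nu> x"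
    and s: "0 \<le> s" "s \<le> \<nu> + 2"
    and t: "0 \<le> t" "t \<le> \<nu>"
    and \<tau>: "0 \<le> \<tau>" "\<tau> \<le> 1"
    and tr: "op_powr_dom S (t + 1 - \<tau> * (1 + \<nu>)) = UNIV"
            "positive_trace_class (op_powr S (t + 1 - \<tau> * (1 + \<nu>)))"
  shows "\<exists>C'>0. \<forall>\<alpha>>0. \<forall>\<gamma>>0. \<forall>u\<^sub>0 u\<^sub>d (M :: 'w measure) \<eta> u.
           u\<^sub>0 - u\<^sub>d \<in> op_powr_dom S (- s / 2) \<longrightarrow>
           prob_space M \<longrightarrow>
           iid_white_noise M \<gamma> \<eta> \<longrightarrow>
           threedvar M A S \<alpha> u\<^sub>0 (\<lambda>k. observation A u\<^sub>d (\<eta> k)) u \<longrightarrow>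
           (\<exists>!z\<^sub>0. source_solution A S \<nu> s (u\<^sub>0 - u\<^sub>d) z\<^sub>0) \<and>
           (\<forall>z\<^sub>0. source_solution A S \<nu> s (u\<^sub>0 - u\<^sub>d) z\<^sub>0 \<longrightarrow>
              (\<forall>n\<ge>1.
                integrable M (\<lambda>\<omega>. (scale_norm S t (iterate_average u n \<omega> - u\<^sub>d))\<^sup>2) \<and>
                (LINT \<omega>|M. (scale_norm S t (iterate_average u n \<omega> - u\<^sub>d))\<^sup>2)
                \<le> C' * ((real n / \<alpha>) powr (- (s + t) / (1 + \<nu>)) * (norm z\<^sub>0)\<^sup>2
                       + \<gamma>\<^sup>2 / \<alpha> * op_trace (op_powr S (t + 1 - \<tau> * (1 + \<nu>)))
                         * (real n / \<alpha>) powr (- \<tau>))))"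
proof -
  obtain C where C: "C > 1" "\<And>x. (1 / C) * scale_norm S \<nu> x \<le> norm (A x)" "\<And>x. norm (A x) \<le> C * scale_norm S \<nu> x"
    using link by blast
  interpret linked_operator A S \<nu> C
    by unfold_locales (use A S \<nu> C in auto)
  have unique: "\<exists>!z\<^sub>0. source_solution A S \<nu> s w z\<^sub>0" if "w \<in> op_powr_dom S (- s / 2)" for w
    using source_solution_ge_1[OF _ s(2) that] source_solution_less_1[OF s(1) _ that] by (cases "s \<ge> 1") auto
  show ?thesis
  proof (intro exI[of _ "2 * C\<^sup>2"] conjI allI impI)
    show "2 * C\<^sup>2 > 0" using C(1) by simp
  next
    fix \<alpha> \<gamma> :: real and u\<^sub>0 u\<^sub>d :: 'x assume "u\<^sub>0 - u\<^sub>d \<in> op_powr_dom S (- s / 2)"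
    then show "\<exists>!z\<^sub>0. source_solution A S \<nu> s (u\<^sub>0 - u\<^sub>d) z\<^sub>0" by (rule unique)
  next
    fix \<alpha> \<gamma> :: real and u\<^sub>0 u\<^sub>d z\<^sub>0 :: 'x and M :: "'w measure" and \<eta> u n
    assume \<alpha>: "\<alpha> > 0" and \<gamma>: "\<gamma> > 0" and w: "u\<^sub>0 - u\<^sub>d \<in> op_powr_dom S (- s / 2)" and M: "prob_space M"
      and \<eta>: "iid_white_noise M \<gamma> \<eta>" and u: "threedvar M A S \<alpha> u\<^sub>0 (\<lambda>k. observation A u\<^sub>d (\<eta> k)) u"
      and z: "source_solution A S \<nu> s (u\<^sub>0 - u\<^sub>d) z\<^sub>0" and n: "(n :: nat) \<ge> 1"
    note bound = averaged_error_bound[OF \<alpha> \<gamma> n s t \<tau> tr w z M \<eta> u]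
    show "integrable M (\<lambda>\<omega>. (scale_norm S t (iterate_average u n \<omega> - u\<^sub>d))\<^sup>2)" by (rule bound(1))
    show "(LINT \<omega>|M. (scale_norm S t (iterate_average u n \<omega> - u\<^sub>d))\<^sup>2)
      \<le> 2 * C\<^sup>2 * ((real n / \<alpha>) powr (- (s + t) / (1 + \<nu>)) * (norm z\<^sub>0)\<^sup>2
        + \<gamma>\<^sup>2 / \<alpha> * op_trace (op_powr S (t + 1 - \<tau> * (1 + \<nu>))) * (real n / \<alpha>) powr (- \<tau>))"
      by (rule bound(2))
  qed
qed

end
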